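(* Let $n\in\mathbb N$. Assume that $\varphi_0\in C^{[n/2]+3}(\mathbb R^n)$, $\varphi_1\in C^{[n/2]+2}(\mathbb R^n)$, $f\in C^{[n/2]+2}(\mathbb R^n\times(0,\infty))$, and that for some $\varepsilon>0$ and constants $C_\alpha$, \[ |\partial_x^\alpha f(x,t)|+|t\,\partial_t\partial_x^\beta f(x,t)|\le C_\alpha\, t^{\varepsilon-2}\quad\text{for all }x\in\mathbb R^n\text{ and all sufficiently small }t>0, \] for all multi-indices $\alpha,\beta$ with $|\alpha|\le [n/2]+2$, $|\beta|\le[n/2]+1$. Define, for $x\in\mathbb R^n$, $t>0$, \[ \psi(x,t)=\frac32 t^2\int_0^1 db\int_0^{1-b^{1/3}} ds\; b\, v_f(x,3t^{1/3}s;tb)\,\big(1+b^{2/3}-s^2\big) +t^{-1}v_{\varphi_0}(x,3t^{1/3})-3t^{-2/3}(\partial_r v_{\varphi_0})(x,3t^{1/3})+\frac32\int_0^1 v_{\varphi_1}(x,3t^{1/3}s)(1-s^2)\,ds . \] Then $\psi$ is a solution of \[ \psi_{tt}-t^{-4/3}\Delta\psi+2t^{-1}\psi_t=f(x,t),\quad t>0,\ x\in\mathbb R^n, \] with \[ \lim_{t\to0} t\psi(x,t)=\varphi_0(x),\qquad \lim_{t\to0}\Big(t\psi_t(x,t)+\psi(x,t)+3t^{-1/3}\Delta\varphi_0(x)\Big)=\varphi_1(x),\quad x\in\mathbb R^n. \]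
   Context: $\Delta=\sum_{i=1}^n\partial_{x_i}^2$ and $[n/2]$ is the integer part of $n/2$. For a function $h(x,b)$ of $x\in\mathbb R^n$ and a parameter $b$, $v_h(x,r;b)$ denotes the solution $v$ of the Cauchy problem for the free wave equation $v_{rr}-\Delta v=0$ ($x\in\mathbb R^n$), $v(x,0)=h(x,b)$, $v_r(x,0)=0$, evaluated at time $r$ (with $b$ a parameter). If $h=h(x)$ does not depend on a parameter, one writes $v_h(x,r)$, and $\partial_r v_h$ denotes the derivative in the time variable $r$. *)

theory Defs
  imports "HOL-Analysis.Analysis"
begin

definition pdir :: "('a::euclidean_space \<Rightarrow> real) \<Rightarrow> 'a \<Rightarrow> 'a \<Rightarrow> real" where
  "pdir g b x = deriv (\<lambda>s. g (x + s *\<^sub>R b)) 0"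

fun pdirs :: "('a::euclidean_space \<Rightarrow> real) \<Rightarrow> 'a list \<Rightarrow> 'a \<Rightarrow> real" where
  "pdirs g [] = g"
| "pdirs g (b # bs) = pdir (pdirs g bs) b"

definition Ck_on :: "nat \<Rightarrow> 'a set \<Rightarrow> ('a::euclidean_space \<Rightarrow> real) \<Rightarrow> bool" where
  "Ck_on k U g \<longleftrightarrow>
     (\<forall>bs. set bs \<subseteq> Basis \<and> length bs \<le> k \<longrightarrow>
        continuous_on U (pdirs g bs) \<and>
        (length bs < k \<longrightarrow> (\<forall>b\<in>Basis. \<forall>x\<in>U. (\<lambda>s. pdirs g bs (x + s *\<^sub>R b)) differentiable (at 0))))"

definition lap :: "(real^'n::finite \<Rightarrow> real) \<Rightarrow> real^'n \<Rightarrow> real" where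
  "lap g x = (\<Sum>i\<in>UNIV. pdir (pdir g (axis i 1)) (axis i 1) x)"

definition lapx :: "((real^'n::finite) \<times> real \<Rightarrow> real) \<Rightarrow> (real^'n) \<times> real \<Rightarrow> real" where
  "lapx v p = (\<Sum>i\<in>UNIV. pdir (pdir v (axis i 1, 0)) (axis i 1, 0) p)"

definition is_wave_sol :: "(real^'n::finite \<Rightarrow> real) \<Rightarrow> ((real^'n) \<times> real \<Rightarrow> real) \<Rightarrow> bool" where
  "is_wave_sol h v \<longleftrightarrow>
     Ck_on 2 UNIV v \<and>
     (\<forall>p. pdir (pdir v (0, 1)) (0, 1) p = lapx v p) \<and>
     (\<forall>x. v (x, 0) = h x) \<and>
     (\<forall>x. pdir v (0, 1) (x, 0) = 0)"

definition wave :: "(real^'n::finite \<Rightarrow> real) \<Rightarrow> real^'n \<Rightarrow> real \<Rightarrow> real" where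
  "wave h x r = (THE v. is_wave_sol h v) (x, r)"

definition wave_dr :: "(real^'n::finite \<Rightarrow> real) \<Rightarrow> real^'n \<Rightarrow> real \<Rightarrow> real" where
  "wave_dr h x r = deriv (\<lambda>s. wave h x s) r"

definition psi :: "((real^'n) \<times> real \<Rightarrow> real) \<Rightarrow> (real^'n::finite \<Rightarrow> real) \<Rightarrow> (real^'n \<Rightarrow> real)
                    \<Rightarrow> real^'n \<Rightarrow> real \<Rightarrow> real" where
  "psi f \<phi>0 \<phi>1 x t =
     3/2 * t^2 * integral {0..1} (\<lambda>b. integral {0..1 - root 3 b}
        (\<lambda>s. b * wave (\<lambda>y. f (y, t * b)) x (3 * t powr (1/3) * s) * (1 + b powr (2/3) - s^2)))
   + (1 / t) * wave \<phi>0 x (3 * t powr (1/3))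
   - 3 * t powr (-2/3) * wave_dr \<phi>0 x (3 * t powr (1/3))
   + 3/2 * integral {0..1} (\<lambda>s. wave \<phi>1 x (3 * t powr (1/3) * s) * (1 - s^2))"

end

theory Submission
  imports Defs
begin

text \<open>
  Put \<open>u = t \<psi>\<close> and \<open>T = 3 t^(1/3)\<close>. The equation becomes the Euler-Poisson-Darboux type equation
  \<open>u_TT - (2/T) u_T - \<Delta> u = t^(7/3) f\<close>, which is solved by \<open>v - T v_r\<close> and by integrals of solutions \<open>v\<close> of the
  wave equation against \<open>T^2 + \<sigma>^2 - r^2\<close> over \<open>0 \<le> r \<le> T - \<sigma>\<close>. In the source term all derivatives
  fall on \<open>v\<close> and on this kernel, never on the parameter \<open>\<tau>\<close> of \<open>v_f\<close>.

  Classical solutions of the wave equation with data of class C^([n/2] + 2) come from Kirchhoff's formula, applied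
  to two space directions at a time, each application costing one derivative. They are unique by an energy
  estimate with a weight supported in a light cone.
\<close>

section \<open>Functions of class C^k that depend continuously on a parameter\<close>

text \<open>The source term is Duhamel's principle. For fixed \<sigma> the integral over 0 \<le> r
  \<le> T - \<sigma> against the kernel solves the homogeneous equation, vanishes at T = \<sigma>
  and has T-derivative 2 \<sigma>^2 v(x, 0) there. Hence the source \<tau>^(7/3) f d\<sigma> is
  divided by 2 \<sigma>^2 = 18 \<tau>^(2/3), which gives \<tau> f d\<tau> / 18: the origin of the
  factor 1/18. The obstacle is the singularity of f at t = 0, of order t^(\<epsilon> - 2). With e =
  \<epsilon>/2, the factor \<tau>^(2 - e) makes the data and their space derivatives tend to 0 with
  \<tau>, and the weight \<tau>^(e - 1) that remains is integrable: half of \<epsilon> is spent on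
  each. \<open>wave\<close> is a definite description, so the formula has content only once C^2
  solutions are known to be unique, with no growth condition in x and for negative times too.
  \<phi>0 carries one derivative more than \<phi>1 and f because v - T v_r must itself be
  C^2.\<close>

abbreviation dtt :: "('a::euclidean_space \<times> real \<Rightarrow> real) \<Rightarrow> 'a \<times> real \<Rightarrow> real" where
  "dtt v \<equiv> pdir (pdir v (0,1)) (0,1)"

abbreviation Lap :: "('a::euclidean_space \<times> real \<Rightarrow> real) \<Rightarrow> 'a \<times> real \<Rightarrow> real" where
  "Lap v z \<equiv> \<Sum>b\<in>Basis. pdir (pdir v (b,0)) (b,0) z"

abbreviation Laps :: "'a::euclidean_space list \<Rightarrow> ('a \<times> real \<Rightarrow> real) \<Rightarrow> 'a \<times> real \<Rightarrow> real" where
  "Laps es v z \<equiv> \<Sum>e\<leftarrow>es. pdir (pdir v (e,0)) (e,0) z"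

abbreviation has_pdir :: "('a::real_normed_vector \<Rightarrow> real) \<Rightarrow> 'a \<Rightarrow> real \<Rightarrow> 'a \<Rightarrow> bool" where
  "has_pdir g v D x \<equiv> ((\<lambda>s. g (x + s *\<^sub>R v)) has_real_derivative D) (at 0)"

section \<open>Directional and Frechet derivatives\<close>

lemma has_derivative_pdir:
  assumes "(g has_derivative D) (at x)"
  shows "has_pdir g v (D v) x"
proof -
  have "((\<lambda>s::real. x + s *\<^sub>R v) has_derivative (\<lambda>s. s *\<^sub>R v)) (at 0)"
    by (auto intro!: derivative_eq_intros)
  from has_derivative_compose[OF this, of g D] assms
  have "((\<lambda>s. g (x + s *\<^sub>R v)) has_derivative (\<lambda>s. D (s *\<^sub>R v))) (at 0)" by simp
  moreover have "(\<lambda>s. D (s *\<^sub>R v)) = (*) (D v)"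
    using has_derivative_bounded_linear[OF assms] by (auto simp: bounded_linear.linear linear_cmul mult.commute)
  ultimately show ?thesis by (simp add: has_field_derivative_def)
qed

lemma pdir_eq:
  assumes "(g has_derivative D) (at x)"
  shows "pdir g v x = D v"
  unfolding pdir_def using DERIV_imp_deriv[OF has_derivative_pdir[OF assms]] .

lemma pdirI: "has_pdir g v D x \<Longrightarrow> pdir g v x = D"
  unfolding pdir_def by (rule DERIV_imp_deriv)

lemma differentiable_pdir:
  assumes "g differentiable (at x)"
  shows "(g has_derivative (\<lambda>v. pdir g v x)) (at x)"
  using assms pdir_eq unfolding differentiable_def by (metis (no_types, lifting) ext)

lemma has_real_derivative_line_shift:
  fixes x v :: "'a::real_normed_vector" and g :: "'a \<Rightarrow> real"
  assumes "((\<lambda>s. g ((x + c *\<^sub>R v) + s *\<^sub>R v)) has_real_derivative D) (at 0)"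
  shows "((\<lambda>s. g (x + s *\<^sub>R v)) has_real_derivative D) (at c)"
proof -
  have "((\<lambda>s. g (x + (s + c) *\<^sub>R v)) has_real_derivative D) (at 0)"
    using assms by (simp add: algebra_simps)
  thus ?thesis using DERIV_shift[of "\<lambda>s. g (x + s *\<^sub>R v)" D 0 c] by simp
qed

lemma differentiable_line:
  assumes "\<And>y. g differentiable (at y)"
  shows "((\<lambda>s. g (x + s *\<^sub>R v)) has_real_derivative pdir g v (x + c *\<^sub>R v)) (at c)"
  by (rule has_real_derivative_line_shift, rule has_derivative_pdir, rule differentiable_pdir, rule assms)

lemma integral_real_derivative:
  fixes f :: "real \<Rightarrow> real"
  assumes "a \<le> b" "\<And>x. (f has_real_derivative f' x) (at x)"
  shows "integral {a..b} f' = f b - f a"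
  by (rule integral_unique, rule fundamental_theorem_of_calculus[OF assms(1)])
     (use assms(2) in \<open>auto simp: has_real_derivative_iff_has_vector_derivative[symmetric] intro: has_field_derivative_at_within\<close>)

text \<open>\<open>Ck_on\<close> only knows coordinate derivatives, whereas the chain rule and
  linearity in the direction need Frechet differentiability. The increment is split into moves along
  one coordinate at a time; each is controlled by the mean value inequality and the continuity of
  the partial derivative at \<open>x0\<close>.\<close>

lemma partials_imp_has_derivative:
  fixes g :: "'a::euclidean_space \<Rightarrow> real"
  assumes "open U" "x0 \<in> U"
    and part: "\<And>b x. b \<in> Basis \<Longrightarrow> x \<in> U \<Longrightarrow> has_pdir g b (g' b x) x"
    and cont: "\<And>b. b \<in> Basis \<Longrightarrow> continuous_on U (g' b)"
  shows "(g has_derivative (\<lambda>v. \<Sum>b\<in>Basis. (v \<bullet> b) * g' b x0)) (at x0)"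
proof -
  define S where "S A v = (\<Sum>b\<in>A. (v \<bullet> b) *\<^sub>R b)" for A and v :: 'a
  have S_le: "norm (S A v) \<le> real (card A) * norm v" if "A \<subseteq> Basis" for A v
  proof -
    have "norm (S A v) \<le> (\<Sum>b\<in>A. norm ((v \<bullet> b) *\<^sub>R b))" unfolding S_def by (rule norm_sum)
    also have "\<dots> \<le> (\<Sum>b\<in>A. norm v)"
      using that by (intro sum_mono) (auto simp: Basis_le_norm)
    finally show ?thesis by simp
  qed
  have main: "\<forall>e>0. \<exists>d>0. \<forall>v. norm v < d \<longrightarrow>
      \<bar>g (x0 + S A v) - g x0 - (\<Sum>b\<in>A. (v \<bullet> b) * g' b x0)\<bar> \<le> e * norm v"
    if "finite A" "A \<subseteq> Basis" for A
    using that
  proof (induction A rule: finite_induct)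
    case empty
    then show ?case by (auto simp: S_def intro: exI[of _ 1])
  next
    case (insert c A)
    show ?case
    proof (intro allI impI)
      fix e :: real assume "e > 0"
      then obtain d1 where d1: "d1 > 0" "\<And>v. norm v < d1 \<Longrightarrow>
         \<bar>g (x0 + S A v) - g x0 - (\<Sum>b\<in>A. (v \<bullet> b) * g' b x0)\<bar> \<le> e/2 * norm v"
        using insert.IH insert.prems by (meson half_gt_zero insert_subset)
      have cB: "c \<in> Basis" using insert by auto
      obtain r where r: "r > 0" "ball x0 r \<subseteq> U" using assms(1,2) openE by blast
      have "continuous (at x0) (g' c)"
        using cont[OF cB] assms(1,2) continuous_on_eq_continuous_at by blast
      then obtain d2 where d2: "d2 > 0" "\<And>y. dist y x0 < d2 \<Longrightarrow> \<bar>g' c y - g' c x0\<bar> < e/2"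
        unfolding continuous_at_eps_delta using \<open>e > 0\<close> by (metis dist_norm half_gt_zero real_norm_def)
      \<comment> \<open>\<open>norm (S A v)\<close> is at most \<open>card A * norm v\<close>, and
        the move along \<open>c\<close> adds at most \<open>norm v\<close>.\<close>
      define N where "N = real (card A) + 1"
      have N: "N > 0" by (simp add: N_def add_nonneg_pos)
      define d where "d = min d1 (min (d2/N) (r/N))"
      have dpos: "d > 0" using d1 d2 r N by (simp add: d_def)
      show "\<exists>d>0. \<forall>v. norm v < d \<longrightarrow> \<bar>g (x0 + S (insert c A) v) - g x0
          - (\<Sum>b\<in>insert c A. (v \<bullet> b) * g' b x0)\<bar> \<le> e * norm v"
      proof (rule exI[of _ d], safe)
        fix v :: 'a assume v: "norm v < d"
        define y where "y = x0 + S A v"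
        define a where "a = v \<bullet> c"
        have a: "\<bar>a\<bar> \<le> norm v" unfolding a_def using cB by (simp add: Basis_le_norm)
        have near: "dist (y + s *\<^sub>R c) x0 < min d2 r" if "s \<in> closed_segment 0 a" for s
        proof -
          have "\<bar>s\<bar> \<le> \<bar>a\<bar>" using that by (auto simp: closed_segment_eq_real_ivl split: if_splits)
          have "dist (y + s *\<^sub>R c) x0 = norm (S A v + s *\<^sub>R c)" by (simp add: y_def dist_norm)
          also have "\<dots> \<le> norm (S A v) + \<bar>s\<bar>" using norm_triangle_ineq[of "S A v" "s *\<^sub>R c"] cB by simp
          also have "\<dots> \<le> N * norm v" using S_le[of A v] insert.prems \<open>\<bar>s\<bar> \<le> \<bar>a\<bar>\<close> a by (simp add: N_def algebra_simps)
          also have "\<dots> < min d2 r"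
          proof -
            have "norm v < d2/N" "norm v < r/N" using v by (auto simp: d_def)
            thus ?thesis using N by (simp add: field_simps)
          qed
          finally show ?thesis .
        qed
        \<comment> \<open>The mean value inequality along \<open>c\<close> for \<open>g\<close>
          minus the linear function whose slope is frozen at \<open>x0\<close>.\<close>
        have "norm ((\<lambda>s. g (y + s *\<^sub>R c) - s * g' c x0) a - (\<lambda>s. g (y + s *\<^sub>R c) - s * g' c x0) 0) \<le> e/2 * norm (a - 0)"
        proof (rule field_differentiable_bound[of "closed_segment 0 a" _ "\<lambda>s. g' c (y + s *\<^sub>R c) - g' c x0"])
          fix s assume s: "s \<in> closed_segment 0 a"
          have "y + s *\<^sub>R c \<in> U" using near[OF s] r(2) by (auto simp: dist_commute subset_iff)
          from has_real_derivative_line_shift[OF part[OF cB this]]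
          have "((\<lambda>s. g (y + s *\<^sub>R c)) has_real_derivative g' c (y + s *\<^sub>R c)) (at s)" .
          thus "((\<lambda>s. g (y + s *\<^sub>R c) - s * g' c x0) has_real_derivative g' c (y + s *\<^sub>R c) - g' c x0) (at s within closed_segment 0 a)"
            by (auto intro!: derivative_eq_intros intro: has_field_derivative_at_within)
          show "norm (g' c (y + s *\<^sub>R c) - g' c x0) \<le> e/2"
            using d2(2)[of "y + s *\<^sub>R c"] near[OF s] by simp
        qed auto
        hence 1: "\<bar>g (y + a *\<^sub>R c) - g y - a * g' c x0\<bar> \<le> e/2 * \<bar>a\<bar>" by (simp add: algebra_simps)
        have 2: "\<bar>g y - g x0 - (\<Sum>b\<in>A. (v \<bullet> b) * g' b x0)\<bar> \<le> e/2 * norm v"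
          unfolding y_def by (rule d1(2)) (use v d_def in auto)
        have "e/2 * \<bar>a\<bar> \<le> e/2 * norm v" using a \<open>e > 0\<close> by (intro mult_left_mono) auto
        moreover have "x0 + S (insert c A) v = y + a *\<^sub>R c" using insert by (simp add: S_def y_def a_def algebra_simps)
        ultimately have "g (x0 + S (insert c A) v) - g x0 - (\<Sum>b\<in>insert c A. (v \<bullet> b) * g' b x0)
            = (g (y + a *\<^sub>R c) - g y - a * g' c x0) + (g y - g x0 - (\<Sum>b\<in>A. (v \<bullet> b) * g' b x0))"
          and "e/2 * \<bar>a\<bar> + e/2 * norm v \<le> e * norm v"
          using insert.hyps by (simp_all add: a_def)
        thus "\<bar>g (x0 + S (insert c A) v) - g x0
          - (\<Sum>b\<in>insert c A. (v \<bullet> b) * g' b x0)\<bar> \<le> e * norm v"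
          using order_trans[OF abs_triangle_ineq add_mono[OF 1 2]] by simp
      qed (rule dpos)
    qed
  qed
  show ?thesis unfolding has_derivative_within_alt
  proof (intro conjI allI impI)
    show "bounded_linear (\<lambda>v. \<Sum>b\<in>Basis. (v \<bullet> b) * g' b x0)"
      by (intro bounded_linear_sum bounded_linear_mult_const bounded_linear_inner_left)
    fix e :: real assume "e > 0"
    then obtain d where d: "d > 0" "\<And>v. norm v < d \<Longrightarrow>
         \<bar>g (x0 + S Basis v) - g x0 - (\<Sum>b\<in>Basis. (v \<bullet> b) * g' b x0)\<bar> \<le> e * norm v"
      using main[of Basis] by auto
    show "\<exists>d>0. \<forall>y\<in>UNIV. norm (y - x0) < d \<longrightarrow>
        norm (g y - g x0 - (\<Sum>b\<in>Basis. ((y - x0) \<bullet> b) * g' b x0)) \<le> e * norm (y - x0)"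
      using d(1) d(2)[of "y - x0" for y] by (auto simp: S_def euclidean_representation intro!: exI[of _ d])
  qed
qed

text \<open>\<open>Cp k F\<close>: the map \<open>F p\<close> is of class C^k for every \<open>p\<close>, and its derivatives up to order \<open>k\<close> are
  jointly continuous in \<open>p\<close> and the point. No derivative with respect to \<open>p\<close> is involved, which is what
  makes the source term accessible: a solution with data \<open>f(\<cdot>, \<tau>)\<close> is only ever differentiated in space and time.\<close>

primrec Cp :: "nat \<Rightarrow> ('p::topological_space \<Rightarrow> 'a::euclidean_space \<Rightarrow> real) \<Rightarrow> bool" where
  "Cp 0 F \<longleftrightarrow> continuous_on UNIV (\<lambda>(p, x). F p x)"
| "Cp (Suc k) F \<longleftrightarrow> continuous_on UNIV (\<lambda>(p, x). F p x) \<and> (\<forall>p x. F p differentiable (at x)) \<and>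
     (\<forall>v. Cp k (\<lambda>p. pdir (F p) v))"

section \<open>Closure properties of \<open>Cp\<close>\<close>

lemma Cp_continuous: "Cp k F \<Longrightarrow> continuous_on UNIV (\<lambda>(p, x). F p x)"
  by (cases k) auto

lemma Cp_continuous_compose:
  assumes "Cp k F" "continuous_on S P" "continuous_on S X"
  shows "continuous_on S (\<lambda>z. F (P z) (X z))"
  using continuous_on_compose2[OF Cp_continuous[OF assms(1)] continuous_on_Pair[OF assms(2,3)]] by auto

lemma Cp_differentiable: "Cp (Suc k) F \<Longrightarrow> F p differentiable (at x)" by simp

lemma Cp_pdir: "Cp (Suc k) F \<Longrightarrow> Cp k (\<lambda>p. pdir (F p) v)" by simp

lemma Cp_has_derivative: "Cp (Suc k) F \<Longrightarrow> (F p has_derivative (\<lambda>v. pdir (F p) v x)) (at x)"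
  by (rule differentiable_pdir) simp

lemma Cp_line: "Cp (Suc k) F \<Longrightarrow> ((\<lambda>s. F p (x + s *\<^sub>R v)) has_real_derivative pdir (F p) v (x + c *\<^sub>R v)) (at c)"
  by (rule differentiable_line) simp

lemma pdir_linear:
  assumes "g differentiable (at x)"
  shows "pdir g (L :: 'a::euclidean_space) x = (\<Sum>b\<in>Basis. (L \<bullet> b) * pdir g b x)"
proof -
  interpret bounded_linear "\<lambda>v. pdir g v x"
    by (rule has_derivative_bounded_linear[OF differentiable_pdir[OF assms]])
  have "pdir g L x = pdir g (\<Sum>b\<in>Basis. (L \<bullet> b) *\<^sub>R b) x" by (simp add: euclidean_representation)
  thus ?thesis by (simp add: sum scaleR)
qed

lemma Cp_mono_Suc: "Cp (Suc k) F \<Longrightarrow> Cp k F"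
proof (induction k arbitrary: F)
  case (Suc k)
  have "Cp (Suc k) (\<lambda>p. pdir (F p) v)" for v using Cp_pdir[OF Suc.prems] .
  hence "Cp k (\<lambda>p. pdir (F p) v)" for v by (rule Suc.IH)
  moreover have "\<forall>p x. F p differentiable (at x)" using Cp_differentiable[OF Suc.prems] by blast
  ultimately show ?case using Cp_continuous[OF Suc.prems] by (simp only: Cp.simps) blast
qed simp

lemma Cp_mono: "Cp k F \<Longrightarrow> j \<le> k \<Longrightarrow> Cp j F"
  by (induction k) (auto simp: le_Suc_eq dest: Cp_mono_Suc simp del: Cp.simps)

lemma Cp_const: "continuous_on UNIV c \<Longrightarrow> Cp k (\<lambda>p x. c p)"
proof (induction k arbitrary: c)
  case 0 then show ?case by (auto simp: case_prod_beta' intro!: continuous_on_compose2[of UNIV c] continuous_intros)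
next
  case (Suc k)
  have "pdir (\<lambda>x. c p) v = (\<lambda>x. 0)" for p and v :: 'b by (rule ext, rule pdirI) auto
  moreover have "Cp k (\<lambda>(p::'a) (x::'b). 0)" by (rule Suc.IH) auto
  ultimately show ?case using Suc.prems by (auto simp: case_prod_beta' intro!: continuous_on_compose2[of UNIV c] continuous_intros)
qed

lemma Cp_add: "Cp k F \<Longrightarrow> Cp k G \<Longrightarrow> Cp k (\<lambda>p x. F p x + G p x)"
proof (induction k arbitrary: F G)
  case 0 then show ?case by (auto simp: case_prod_beta' intro!: continuous_intros)
next
  case (Suc k)
  have "pdir (\<lambda>x. F p x + G p x) v x = pdir (F p) v x + pdir (G p) v x" for p v x
    by (rule pdir_eq[OF has_derivative_add[OF Cp_has_derivative[OF Suc.prems(1)] Cp_has_derivative[OF Suc.prems(2)]]])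
  hence *: "pdir (\<lambda>x. F p x + G p x) v = (\<lambda>x. pdir (F p) v x + pdir (G p) v x)" for p v by auto
  show ?case using Suc by (auto simp: * case_prod_beta' intro!: continuous_intros)
qed

lemma pdir_mult:
  assumes "F differentiable (at x)" "G differentiable (at x)"
  shows "pdir (\<lambda>x. F x * G x) v x = F x * pdir G v x + pdir F v x * G x"
  by (rule pdir_eq[OF has_derivative_mult[OF differentiable_pdir differentiable_pdir]]) (use assms in auto)

lemma pdir_add:
  assumes "F differentiable (at x)" "G differentiable (at x)"
  shows "pdir (\<lambda>x. F x + G x) v x = pdir F v x + pdir G v x"
  by (rule pdir_eq[OF has_derivative_add[OF differentiable_pdir differentiable_pdir]]) (use assms in auto)

lemma pdir_diff:
  assumes "F differentiable (at x)" "G differentiable (at x)"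
  shows "pdir (\<lambda>x. F x - G x) v x = pdir F v x - pdir G v x"
  by (rule pdir_eq[OF has_derivative_diff[OF differentiable_pdir differentiable_pdir]]) (use assms in auto)

lemma pdir_cmult:
  assumes "g differentiable (at z)"
  shows "pdir (\<lambda>z. c * g z) v z = c * pdir g v z"
  by (rule pdir_eq[OF has_derivative_mult_right[OF differentiable_pdir[OF assms]]])

lemma pdir_snd: "pdir (snd :: 'a::euclidean_space \<times> real \<Rightarrow> real) = (\<lambda>v _. snd v)"
  "(snd :: 'a::euclidean_space \<times> real \<Rightarrow> real) differentiable (at y)"
  using pdir_eq[OF has_derivative_snd[OF has_derivative_ident]] bounded_linear_imp_differentiable[OF bounded_linear_snd]
  by (auto simp: fun_eq_iff)

lemma Cp_mult: "Cp k F \<Longrightarrow> Cp k G \<Longrightarrow> Cp k (\<lambda>p x. F p x * G p x)"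
proof (induction k arbitrary: F G)
  case 0 then show ?case by (auto simp: case_prod_beta' intro!: continuous_intros)
next
  case (Suc k)
  have *: "pdir (\<lambda>x. F p x * G p x) v = (\<lambda>x. F p x * pdir (G p) v x + pdir (F p) v x * G p x)" for p v
    using Suc.prems by (auto simp: pdir_mult)
  have "Cp k (\<lambda>p x. F p x * pdir (G p) v x + pdir (F p) v x * G p x)" for v
    by (intro Cp_add Suc.IH Cp_pdir Suc.prems Cp_mono_Suc)
  then show ?case using Suc.prems by (auto simp: * case_prod_beta' intro!: continuous_intros)
qed

lemma Cp_cmult: "Cp k F \<Longrightarrow> Cp k (\<lambda>p x. c * F p x)"
  by (intro Cp_mult Cp_const) auto

lemma Cp_sum: "finite A \<Longrightarrow> (\<And>i. i \<in> A \<Longrightarrow> Cp k (F i)) \<Longrightarrow> Cp k (\<lambda>p x. \<Sum>i\<in>A. F i p x)"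
  by (induction A rule: finite_induct) (auto intro: Cp_add Cp_const)

lemma Cp_diff: "Cp k F \<Longrightarrow> Cp k G \<Longrightarrow> Cp k (\<lambda>p x. F p x - G p x)"
  using Cp_add[OF _ Cp_cmult[of k G "-1"], of F] by simp

lemma Cp_linear:
  assumes "bounded_linear l"
  shows "Cp k (\<lambda>(p::'p::topological_space) (x::'a::euclidean_space). l x)"
proof (cases k)
  case 0
  then show ?thesis using bounded_linear.continuous_on[OF assms continuous_on_snd[OF continuous_on_id]]
    by (auto simp: case_prod_beta')
next
  case (Suc j)
  have d: "(l has_derivative l) (at x)" for x by (rule bounded_linear_imp_has_derivative[OF assms])
  have "pdir l v = (\<lambda>x. l v)" for v using pdir_eq[OF d] by auto
  then show ?thesis using Suc bounded_linear.continuous_on[OF assms continuous_on_snd[OF continuous_on_id]] d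
    by (auto simp: case_prod_beta' differentiable_def intro: Cp_const)
qed

text \<open>\<open>Cp\<close> asks for Frechet derivatives in all directions; by
  \<open>partials_imp_has_derivative\<close> the coordinate directions suffice, every other
  direction being a fixed linear combination of them.\<close>

lemma Cp_SucI:
  fixes F :: "'p::topological_space \<Rightarrow> 'a::euclidean_space \<Rightarrow> real"
  assumes c: "continuous_on UNIV (\<lambda>(p, x). F p x)"
    and d: "\<And>p x b. b \<in> Basis \<Longrightarrow> has_pdir (F p) b (F' b p x) x"
    and C: "\<And>b. b \<in> Basis \<Longrightarrow> Cp k (F' b)"
  shows "Cp (Suc k) F"
proof -
  have D: "(F p has_derivative (\<lambda>v. \<Sum>b\<in>Basis. (v \<bullet> b) * F' b p x)) (at x)" for p x
    by (rule partials_imp_has_derivative[where U=UNIV])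
       (auto intro!: d Cp_continuous_compose[OF C] continuous_intros)
  have "pdir (F p) v = (\<lambda>x. \<Sum>b\<in>Basis. (v \<bullet> b) * F' b p x)" for p v
    using pdir_eq[OF D] by auto
  moreover have "Cp k (\<lambda>p x. \<Sum>b\<in>Basis. (v \<bullet> b) * F' b p x)" for v
    by (intro Cp_sum Cp_cmult C) auto
  ultimately show ?thesis using c by (auto intro: differentiableI[OF D])
qed

lemma pdir_compose_affine:
  assumes g: "g differentiable (at (A z + c))" and A: "linear (A :: 'b::euclidean_space \<Rightarrow> 'a::euclidean_space)"
  shows "pdir (\<lambda>z. g (A z + c)) v z = pdir g (A v) (A z + c)"
    and "(\<lambda>z. g (A z + c)) differentiable (at z)"
proof -
  have "((\<lambda>z. A z + c) has_derivative A) (at z)"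
    using linear_conv_bounded_linear[of A] A by (auto intro!: derivative_eq_intros bounded_linear_imp_has_derivative)
  from has_derivative_compose[OF this differentiable_pdir[OF g]]
  have "((\<lambda>z. g (A z + c)) has_derivative (\<lambda>v. pdir g (A v) (A z + c))) (at z)" .
  thus "pdir (\<lambda>z. g (A z + c)) v z = pdir g (A v) (A z + c)" "(\<lambda>z. g (A z + c)) differentiable (at z)"
    by (auto simp: pdir_eq differentiable_def)
qed

text \<open>One chain rule serves points on spheres, shifts, time scalings and delays. The parameter
  may move the linear map, the translation and the parameter of \<open>F\<close>, each of them only
  continuously.\<close>

lemma Cp_compose_affine:
  fixes F :: "'p::topological_space \<Rightarrow> 'a::euclidean_space \<Rightarrow> real" and A :: "'q::topological_space \<Rightarrow> 'b::euclidean_space \<Rightarrow> 'a"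
  assumes F: "Cp k F" and lin: "\<And>q. linear (A q)" and A: "\<And>z. continuous_on UNIV (\<lambda>q. A q z)"
    and r: "continuous_on UNIV r" and c: "continuous_on UNIV c"
  shows "Cp k (\<lambda>q z. F (r q) (A q z + c q))"
  using F
proof (induction k arbitrary: F)
  have Ac: "continuous_on UNIV (\<lambda>q. A (fst q) (snd q))"
  proof -
    have eq: "A q z = (\<Sum>b\<in>Basis. (z \<bullet> b) *\<^sub>R A q b)" for q z
      using linear_sum[OF lin, of q "\<lambda>b. (z \<bullet> b) *\<^sub>R b" Basis] linear_cmul[OF lin]
      by (simp add: euclidean_representation)
    have "continuous_on UNIV (\<lambda>p. \<Sum>b\<in>Basis. (snd p \<bullet> b) *\<^sub>R A (fst p) b)"
      by (intro continuous_intros continuous_on_compose2[OF A continuous_on_fst]) auto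
    thus ?thesis by (subst eq)
  qed
  have cont: "continuous_on UNIV (\<lambda>(q, z). F (r q) (A q z + c q))" if "Cp k F" for k F
    unfolding case_prod_beta'
    by (intro Cp_continuous_compose[OF that] continuous_intros Ac
        continuous_on_compose2[OF r continuous_on_fst] continuous_on_compose2[OF c continuous_on_fst]) auto
  {
    case 0 then show ?case using cont[of 0] by simp
  next
    case (Suc k)
    \<comment> \<open>The direction \<open>A q v\<close> varies with \<open>q\<close>, while the
      induction hypothesis handles fixed directions; expanding it in the basis turns the dependence
      on \<open>q\<close> into continuous coefficients.\<close>
    have "pdir (\<lambda>z. F (r q) (A q z + c q)) v z = (\<Sum>b\<in>Basis. (A q v \<bullet> b) * pdir (F (r q)) b (A q z + c q))" for q v z
      using Suc.prems by (auto simp: pdir_compose_affine lin intro!: pdir_linear)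
    hence *: "pdir (\<lambda>z. F (r q) (A q z + c q)) v = (\<lambda>z. \<Sum>b\<in>Basis. (A q v \<bullet> b) * pdir (F (r q)) b (A q z + c q))" for q v by auto
    have "Cp k (\<lambda>q z. \<Sum>b\<in>Basis. (A q v \<bullet> b) * pdir (F (r q)) b (A q z + c q))" for v
      by (intro Cp_sum Cp_mult Cp_const continuous_intros A Suc.IH Cp_pdir[OF Suc.prems]) auto
    then show ?case using cont[OF Suc.prems] Suc.prems
      by (auto simp: * intro: pdir_compose_affine(2)[OF _ lin])
  }
qed

lemma Cp_reparam: "Cp k F \<Longrightarrow> continuous_on UNIV r \<Longrightarrow> Cp k (\<lambda>q. F (r q))"
  using Cp_compose_affine[of k F "\<lambda>q z. z" r "\<lambda>q. 0"] by (auto simp: linear_iff)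

section \<open>Differentiation under the integral sign and symmetry of second derivatives\<close>

lemma Cp_integrable:
  assumes "Cp k F"
  shows "(\<lambda>t. F (p, t) x) integrable_on {a..b::real}"
  by (intro integrable_continuous_real Cp_continuous_compose[OF assms] continuous_intros)

lemma Cp_integral_line:
  fixes F :: "('p::topological_space \<times> real) \<Rightarrow> 'a::euclidean_space \<Rightarrow> real"
  assumes "Cp (Suc k) F"
  shows "((\<lambda>s. integral {a..b} (\<lambda>t. F (p, t) (x + s *\<^sub>R v))) has_real_derivative
     integral {a..b} (\<lambda>t. pdir (F (p, t)) v (x + c *\<^sub>R v))) (at c)"
proof -
  have "((\<lambda>s. integral (cbox a b) (\<lambda>t. F (p, t) (x + s *\<^sub>R v))) has_field_derivative
     integral (cbox a b) ((\<lambda>s t. pdir (F (p, t)) v (x + s *\<^sub>R v)) c)) (at c within UNIV)"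
  proof (rule leibniz_rule_field_derivative)
    show "continuous_on (UNIV \<times> cbox a b) (\<lambda>(s, t). pdir (F (p, t)) v (x + s *\<^sub>R v))"
      unfolding case_prod_beta'
      by (intro Cp_continuous_compose[OF Cp_pdir[OF assms]] continuous_intros)
    show "((\<lambda>s. F (p, t) (x + s *\<^sub>R v)) has_real_derivative pdir (F (p, t)) v (x + s *\<^sub>R v)) (at s within UNIV)" for s t
      using Cp_line[OF assms] by simp
    show "(\<lambda>t. F (p, t) (x + s *\<^sub>R v)) integrable_on cbox a b" for s
      unfolding cbox_interval by (rule Cp_integrable[OF assms])
  qed auto
  thus ?thesis by simp
qed

lemma Cp_pdir_integral:
  fixes F :: "('p::topological_space \<times> real) \<Rightarrow> 'a::euclidean_space \<Rightarrow> real"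
  assumes "Cp (Suc k) F"
  shows "pdir (\<lambda>x. integral {a..b} (\<lambda>t. F (p, t) x)) v = (\<lambda>x. integral {a..b} (\<lambda>t. pdir (F (p, t)) v x))"
  by (rule ext, rule pdirI) (use Cp_integral_line[OF assms, of a b p _ v 0] in simp)

lemma Cp_integral:
  fixes F :: "('p::topological_space \<times> real) \<Rightarrow> 'a::euclidean_space \<Rightarrow> real"
  assumes "Cp k F"
  shows "Cp k (\<lambda>p x. integral {a..b} (\<lambda>t. F (p, t) x))"
  using assms
proof (induction k arbitrary: F)
  have cont: "continuous_on UNIV (\<lambda>(p, x). integral {a..b} (\<lambda>t. F (p, t) x))" if "Cp k F"
    for k and F :: "('p \<times> real) \<Rightarrow> 'a \<Rightarrow> real"
  proof -
    have "continuous_on UNIV (\<lambda>q. integral (cbox a b) ((\<lambda>q t. F (fst q, t) (snd q)) q))"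
      by (rule integral_continuous_on_param)
         (auto simp: case_prod_beta' intro!: Cp_continuous_compose[OF that] continuous_intros)
    thus ?thesis by (simp add: case_prod_beta')
  qed
  {
    case 0 then show ?case using cont[of 0] by simp
  next
    case (Suc k)
    show ?case
      by (rule Cp_SucI[OF cont[OF Suc.prems], where F' = "\<lambda>v p x. integral {a..b} (\<lambda>t. pdir (F (p, t)) v x)"])
         (use Cp_integral_line[OF Suc.prems, where c=0] Suc.IH[OF Cp_pdir[OF Suc.prems]] in auto)
  }
qed

text \<open>Write the increment along \<open>v\<close> as the integral of the derivative along
  \<open>v\<close>, differentiate under the integral along \<open>w\<close>, then differentiate in
  the length \<open>s\<close> of the increment at 0.\<close>

lemma Cp_Schwarz:
  assumes "Cp (Suc (Suc k)) F"
  shows "pdir (pdir (F p) v) w x = pdir (pdir (F p) w) v x"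
proof -
  have 2: "Cp (Suc k) (\<lambda>(q::('a \<times> real)) z. pdir (F (fst q)) v (z + snd q *\<^sub>R v))"
    by (intro Cp_compose_affine[where A="\<lambda>q z. z"] Cp_pdir[OF assms]) (auto simp: linear_iff intro!: continuous_intros)
  have FTC: "F p (y + s *\<^sub>R v) - F p y = integral {0..s} (\<lambda>\<sigma>. pdir (F p) v (y + \<sigma> *\<^sub>R v))" if "s \<ge> 0" for y s
    using integral_real_derivative[OF that Cp_line[OF assms, of p y v]] by simp
  have eq: "pdir (F p) w (x + s *\<^sub>R v) - pdir (F p) w x = integral {0..s} (\<lambda>\<sigma>. pdir (pdir (F p) v) w (x + \<sigma> *\<^sub>R v))"
    if "s \<ge> 0" for s
  proof -
    have "((\<lambda>t. integral {0..s} (\<lambda>\<sigma>. pdir (F p) v ((x + t *\<^sub>R w) + \<sigma> *\<^sub>R v))) has_real_derivative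
       integral {0..s} (\<lambda>\<sigma>. pdir (pdir (F p) v) w (x + \<sigma> *\<^sub>R v))) (at 0)"
      using Cp_integral_line[OF 2, of 0 s p x w 0] pdir_compose_affine(1)[where A="\<lambda>z. z" and g="pdir (F p) v"] Cp_pdir[OF assms]
      by (simp add: linear_iff)
    moreover have "((\<lambda>t. F p ((x + t *\<^sub>R w) + s *\<^sub>R v) - F p (x + t *\<^sub>R w)) has_real_derivative
       pdir (F p) w (x + s *\<^sub>R v) - pdir (F p) w x) (at 0)"
      using Cp_line[OF assms, of p "x + s *\<^sub>R v" w 0] Cp_line[OF assms, of p x w 0]
      by (intro derivative_intros) (simp_all add: algebra_simps)
    ultimately show ?thesis unfolding FTC[OF that] by (rule DERIV_unique[rotated])
  qed
  have c: "continuous_on {0..1} (\<lambda>\<sigma>. pdir (pdir (F p) v) w (x + \<sigma> *\<^sub>R v))"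
    using Cp_pdir[OF Cp_pdir[OF assms]] by (rule Cp_continuous_compose) (intro continuous_intros)+
  have a: "((\<lambda>s. integral {0..s} (\<lambda>\<sigma>. pdir (pdir (F p) v) w (x + \<sigma> *\<^sub>R v))) has_real_derivative pdir (pdir (F p) v) w x) (at 0 within {0..1})"
    using integral_has_real_derivative[OF c, of 0] by simp
  have "((\<lambda>s. pdir (F p) w (x + s *\<^sub>R v) - pdir (F p) w x) has_real_derivative pdir (pdir (F p) v) w x) (at 0 within {0..1})"
    by (rule has_field_derivative_transform_within[OF a, of 1]) (auto simp: eq)
  moreover have "((\<lambda>s. pdir (F p) w (x + s *\<^sub>R v) - pdir (F p) w x) has_real_derivative pdir (pdir (F p) w) v x) (at 0 within {0..1})"
    using Cp_line[OF Cp_pdir[OF assms], of p w x v 0]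
    by (auto intro!: derivative_eq_intros intro: has_field_derivative_at_within)
  \<comment> \<open>The integral form holds for s \<ge> 0 only, so the two derivatives are compared
    as one-sided ones.\<close>
  moreover have "at 0 within {0..1} \<noteq> (bot :: real filter)"
    by (simp add: at_within_Icc_at_right trivial_limit_at_right_real)
  ultimately show ?thesis by (auto intro: vector_derivative_unique_within simp: has_real_derivative_iff_has_vector_derivative)
qed

section \<open>Spherical means in three variables\<close>

text \<open>The sphere of radius \<open>snd z\<close> about \<open>(fst z, 0)\<close> in the three
  variables \<open>a\<close>, \<open>b\<close> and time, with the time axis as polar axis: the time
  slot of \<open>w\<close> serves as a third space variable. For fixed angles the map is linear in
  \<open>z\<close>, so \<open>Cp_compose_affine\<close> applies.\<close>

definition sph_lin :: "'a::euclidean_space \<Rightarrow> 'a \<Rightarrow> real \<Rightarrow> real \<Rightarrow> 'a \<times> real \<Rightarrow> 'a \<times> real" where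
  "sph_lin a b \<theta> \<phi> z =
     (fst z + (snd z * (sin \<theta> * cos \<phi>)) *\<^sub>R a + (snd z * (sin \<theta> * sin \<phi>)) *\<^sub>R b, snd z * cos \<theta>)"

definition smean :: "'a::euclidean_space \<Rightarrow> 'a \<Rightarrow> ('a \<times> real \<Rightarrow> real) \<Rightarrow> 'a \<times> real \<Rightarrow> real" where
  "smean a b w z = (1 / (4 * pi)) *
     integral {0..pi} (\<lambda>\<theta>. integral {0..2*pi} (\<lambda>\<phi>. sin \<theta> * w (sph_lin a b \<theta> \<phi> z)))"

text \<open>If \<open>w\<close> solves the wave equation for the sum of second derivatives along some directions, then
  \<open>kstep a b w\<close> solves it with the directions \<open>a\<close> and \<open>b\<close> added, at the price of one derivative: this is
  Kirchhoff's formula in the variables \<open>(r, a, b)\<close>.\<close>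

definition kstep :: "'a::euclidean_space \<Rightarrow> 'a \<Rightarrow> ('a \<times> real \<Rightarrow> real) \<Rightarrow> 'a \<times> real \<Rightarrow> real" where
  "kstep a b w = pdir (\<lambda>z. snd z * smean a b w z) (0, 1)"

lemma continuous_on_sin_cos [continuous_intros]:
  fixes f :: "'z::topological_space \<Rightarrow> real"
  assumes "continuous_on S f"
  shows "continuous_on S (\<lambda>y. sin (f y))" "continuous_on S (\<lambda>y. cos (f y))"
  using continuous_on_compose2[OF continuous_on_sin[OF continuous_on_id] assms]
    continuous_on_compose2[OF continuous_on_cos[OF continuous_on_id] assms] by auto

lemma linear_sph_lin: "linear (sph_lin a b \<theta> \<phi>)"
  by (auto simp: linear_iff sph_lin_def algebra_simps)

lemma continuous_on_sph_lin [continuous_intros]: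
  "continuous_on S f \<Longrightarrow> continuous_on S g \<Longrightarrow> continuous_on S h \<Longrightarrow>
    continuous_on S (\<lambda>y. sph_lin a b (f y) (g y) (h y))"
  unfolding sph_lin_def by (intro continuous_intros) auto

text \<open>The angles join the parameter, nested so that \<open>Cp_integral\<close> removes first
  \<phi> and then \<theta>.\<close>

lemma Cp_sph_integrand:
  assumes "Cp k w"
  shows "Cp k (\<lambda>q z. sin (snd (fst q)) * w (fst (fst q)) (sph_lin a b (snd (fst q)) (snd q) z))"
    (is "Cp k ?F")
proof -
  have "Cp k (\<lambda>q z. w ((\<lambda>q. fst (fst q)) q) ((\<lambda>q. sph_lin a b (snd (fst q)) (snd q)) q z + (\<lambda>q. 0) q))"
    by (rule Cp_compose_affine[OF assms linear_sph_lin]) (intro continuous_intros)+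
  hence "Cp k (\<lambda>q z. w (fst (fst q)) (sph_lin a b (snd (fst q)) (snd q) z))" by simp
  thus ?thesis by (intro Cp_mult[OF Cp_const]) (intro continuous_intros)+
qed

lemma Cp_smean:
  assumes "Cp k w" shows "Cp k (\<lambda>p. smean a b (w p))"
  unfolding smean_def
  using Cp_integral[OF Cp_integral[OF Cp_sph_integrand[OF assms, of a b]]]
  by (intro Cp_cmult) simp

lemma pdir_double_integral:
  fixes F :: "(('p::topological_space \<times> real) \<times> real) \<Rightarrow> 'a::euclidean_space \<Rightarrow> real"
  assumes "Cp (Suc k) F"
  shows "pdir (\<lambda>z. integral {a..b} (\<lambda>\<theta>. integral {c..d} (\<lambda>\<phi>. F ((p, \<theta>), \<phi>) z))) v z
     = integral {a..b} (\<lambda>\<theta>. integral {c..d} (\<lambda>\<phi>. pdir (F ((p, \<theta>), \<phi>)) v z))"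
  using fun_cong[OF Cp_pdir_integral[OF Cp_integral[OF assms, of c d], of a b p v], of z]
  by (simp add: Cp_pdir_integral[OF assms])

lemma pdir_sph:
  assumes "\<And>y. g differentiable (at y)"
  shows "pdir (\<lambda>z. c * g (sph_lin a b \<theta> \<phi> z)) v z = c * pdir g (sph_lin a b \<theta> \<phi> v) (sph_lin a b \<theta> \<phi> z)"
proof -
  note e = pdir_compose_affine[OF assms linear_sph_lin, where c=0]
  have "pdir (\<lambda>z. g (sph_lin a b \<theta> \<phi> z)) v z = pdir g (sph_lin a b \<theta> \<phi> v) (sph_lin a b \<theta> \<phi> z)"
    "(\<lambda>z. g (sph_lin a b \<theta> \<phi> z)) differentiable (at z)"
    using e[of a b \<theta> \<phi>] by simp_all
  moreover have "pdir (\<lambda>z. c) v z = 0" for z :: "'a \<times> real" by (rule pdirI) auto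
  ultimately show ?thesis by (simp add: pdir_mult)
qed

text \<open>As \<open>sph_lin\<close> is linear, a derivative along \<open>v\<close> becomes one
  along \<open>sph_lin a b \<theta> \<phi> v\<close>; when \<open>v\<close> is the time direction
  this is the radial direction of the sphere.\<close>

lemma pdir_smean:
  assumes "Cp (Suc k) w"
  shows "pdir (smean a b (w p)) v z = (1 / (4 * pi)) *
    integral {0..pi} (\<lambda>\<theta>. integral {0..2*pi} (\<lambda>\<phi>. sin \<theta> * pdir (w p) (sph_lin a b \<theta> \<phi> v) (sph_lin a b \<theta> \<phi> z)))"
proof -
  note C = Cp_sph_integrand[OF assms, of a b]
  have "(\<lambda>z. integral {0..pi} (\<lambda>\<theta>. integral {0..2*pi} (\<lambda>\<phi>. sin \<theta> * w p (sph_lin a b \<theta> \<phi> z)))) differentiable (at z)"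
    using Cp_differentiable[OF Cp_integral[OF Cp_integral[OF C, of 0 "2*pi"], of 0 pi], of p z] by simp
  from pdir_cmult[OF this, of "1/(4*pi)" v] show ?thesis
    using pdir_double_integral[OF C, of 0 pi 0 "2*pi" p v z]
    unfolding smean_def by (simp add: pdir_sph[OF Cp_differentiable[OF assms]])
qed

lemma pdir_smean_space:
  assumes "Cp (Suc k) w"
  shows "pdir (smean a b (w p)) (e, 0) = smean a b (pdir (w p) (e, 0))"
  by (rule ext) (simp add: pdir_smean[OF assms] smean_def, simp add: sph_lin_def)

lemma smean_at_0: "smean a b w (x, 0) = w (x, 0)"
  by (simp add: smean_def sph_lin_def)

lemma smean_integrable:
  assumes "Cp k w"
  shows "(\<lambda>\<theta>. integral {0..2*pi} (\<lambda>\<phi>. sin \<theta> * w p (sph_lin a b \<theta> \<phi> z))) integrable_on {0..pi}"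
    "(\<lambda>\<phi>. sin \<theta> * w p (sph_lin a b \<theta> \<phi> z)) integrable_on {0..2*pi}"
proof -
  note C = Cp_sph_integrand[OF assms, of a b]
  have "(\<lambda>\<phi>. (\<lambda>q z. sin (snd (fst q)) * w (fst (fst q)) (sph_lin a b (snd (fst q)) (snd q) z)) ((p, \<theta>), \<phi>) z) integrable_on {0..2*pi}"
    by (rule Cp_integrable[OF C])
  thus "(\<lambda>\<phi>. sin \<theta> * w p (sph_lin a b \<theta> \<phi> z)) integrable_on {0..2*pi}" by simp
  have "(\<lambda>\<theta>. (\<lambda>q z. integral {0..2*pi} (\<lambda>\<phi>. sin (snd (fst (q, \<phi>))) * w (fst (fst (q, \<phi>)))
      (sph_lin a b (snd (fst (q, \<phi>))) (snd (q, \<phi>)) z))) (p, \<theta>) z) integrable_on {0..pi}"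
    by (rule Cp_integrable[OF Cp_integral[OF C]])
  thus "(\<lambda>\<theta>. integral {0..2*pi} (\<lambda>\<phi>. sin \<theta> * w p (sph_lin a b \<theta> \<phi> z))) integrable_on {0..pi}" by simp
qed

lemma smean_add:
  assumes "Cp k w" "Cp k w'"
  shows "smean a b (\<lambda>y. w p y + w' p y) z = smean a b (w p) z + smean a b (w' p) z"
  using smean_integrable[OF assms(1), where p=p and a=a and b=b] smean_integrable[OF assms(2), where p=p and a=a and b=b]
  by (simp add: smean_def distrib_left integral_add)

lemma smean_sum_list:
  assumes "\<And>e. Cp k (w e)"
  shows "smean a b (\<lambda>y. \<Sum>e\<leftarrow>es. w e p y) z = (\<Sum>e\<leftarrow>es. smean a b (w e p) z)"
proof -
  have C: "Cp k (\<lambda>p y. \<Sum>e\<leftarrow>es. w e p y)" for es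
    by (induction es) (auto intro: Cp_add Cp_const assms)
  show ?thesis by (induction es) (simp_all add: smean_add[OF assms C], simp add: smean_def)
qed

lemma pdir_zero: "pdir g 0 x = 0"
  by (rule pdirI) auto

lemma pdir_comb3:
  assumes "g differentiable (at y)"
  shows "pdir g (\<alpha> *\<^sub>R a + \<beta> *\<^sub>R b, \<gamma>) y = \<alpha> * pdir g (a, 0) y + \<beta> * pdir g (b, 0) y + \<gamma> * pdir g (0, 1) y"
proof -
  interpret bounded_linear "\<lambda>v. pdir g v y"
    by (rule has_derivative_bounded_linear[OF differentiable_pdir[OF assms]])
  have "(\<alpha> *\<^sub>R a + \<beta> *\<^sub>R b, \<gamma>) = \<alpha> *\<^sub>R (a, 0) + \<beta> *\<^sub>R (b, 0) + \<gamma> *\<^sub>R (0, 1)" by simp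
  thus ?thesis by (simp only: add scaleR real_scaleR_def)
qed

lemma chain_curve:
  assumes "g differentiable (at (x + \<alpha> t *\<^sub>R a + \<beta> t *\<^sub>R b, \<gamma> t))"
    and "(\<alpha> has_real_derivative \<alpha>') (at t)" "(\<beta> has_real_derivative \<beta>') (at t)" "(\<gamma> has_real_derivative \<gamma>') (at t)"
  shows "((\<lambda>t. g (x + \<alpha> t *\<^sub>R a + \<beta> t *\<^sub>R b, \<gamma> t)) has_real_derivative
     \<alpha>' * pdir g (a, 0) (x + \<alpha> t *\<^sub>R a + \<beta> t *\<^sub>R b, \<gamma> t) + \<beta>' * pdir g (b, 0) (x + \<alpha> t *\<^sub>R a + \<beta> t *\<^sub>R b, \<gamma> t)
      + \<gamma>' * pdir g (0, 1) (x + \<alpha> t *\<^sub>R a + \<beta> t *\<^sub>R b, \<gamma> t)) (at t)"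
proof -
  note d = assms(2-4)[unfolded has_field_derivative_def]
  have "((\<lambda>t. (x + \<alpha> t *\<^sub>R a + \<beta> t *\<^sub>R b, \<gamma> t)) has_derivative (\<lambda>s. s *\<^sub>R (\<alpha>' *\<^sub>R a + \<beta>' *\<^sub>R b, \<gamma>'))) (at t)"
    by (rule has_derivative_eq_rhs, (rule derivative_intros d)+) (auto simp: algebra_simps)
  from has_derivative_compose[OF this differentiable_pdir[OF assms(1)]]
  have *: "((\<lambda>t. g (x + \<alpha> t *\<^sub>R a + \<beta> t *\<^sub>R b, \<gamma> t)) has_derivative
     (\<lambda>s. pdir g (s *\<^sub>R (\<alpha>' *\<^sub>R a + \<beta>' *\<^sub>R b, \<gamma>')) (x + \<alpha> t *\<^sub>R a + \<beta> t *\<^sub>R b, \<gamma> t))) (at t)" .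
  interpret bounded_linear "\<lambda>v. pdir g v (x + \<alpha> t *\<^sub>R a + \<beta> t *\<^sub>R b, \<gamma> t)"
    by (rule has_derivative_bounded_linear[OF differentiable_pdir[OF assms(1)]])
  show ?thesis using * unfolding scaleR pdir_comb3[OF assms(1)] has_field_derivative_def
    by (simp add: mult_commute_abs)
qed

text \<open>\<open>s r\<close> times the Laplacian is a radial part plus a \<open>\<theta>\<close>-derivative plus a \<open>\<phi>\<close>-derivative, written
  for \<open>c, s = cos \<theta>, sin \<theta>\<close> and \<open>C, S = cos \<phi>, sin \<phi>\<close>. The tangential derivatives are divided by \<open>r sin \<theta>\<close>
  beforehand, so the identity has no singularity at the poles or at \<open>r = 0\<close>.\<close>

lemma sphere_identity:
  fixes c s C S r :: real
  assumes "c\<^sup>2 + s\<^sup>2 = 1" "C\<^sup>2 + S\<^sup>2 = 1"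
  shows "s * (2 * (s * C * D2 + s * S * D3 + c * D1)
      + r * (s * C * (s * C * D22 + s * S * D23 + c * D12) + s * S * (s * C * D23 + s * S * D33 + c * D13) + c * (s * C * D12 + s * S * D13 + c * D11)))
    + (c * (c * C * D2 + c * S * D3 - s * D1) + s * (c * C * (r * c * C * D22 + r * c * S * D23 - r * s * D12) + c * S * (r * c * C * D23 + r * c * S * D33 - r * s * D13)
        - s * (r * c * C * D12 + r * c * S * D13 - r * s * D11) - s * C * D2 - s * S * D3 - c * D1))
    + (C * (r * s * C * D33 - r * s * S * D23) - S * (r * s * C * D23 - r * s * S * D22) - S * D3 - C * D2)
   = s * r * (D11 + D22 + D33)"
proof -
  \<comment> \<open>\<open>P\<close> is the second derivative along (C, S) in the plane of the
    variables 2 and 3. The radial and the \<theta> part together give \<open>P + D11\<close>, and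
    the \<phi> part supplies the rest of the trace.\<close>
  define P where "P = C\<^sup>2 * D22 + 2 * C * S * D23 + S\<^sup>2 * D33"
  have 1: "s * C * (s * C * D22 + s * S * D23 + c * D12) + s * S * (s * C * D23 + s * S * D33 + c * D13)
      + c * (s * C * D12 + s * S * D13 + c * D11) = s\<^sup>2 * P + c\<^sup>2 * D11 + 2 * c * s * (C * D12 + S * D13)"
    by (simp add: P_def algebra_simps power2_eq_square)
  have 2: "c * C * (r * c * C * D22 + r * c * S * D23 - r * s * D12) + c * S * (r * c * C * D23 + r * c * S * D33 - r * s * D13)
      - s * (r * c * C * D12 + r * c * S * D13 - r * s * D11) = r * (c\<^sup>2 * P + s\<^sup>2 * D11 - 2 * c * s * (C * D12 + S * D13))"
    by (simp add: P_def algebra_simps power2_eq_square)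
  have 3: "C * (r * s * C * D33 - r * s * S * D23) - S * (r * s * C * D23 - r * s * S * D22)
      = r * s * ((C\<^sup>2 + S\<^sup>2) * (D22 + D33) - P)"
    by (simp add: P_def algebra_simps power2_eq_square)
  have 4: "s * (2 * X + r * (s\<^sup>2 * P + c\<^sup>2 * D11 + Y)) + (Z + s * (r * (c\<^sup>2 * P + s\<^sup>2 * D11 - Y) - U - V - W))
     = s * r * ((c\<^sup>2 + s\<^sup>2) * (P + D11)) + 2 * (s * X) + Z - s * (U + V + W)" for X Y Z U V W
    by (simp add: algebra_simps)
  have "2 * (s * (s * C * D2 + s * S * D3 + c * D1)) + c * (c * C * D2 + c * S * D3 - s * D1)
      - s * (s * C * D2 + s * S * D3 + c * D1) = (c\<^sup>2 + s\<^sup>2) * (C * D2 + S * D3)"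
    by (simp add: algebra_simps power2_eq_square)
  thus ?thesis unfolding 1 2 3 4 assms by (simp add: algebra_simps)
qed

text \<open>The second r-derivative of r M, with M the mean, is 2 M_r + r M_rr. By
  \<open>sphere_identity\<close> its integrand differs from r times that of the three-dimensional
  Laplacian by a \<theta>-derivative and a \<phi>-derivative, both of which integrate to 0. This
  takes the place of the divergence theorem on the ball.\<close>

lemma Kirchhoff_identity:
  fixes w :: "'a::euclidean_space \<times> real \<Rightarrow> real"
  assumes w2: "Cp (Suc (Suc 0)) (\<lambda>_::real. w)"
  defines "D \<equiv> pdir w" and "DD \<equiv> \<lambda>v u. pdir (pdir w v) u"
  shows "dtt (\<lambda>z. snd z * smean a b w z) z =
    snd z * smean a b (\<lambda>y. DD (0,1) (0,1) y + DD (a,0) (a,0) y + DD (b,0) (b,0) y) z"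
proof -
  obtain x r where z: "z = (x, r)" by (cases z)
  let ?I = "\<lambda>f :: real \<Rightarrow> real \<Rightarrow> real. integral {0..pi} (\<lambda>s. integral {0..2*pi} (f s))"
  let ?L = "\<lambda>s t. sph_lin a b s t z"
  let ?u = "\<lambda>s t. sph_lin a b s t (0, 1)"
  have w1: "Cp (Suc 0) (\<lambda>_::real. D v)" for v using Cp_pdir[OF w2] by (simp only: D_def)
  have w0: "Cp 0 (\<lambda>_::real. DD v u)" for v u using Cp_pdir[OF w1] by (simp only: D_def DD_def)
  have dw: "w differentiable (at y)" for y using Cp_differentiable[OF w2] .
  have dD: "D v differentiable (at y)" for v y using Cp_differentiable[OF w1] .
  have Schw: "DD v u y = DD u v y" for v u y unfolding DD_def using Cp_Schwarz[OF w2] .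
  have pD: "pdir (D v) u = DD v u" for v u by (simp add: DD_def D_def)
  have cD: "continuous_on X (\<lambda>y. D v (f y))" if "continuous_on X f" for X :: "'z::topological_space set" and f v
    using Cp_continuous_compose[OF w1 continuous_on_const that] .
  have cDD: "continuous_on X (\<lambda>y. DD v u (f y))" if "continuous_on X f" for X :: "'z::topological_space set" and f v u
    using Cp_continuous_compose[OF w0 continuous_on_const that] .
  let ?Da = "\<lambda>s t. D (a,0) (?L s t)"
  let ?Db = "\<lambda>s t. D (b,0) (?L s t)"
  let ?Dr = "\<lambda>s t. D (0,1) (?L s t)"
  let ?Daa = "\<lambda>s t. DD (a,0) (a,0) (?L s t)"
  let ?Dab = "\<lambda>s t. DD (a,0) (b,0) (?L s t)"
  let ?Dar = "\<lambda>s t. DD (a,0) (0,1) (?L s t)"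
  let ?Dba = "\<lambda>s t. DD (b,0) (a,0) (?L s t)"
  let ?Dbb = "\<lambda>s t. DD (b,0) (b,0) (?L s t)"
  let ?Dbr = "\<lambda>s t. DD (b,0) (0,1) (?L s t)"
  let ?Dra = "\<lambda>s t. DD (0,1) (a,0) (?L s t)"
  let ?Drb = "\<lambda>s t. DD (0,1) (b,0) (?L s t)"
  let ?Drr = "\<lambda>s t. DD (0,1) (0,1) (?L s t)"
  let ?K1 = "\<lambda>s t. D (?u s t) (?L s t)"
  let ?K2 = "\<lambda>s t. pdir (D (?u s t)) (?u s t) (?L s t)"
  have u: "?u s t = ((sin s * cos t) *\<^sub>R a + (sin s * sin t) *\<^sub>R b, cos s)" for s t
    by (simp add: sph_lin_def)
  have Deq: "D (?u s t) y = sin s * cos t * D (a,0) y + sin s * sin t * D (b,0) y + cos s * D (0,1) y" for s t y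
    unfolding u D_def by (rule pdir_comb3[OF dw])
  have K2: "?K2 s t = sin s * cos t * DD (?u s t) (a,0) (?L s t) + sin s * sin t * DD (?u s t) (b,0) (?L s t) + cos s * DD (?u s t) (0,1) (?L s t)" for s t
    unfolding pD[symmetric] unfolding u by (rule pdir_comb3[OF dD])
  have DDu: "DD (?u s t) v y = sin s * cos t * DD (a,0) v y + sin s * sin t * DD (b,0) v y + cos s * DD (0,1) v y" for s t v y
    unfolding Schw[of _ v] unfolding pD[symmetric] unfolding u by (rule pdir_comb3[OF dD])
  have cK1: "continuous_on X (\<lambda>y. ?K1 (f y) (g y))" if "continuous_on X f" "continuous_on X g" for X :: "'z::topological_space set" and f g
    unfolding Deq by (intro continuous_intros cD that)
  have cK2: "continuous_on X (\<lambda>y. ?K2 (f y) (g y))" if "continuous_on X f" "continuous_on X g" for X :: "'z::topological_space set" and f g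
    unfolding K2 DDu by (intro continuous_intros cDD that)
  let ?E = "\<lambda>s t. sin s * (?Drr s t + ?Daa s t + ?Dbb s t)"
  \<comment> \<open>The \<theta>-derivative of \<open>w\<close> along the sphere times sin \<theta>
    / r, and below it the \<phi>-derivative divided by r sin \<theta>, both with the quotient
    carried out so that r = 0 and the poles are regular.\<close>
  let ?N = "\<lambda>s t. sin s * (cos s * cos t * ?Da s t + cos s * sin t * ?Db s t - sin s * ?Dr s t)"
  let ?m = "\<lambda>s t. cos t * ?Db s t - sin t * ?Da s t"
  let ?Ns = "\<lambda>s t. cos s * (cos s * cos t * ?Da s t + cos s * sin t * ?Db s t - sin s * ?Dr s t)
     + sin s * (cos s * cos t * (r * cos s * cos t * ?Daa s t + r * cos s * sin t * ?Dab s t - r * sin s * ?Dar s t)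
      + cos s * sin t * (r * cos s * cos t * ?Dba s t + r * cos s * sin t * ?Dbb s t - r * sin s * ?Dbr s t)
      - sin s * (r * cos s * cos t * ?Dra s t + r * cos s * sin t * ?Drb s t - r * sin s * ?Drr s t)
      - sin s * cos t * ?Da s t - sin s * sin t * ?Db s t - cos s * ?Dr s t)"
  let ?mt = "\<lambda>s t. cos t * (r * sin s * cos t * ?Dbb s t - r * sin s * sin t * ?Dba s t)
     - sin t * (r * sin s * cos t * ?Dab s t - r * sin s * sin t * ?Daa s t)
     - sin t * ?Db s t - cos t * ?Da s t"
  have ds: "((\<lambda>s. D v (?L s t)) has_real_derivative
     r * cos s * cos t * DD v (a,0) (?L s t) + r * cos s * sin t * DD v (b,0) (?L s t) - r * sin s * DD v (0,1) (?L s t)) (at s)" for v s t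
    unfolding sph_lin_def z fst_conv snd_conv pD[symmetric]
    by (rule DERIV_cong, rule chain_curve[OF dD]) (auto intro!: derivative_eq_intros)
  have dt: "((\<lambda>t. D v (?L s t)) has_real_derivative
     r * sin s * cos t * DD v (b,0) (?L s t) - r * sin s * sin t * DD v (a,0) (?L s t)) (at t)" for v s t
    unfolding sph_lin_def z fst_conv snd_conv pD[symmetric]
    by (rule DERIV_cong, rule chain_curve[OF dD]) (auto intro!: derivative_eq_intros)
  have dN: "((\<lambda>s. ?N s t) has_real_derivative ?Ns s t) (at s)" for s t
    by (rule DERIV_cong, (rule derivative_intros ds)+) (simp add: algebra_simps)
  have dm: "((\<lambda>t. ?m s t) has_real_derivative ?mt s t) (at t)" for s t
    by (rule DERIV_cong, (rule derivative_intros dt)+) (simp add: algebra_simps)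
  \<comment> \<open>Both exact terms drop out: sin \<theta> is 0 at the poles, and \<open>?m\<close>
    is periodic in \<phi> with period 2 pi.\<close>
  have IN: "integral {0..pi} (\<lambda>s. ?Ns s t) = 0" for t
    using integral_real_derivative[OF _ dN, of 0 pi t] by simp
  have Im: "integral {0..2*pi} (\<lambda>t. ?mt s t) = 0" for s
    using integral_real_derivative[OF _ dm, of 0 "2*pi" s] by (simp add: sph_lin_def)
  have cN: "continuous_on UNIV (\<lambda>q. ?Ns (fst q) (snd q))"
    by (intro continuous_intros cD cDD)
  have cm: "continuous_on UNIV (\<lambda>q. ?mt (fst q) (snd q))"
    by (intro continuous_intros cD cDD)
  have int2: "?I (\<lambda>s t. G s t + H s t)
      = ?I (\<lambda>s t. G s t) + ?I (\<lambda>s t. H s t)"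
    if G: "continuous_on UNIV (\<lambda>q. G (fst q) (snd q))" and H: "continuous_on UNIV (\<lambda>q. H (fst q) (snd q))" for G H :: "real \<Rightarrow> real \<Rightarrow> real"
  proof -
    have i1: "(\<lambda>t. f s t) integrable_on {0..2*pi}" "(\<lambda>s. integral {0..2*pi} (f s)) integrable_on {0..pi}"
      if f: "continuous_on UNIV (\<lambda>q. f (fst q) (snd q))" for f :: "real \<Rightarrow> real \<Rightarrow> real" and s
    proof -
      show "(\<lambda>t. f s t) integrable_on {0..2*pi}"
        using continuous_on_compose2[OF f continuous_on_Pair[OF continuous_on_const continuous_on_id], of s "{0..2*pi}"]
        by (intro integrable_continuous_real) auto
      have "continuous_on UNIV (\<lambda>s. integral (cbox 0 (2*pi)) (f s))"
        by (rule integral_continuous_on_param) (use f in \<open>auto simp: case_prod_beta' intro: continuous_on_subset\<close>)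
      thus "(\<lambda>s. integral {0..2*pi} (f s)) integrable_on {0..pi}"
        by (intro integrable_continuous_real) (auto intro: continuous_on_subset)
    qed
    show ?thesis using i1[OF G] i1[OF H] by (simp add: integral_add)
  qed
  have key: "sin s * (2 * ?K1 s t + r * ?K2 s t) + (?Ns s t + ?mt s t) = r * ?E s t" for s t
    unfolding Deq K2 DDu
    using sphere_identity[of "cos s" "sin s" "cos t" "sin t" "?Da s t" "?Db s t" "?Dr s t" r
       "?Daa s t" "?Dab s t" "?Dra s t" "?Dbb s t"
       "?Drb s t" "?Drr s t"]
    by (simp add: Schw[of "(b,0)" "(a,0)"] Schw[of "(a,0)" "(0,1)"] Schw[of "(b,0)" "(0,1)"] algebra_simps)
  have alg: "2 * (k * X) + r * (k * Y) = k * (2 * X + r * Y)" for k X Y :: real by (simp add: algebra_simps)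
  have cm2: "c * ?I (\<lambda>s t. f s t) = ?I (\<lambda>s t. c * f s t)"
    for c :: real and f by (simp only: integral_mult_right)
  have key': "(2 * (sin s * ?K1 s t) + r * (sin s * ?K2 s t)) + (?Ns s t + ?mt s t) = r * ?E s t" for s t
    unfolding key[of s t, symmetric] by (rule arg_cong2[where f="(+)", OF alg refl])
  have NM0: "?I (\<lambda>s t. ?Ns s t + ?mt s t) = 0"
  proof -
    \<comment> \<open>The \<theta>-derivative has to be integrated over \<theta> first, hence the
      exchange of the two integrals.\<close>
    have "?I (\<lambda>s t. ?Ns s t) = integral {0..2*pi} (\<lambda>t. integral {0..pi} (\<lambda>s. ?Ns s t))"
      using integral_swap_continuous[of 0 0 pi "2*pi" ?Ns] cN
      by (simp add: case_prod_beta' continuous_on_subset)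
    also have "\<dots> = 0" by (simp only: IN) simp
    finally show ?thesis by (subst int2[OF cN cm]) (simp only: Im, simp)
  qed
  have CU: "Cp (Suc (Suc 0)) (\<lambda>_::real. smean a b w)" using Cp_smean[OF w2] .
  have U0: "smean a b w differentiable (at y)" for y
    using Cp_differentiable[OF CU] .
  let ?U1 = "pdir (smean a b w) (0,1)"
  have U1: "?U1 differentiable (at y)" for y
    using Cp_differentiable[OF Cp_pdir[OF CU]] .
  have Q1: "pdir (\<lambda>z. snd z * smean a b w z) (0,1) = (\<lambda>z. snd z * ?U1 z + smean a b w z)"
    by (rule ext) (simp add: pdir_mult[OF pdir_snd(2) U0] pdir_snd)
  have "pdir (\<lambda>z. snd z * ?U1 z + smean a b w z) (0,1) z = pdir (\<lambda>z. snd z * ?U1 z) (0,1) z + ?U1 z"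
    by (rule pdir_eq[OF has_derivative_add[OF differentiable_pdir differentiable_pdir]])
       (auto intro!: differentiable_mult pdir_snd U1 U0)
  also have "\<dots> = 2 * ?U1 z + r * pdir ?U1 (0,1) z"
    by (simp add: pdir_mult[OF pdir_snd(2) U1] pdir_snd z)
  also have "?U1 z = 1/(4*pi) * ?I (\<lambda>s t. sin s * ?K1 s t)"
    unfolding D_def using pdir_smean[OF w2, of a b "(0,1)" z] .
  also have "pdir ?U1 (0,1) z = 1/(4*pi) * ?I (\<lambda>s t. sin s * ?K2 s t)"
  proof -
    let ?F = "\<lambda>q::(real\<times>real)\<times>real. \<lambda>z. sin (snd (fst q)) * D (?u (snd (fst q)) (snd q)) (sph_lin a b (snd (fst q)) (snd q) z)"
    \<comment> \<open>The radial direction depends on the angles; in the fixed directions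
      \<open>a\<close>, \<open>b\<close> and time the integrand is visibly of class
      \<open>Cp\<close>.\<close>
    have Feq: "?F = (\<lambda>q z. (sin (snd (fst q)) * cos (snd q)) * (sin (snd (fst q)) * D (a,0) (sph_lin a b (snd (fst q)) (snd q) z))
       + (sin (snd (fst q)) * sin (snd q)) * (sin (snd (fst q)) * D (b,0) (sph_lin a b (snd (fst q)) (snd q) z))
       + cos (snd (fst q)) * (sin (snd (fst q)) * D (0,1) (sph_lin a b (snd (fst q)) (snd q) z)))"
      unfolding Deq by (auto simp: algebra_simps)
    have F: "Cp (Suc 0) ?F"
      unfolding Feq
      by (intro Cp_add Cp_mult[OF Cp_const Cp_sph_integrand[OF w1, where a=a and b=b]] continuous_intros)
    have U1eq: "?U1 = (\<lambda>z. 1/(4*pi) * ?I (\<lambda>s t. ?F ((0, s), t) z))"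
      using pdir_smean[OF w2, of a b "(0,1)"] by (auto simp: D_def)
    have e: "pdir (?F ((0, s), t)) (0,1) z = sin s * ?K2 s t" for s t
      using pdir_sph[OF dD] by simp
    have "pdir ?U1 (0,1) z = 1/(4*pi) * ?I (\<lambda>s t. pdir (?F ((0, s), t)) (0,1) z)"
      unfolding U1eq pdir_cmult[OF Cp_differentiable[OF Cp_integral[OF Cp_integral[OF F]]]]
      by (simp only: pdir_double_integral[OF F])
    thus ?thesis unfolding e .
  qed
  also have "2 * (1/(4*pi) * ?I (\<lambda>s t. sin s * ?K1 s t)) + r * (1/(4*pi) * ?I (\<lambda>s t. sin s * ?K2 s t)) = 1/(4*pi) * (2 * ?I (\<lambda>s t. sin s * ?K1 s t) + r * ?I (\<lambda>s t. sin s * ?K2 s t))"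
    by (rule alg)
  also have "\<dots> = 1/(4*pi) * (?I (\<lambda>s t. 2 * (sin s * ?K1 s t)) + ?I (\<lambda>s t. r * (sin s * ?K2 s t)))"
    by (simp only: cm2)
  also have "\<dots> = 1/(4*pi) * ?I (\<lambda>s t. 2 * (sin s * ?K1 s t) + r * (sin s * ?K2 s t))"
    by (subst int2) (auto intro!: continuous_intros cK1 cK2)
  also have "?I (\<lambda>s t. 2 * (sin s * ?K1 s t) + r * (sin s * ?K2 s t))
      = ?I (\<lambda>s t. 2 * (sin s * ?K1 s t) + r * (sin s * ?K2 s t))
        + ?I (\<lambda>s t. ?Ns s t + ?mt s t)"
    unfolding NM0 by simp
  also have "\<dots> = ?I (\<lambda>s t. (2 * (sin s * ?K1 s t) + r * (sin s * ?K2 s t)) + (?Ns s t + ?mt s t))"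
  proof (rule int2[symmetric])
    show "continuous_on UNIV (\<lambda>q. 2 * (sin (fst q) * ?K1 (fst q) (snd q)) + r * (sin (fst q) * ?K2 (fst q) (snd q)))"
      by (intro continuous_intros cK1 cK2)
    show "continuous_on UNIV (\<lambda>q. ?Ns (fst q) (snd q) + ?mt (fst q) (snd q))"
      by (rule continuous_on_add[OF cN cm])
  qed
  also have "\<dots> = ?I (\<lambda>s t. r * ?E s t)"
    by (simp only: key')
  also have "1/(4*pi) * \<dots> = snd z * smean a b (\<lambda>y. DD (0,1) (0,1) y + DD (a,0) (a,0) y + DD (b,0) (b,0) y) z"
    by (simp add: smean_def z)
  finally show ?thesis unfolding Q1 .
qed

section \<open>The solution operator of the wave equation\<close>

text \<open>Two directions at a time, starting from d'Alembert's formula or from functions constant in time; so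
  \<open>n\<close> directions cost \<open>[n/2]\<close> derivatives.\<close>

fun wave_op :: "'a::euclidean_space list \<Rightarrow> ('a \<Rightarrow> real) \<Rightarrow> 'a \<times> real \<Rightarrow> real" where
  "wave_op [] h = (\<lambda>z. h (fst z))"
| "wave_op [e] h = (\<lambda>z. (h (fst z + snd z *\<^sub>R e) + h (fst z - snd z *\<^sub>R e)) / 2)"
| "wave_op (a # b # es) h = kstep a b (wave_op es h)"

lemma Cp_kstep:
  assumes "Cp (Suc k) w"
  shows "Cp k (\<lambda>p. kstep a b (w p))"
  unfolding kstep_def
  by (intro Cp_pdir Cp_mult Cp_linear bounded_linear_snd Cp_smean assms)

lemma pdir_sum_list:
  assumes "\<And>e. F e differentiable (at x)"
  shows "pdir (\<lambda>x. \<Sum>e\<leftarrow>es. F e x) v x = (\<Sum>e\<leftarrow>es. pdir (F e) v x)"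
    "(\<lambda>x. \<Sum>e\<leftarrow>es. F e x) differentiable (at x)"
proof (induction es)
  case Nil
  { case 1 show ?case by (rule pdirI) simp }
  { case 2 show ?case by simp }
next
  case (Cons e es)
  { case 1 show ?case using Cons by (simp add: pdir_add assms) }
  { case 2 show ?case using Cons by (simp add: assms) }
qed

text \<open>Let M be the spherical mean. \<open>Kirchhoff_identity\<close> and the equation for
  \<open>w\<close> show that r M solves the equation for the enlarged list, with value 0 and time
  derivative \<open>w p (x, 0)\<close> at r = 0. \<open>kstep\<close> is the time derivative of r M,
  which turns that velocity into the initial value.\<close>

lemma kstep_wave_equation:
  fixes w :: "'p::topological_space \<Rightarrow> 'a::euclidean_space \<times> real \<Rightarrow> real"
  assumes w: "Cp (Suc (Suc (Suc k))) w"
    and eq: "\<And>z. dtt (w p) z = Laps es (w p) z"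
  shows "dtt (kstep a b (w p)) z = Laps (a # b # es) (kstep a b (w p)) z"
    and "pdir (kstep a b (w p)) (0,1) (x, 0) = 0"
    and "kstep a b (w p) (x, 0) = w p (x, 0)"
proof -
  let ?Q = "\<lambda>p z. snd z * smean a b (w p) z"
  have Q: "Cp (Suc (Suc (Suc k))) ?Q"
    by (intro Cp_mult Cp_linear bounded_linear_snd Cp_smean w)
  have w1: "Cp (Suc (Suc k)) (\<lambda>p. pdir (w p) v)" for v by (rule Cp_pdir[OF w])
  have w2: "Cp (Suc k) (\<lambda>p. pdir (pdir (w p) v) v')" for v v' by (rule Cp_pdir[OF w1])
  have Qe: "pdir (\<lambda>z. snd z * smean a b (w' p) z) (e,0) = (\<lambda>z. snd z * smean a b (pdir (w' p) (e,0)) z)"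
    if w': "Cp (Suc j) w'" for w' :: "'p \<Rightarrow> _" and e j
    by (rule ext) (simp add: pdir_mult[OF pdir_snd(2) Cp_differentiable[OF Cp_smean[OF w']]] pdir_snd(1)
        pdir_smean_space[OF w'])
  have Qee: "pdir (pdir (?Q p) (e,0)) (e,0) = (\<lambda>z. snd z * smean a b (pdir (pdir (w p) (e,0)) (e,0)) z)" for e
    unfolding Qe[OF w] by (rule Qe[OF w1])
  have Qrr: "dtt (?Q p) z = Laps (a # b # es) (?Q p) z" for z
  proof -
    have "Cp (Suc (Suc 0)) (\<lambda>_::real. w p)"
      using Cp_mono[OF Cp_reparam[OF w, of "\<lambda>_. p"], of "Suc (Suc 0)"] by auto
    from Kirchhoff_identity[OF this, of a b z]
    have "dtt (?Q p) z = snd z * smean a b (\<lambda>y. dtt (w p) y +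
        pdir (pdir (w p) (a,0)) (a,0) y + pdir (pdir (w p) (b,0)) (b,0) y) z" .
    also have "(\<lambda>y. dtt (w p) y + pdir (pdir (w p) (a,0)) (a,0) y + pdir (pdir (w p) (b,0)) (b,0) y)
       = (\<lambda>y. \<Sum>e\<leftarrow>a # b # es. pdir (pdir (w p) (e,0)) (e,0) y)"
      by (simp add: eq algebra_simps)
    also have "smean a b (\<lambda>y. \<Sum>e\<leftarrow>a # b # es. pdir (pdir (w p) (e,0)) (e,0) y) z
       = (\<Sum>e\<leftarrow>a # b # es. smean a b (pdir (pdir (w p) (e,0)) (e,0)) z)"
      by (rule smean_sum_list[OF w2])
    finally show ?thesis by (simp only: Qee sum_list_const_mult)
  qed
  have Q1: "Cp (Suc (Suc k)) (\<lambda>p. pdir (?Q p) v)" for v by (rule Cp_pdir[OF Q])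
  have Q2: "Cp (Suc k) (\<lambda>p. pdir (pdir (?Q p) v) v')" for v v' by (rule Cp_pdir[OF Q1])
  have "dtt (kstep a b (w p)) z = dtt (pdir (?Q p) (0,1)) z"
    by (simp add: kstep_def)
  also have "dtt (?Q p) = (\<lambda>z. \<Sum>e\<leftarrow>a # b # es. pdir (pdir (?Q p) (e,0)) (e,0) z)"
    using Qrr by blast
  also have "pdir (\<lambda>z. \<Sum>e\<leftarrow>a # b # es. pdir (pdir (?Q p) (e,0)) (e,0) z) (0,1) z
      = (\<Sum>e\<leftarrow>a # b # es. pdir (pdir (pdir (?Q p) (e,0)) (e,0)) (0,1) z)"
    by (rule pdir_sum_list(1)[OF Cp_differentiable[OF Q2]])
  also have "(\<lambda>e. pdir (pdir (pdir (?Q p) (e,0)) (e,0)) (0,1) z) = (\<lambda>e. pdir (pdir (kstep a b (w p)) (e,0)) (e,0) z)"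
  proof
    fix e
    have "pdir (pdir (pdir (?Q p) (e,0)) (e,0)) (0,1) z = pdir (pdir (pdir (?Q p) (e,0)) (0,1)) (e,0) z"
      by (rule Cp_Schwarz[OF Q1])
    also have "pdir (pdir (?Q p) (e,0)) (0,1) = pdir (pdir (?Q p) (0,1)) (e,0)"
      using Cp_Schwarz[OF Q] by blast
    finally show "pdir (pdir (pdir (?Q p) (e,0)) (e,0)) (0,1) z = pdir (pdir (kstep a b (w p)) (e,0)) (e,0) z"
      by (simp add: kstep_def)
  qed
  finally show "dtt (kstep a b (w p)) z = Laps (a # b # es) (kstep a b (w p)) z" .
  \<comment> \<open>At r = 0 each second space derivative of \<open>?Q p\<close> contains the factor
    r, so by the equation its second time derivative vanishes there as well.\<close>
  have "(\<Sum>e\<leftarrow>es. pdir (pdir (?Q p) (e,0)) (e,0) (x, 0)) = 0" for es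
    by (induction es) (simp_all add: Qee)
  thus "pdir (kstep a b (w p)) (0,1) (x, 0) = 0" using Qrr[of "(x, 0)"] by (simp only: kstep_def)
  show "kstep a b (w p) (x, 0) = w p (x, 0)"
    by (simp add: kstep_def pdir_mult[OF pdir_snd(2) Cp_differentiable[OF Cp_smean[OF w]]] pdir_snd(1) smean_at_0)
qed

lemma linear_comp_shift: "linear (\<lambda>z::'a::real_vector \<times> real. fst z + snd z *\<^sub>R e)"
  by (auto simp: linear_iff algebra_simps)

lemma Cp_shift:
  assumes "Cp k h"
  shows "Cp k (\<lambda>p z. h p (fst z + snd z *\<^sub>R e))"
  using Cp_compose_affine[OF assms linear_comp_shift[of e] continuous_on_const continuous_on_id continuous_on_const[of _ 0]] by simp

lemma pdir_shift:
  assumes "Cp (Suc k) h"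
  shows "pdir (\<lambda>z. h p (fst z + snd z *\<^sub>R e)) v = (\<lambda>z. pdir (h p) (fst v + snd v *\<^sub>R e) (fst z + snd z *\<^sub>R e))"
  by (rule ext) (use pdir_compose_affine(1)[OF _ linear_comp_shift[of e], of "h p" _ 0] Cp_differentiable[OF assms] in simp)

lemma pdir_avg:
  assumes "F differentiable (at x)" "G differentiable (at x)"
  shows "pdir (\<lambda>x. (F x + G x) / 2) v x = (pdir F v x + pdir G v x) / 2"
  using pdir_cmult[of "\<lambda>x. F x + G x" x "1/2" v] assms by (simp add: pdir_add)

text \<open>Each \<open>kstep\<close> uses up one derivative and two directions, which is the
  \<open>length es div 2\<close> in the hypothesis. The equation is claimed for
  \<open>k \<ge> 2\<close> only, where second derivatives are available.\<close>

lemma wave_op_properties: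
  fixes h :: "'p::topological_space \<Rightarrow> 'a::euclidean_space \<Rightarrow> real"
  shows "Cp (length es div 2 + k) h \<Longrightarrow> Cp k (\<lambda>p. wave_op es (h p)) \<and>
    (k \<ge> 2 \<longrightarrow> (\<forall>p x z. wave_op es (h p) (x, 0) = h p x \<and> pdir (wave_op es (h p)) (0,1) (x, 0) = 0 \<and>
       dtt (wave_op es (h p)) z = Laps es (wave_op es (h p)) z))"
\<comment> \<open>The recursion leaves the data alone, so \<open>h undefined\<close> is only a
  placeholder for the second argument of the induction rule; the cases are proved for all parameters
  at once.\<close>
proof (induction es "h undefined" arbitrary: k rule: wave_op.induct)
  case 1
  have C: "Cp k (\<lambda>p (z::'a \<times> real). h p (fst z))" using Cp_shift[of k h 0] 1 by simp
  have d: "pdir (\<lambda>(z::'a \<times> real). h p (fst z)) v = (\<lambda>z. pdir (h p) (fst v) (fst z))" if "Cp (Suc j) h" for p v j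
    using pdir_shift[OF that, of p 0 v] by simp
  show ?case
  proof (intro conjI impI allI)
    assume "2 \<le> k"
    then obtain j where j: "k = Suc (Suc j)" by (metis add_2_eq_Suc le_Suc_ex)
    have h: "Cp (Suc (Suc j)) h" using 1 j by simp
    fix p x z
    show "pdir (wave_op [] (h p)) (0,1) (x, 0) = 0" by (simp add: d[OF h] pdir_zero)
    show "dtt (wave_op [] (h p)) z = (\<Sum>e\<leftarrow>[]. pdir (pdir (wave_op [] (h p)) (e,0)) (e,0) z)"
      by (simp add: d[OF h] pdir_zero[abs_def] pdirI)
  qed (use C in auto)
next
  case (2 e)
  have h: "Cp k h" using 2 by simp
  have C: "Cp k (\<lambda>p. wave_op [e] (h p))"
    using Cp_cmult[OF Cp_add[OF Cp_shift[OF h, of e] Cp_shift[OF h, of "-e"]], of "1/2"] by simp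
  show ?case
  proof (intro conjI impI allI C)
    assume "2 \<le> k"
    then obtain j where j: "k = Suc (Suc j)" by (metis add_2_eq_Suc le_Suc_ex)
    have h: "Cp (Suc (Suc j)) h" using h j by simp
    have d1: "pdir (wave_op [e] (h p)) v = (\<lambda>z. (pdir (h p) (fst v + snd v *\<^sub>R e) (fst z + snd z *\<^sub>R e) + pdir (h p) (fst v - snd v *\<^sub>R e) (fst z - snd z *\<^sub>R e)) / 2)" for p v
      using pdir_avg[OF Cp_differentiable[OF Cp_shift[OF h, of e]] Cp_differentiable[OF Cp_shift[OF h, of "-e"]]]
         pdir_shift[OF h, of p e v] pdir_shift[OF h, of p "-e" v]
      by (auto simp: fun_eq_iff)
    have d2: "pdir (pdir (wave_op [e] (h p)) v) v = (\<lambda>z. (pdir (pdir (h p) (fst v + snd v *\<^sub>R e)) (fst v + snd v *\<^sub>R e) (fst z + snd z *\<^sub>R e)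
        + pdir (pdir (h p) (fst v - snd v *\<^sub>R e)) (fst v - snd v *\<^sub>R e) (fst z - snd z *\<^sub>R e)) / 2)" for p v
    proof -
      note h1 = Cp_pdir[OF h, of "fst v + snd v *\<^sub>R e"] and h2 = Cp_pdir[OF h, of "fst v - snd v *\<^sub>R e"]
      show ?thesis
        using pdir_avg[OF Cp_differentiable[OF Cp_shift[OF h1, of e]] Cp_differentiable[OF Cp_shift[OF h2, of "-e"]]]
           pdir_shift[OF h1, of p e v] pdir_shift[OF h2, of p "-e" v]
        unfolding d1 by (auto simp: fun_eq_iff)
    qed
    have pneg: "pdir (h p) (- e) x = - pdir (h p) e x" for p x
    proof -
      interpret bounded_linear "\<lambda>v. pdir (h p) v x"
        by (rule has_derivative_bounded_linear[OF differentiable_pdir[OF Cp_differentiable[OF h]]])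
      show ?thesis by (rule neg)
    qed
    have neg2: "pdir (pdir (h p) (- e)) (- e) x = pdir (pdir (h p) e) e x" for p x
    proof -
      note h1 = Cp_pdir[OF h, of e]
      interpret bounded_linear "\<lambda>v. pdir (pdir (h p) e) v x"
        by (rule has_derivative_bounded_linear[OF differentiable_pdir[OF Cp_differentiable[OF h1]]])
      have "pdir (h p) (- e) = (\<lambda>x. (-1) * pdir (h p) e x)" by (auto simp: pneg)
      thus ?thesis using pdir_cmult[OF Cp_differentiable[OF h1], where c="-1" and v="-e"] by (simp add: neg)
    qed
    fix p x z
    show "wave_op [e] (h p) (x, 0) = h p x" by simp
    show "pdir (wave_op [e] (h p)) (0,1) (x, 0) = 0" unfolding d1 by (simp add: pneg)
    show "dtt (wave_op [e] (h p)) z = (\<Sum>e'\<leftarrow>[e]. pdir (pdir (wave_op [e] (h p)) (e',0)) (e',0) z)"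
      unfolding d2 by (simp add: neg2)
  qed
next
  case (3 a b es)
  \<comment> \<open>Removing two directions lowers \<open>length es div 2\<close> by one, so the
    recursive call yields one derivative more, which \<open>kstep\<close> consumes.\<close>
  have h: "Cp (length es div 2 + Suc k) h" using 3(2) by simp
  note IH = 3(1)[OF h]
  hence w: "Cp (Suc k) (\<lambda>p. wave_op es (h p))" by blast
  have C: "Cp k (\<lambda>p. wave_op (a # b # es) (h p))" using Cp_kstep[OF w] by simp
  show ?case
  proof (intro conjI impI allI C)
    assume k: "2 \<le> k"
    then obtain j where j: "k = Suc (Suc j)" by (metis add_2_eq_Suc le_Suc_ex)
    have w: "Cp (Suc (Suc (Suc j))) (\<lambda>p. wave_op es (h p))" using w j by simp
    fix p x z
    have "dtt (wave_op es (h p)) z = Laps es (wave_op es (h p)) z" for z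
      using IH le_SucI[OF k] by blast
    note K = kstep_wave_equation[OF w this]
    show "dtt (wave_op (a # b # es) (h p)) z = (\<Sum>e\<leftarrow>a # b # es. pdir (pdir (wave_op (a # b # es) (h p)) (e,0)) (e,0) z)"
      unfolding wave_op.simps by (rule K(1))
    show "pdir (wave_op (a # b # es) (h p)) (0,1) (x, 0) = 0" unfolding wave_op.simps by (rule K(2))
    show "wave_op (a # b # es) (h p) (x, 0) = h p x" unfolding wave_op.simps K(3) using IH le_SucI[OF k] by blast
  qed
qed

section \<open>Uniqueness\<close>

lemma Cp_const_differentiable: "Cp (Suc k) (\<lambda>_::real. g) \<Longrightarrow> g differentiable (at x)"
  by simp

text \<open>The outer function of one variable need only be C^1 near the values taken. This serves
  the square root and the squared positive part in the energy weight.\<close>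

lemma Cp1_compose:
  assumes F: "Cp (Suc 0) F" and S: "\<And>p x. F p x \<in> S" and d: "\<And>y. y \<in> S \<Longrightarrow> (\<eta> has_real_derivative \<eta>' y) (at y)"
    and c: "continuous_on S \<eta>'"
  shows "Cp (Suc 0) (\<lambda>p x. \<eta> (F p x))"
    and "pdir (\<lambda>x. \<eta> (F p x)) v x = \<eta>' (F p x) * pdir (F p) v x"
proof -
  have D: "((\<lambda>x. \<eta> (F p x)) has_derivative (\<lambda>v. \<eta>' (F p x) * pdir (F p) v x)) (at x)" for p x
    using has_derivative_compose[OF Cp_has_derivative[OF F] d[OF S, unfolded has_field_derivative_def]] .
  show P: "pdir (\<lambda>x. \<eta> (F p x)) v x = \<eta>' (F p x) * pdir (F p) v x" for p v x
    by (rule pdir_eq[OF D])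
  have c\<eta>: "continuous_on S \<eta>" using d by (meson DERIV_isCont continuous_at_imp_continuous_on)
  show "Cp (Suc 0) (\<lambda>p x. \<eta> (F p x))"
    using Cp_continuous[OF F] Cp_continuous[OF Cp_pdir[OF F]] S differentiableI[OF D]
    by (auto simp: P case_prod_beta' intro!: continuous_intros continuous_on_compose2[OF c] continuous_on_compose2[OF c\<eta>])
qed

lemma DERIV_max_0_square: "((\<lambda>s::real. (max 0 s)\<^sup>2) has_real_derivative 2 * max 0 s) (at s)"
proof (cases "s = 0")
  case True
  have "((\<lambda>h::real. ((max 0 (0 + h))\<^sup>2 - (max 0 0)\<^sup>2) / h) \<longlongrightarrow> 0) (at 0)"
  proof (rule Lim_null_comparison)
    show "\<forall>\<^sub>F h::real in at 0. norm (((max 0 (0 + h))\<^sup>2 - (max 0 0)\<^sup>2) / h) \<le> \<bar>h\<bar>"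
      by (intro always_eventually allI) (auto simp: max_def power2_eq_square)
    show "((\<lambda>h::real. \<bar>h\<bar>) \<longlongrightarrow> 0) (at 0)" using tendsto_rabs[OF tendsto_ident_at, of 0 UNIV] by simp
  qed
  thus ?thesis using True by (simp add: DERIV_def)
next
  case False
  show ?thesis
  proof (cases "s > 0")
    case True
    show ?thesis
      by (rule has_field_derivative_transform_within_open[where S="{0<..}" and f="\<lambda>s. s\<^sup>2"])
         (use True in \<open>auto intro!: derivative_eq_intros\<close>)
  next
    case f: False
    show ?thesis
      by (rule has_field_derivative_transform_within_open[where S="{..<0}" and f="\<lambda>s. 0"])
         (use f False in auto)
  qed
qed

text \<open>Translating \<open>G\<close> by s v with |s| \<le> 1 does not change its integral,
  because the support stays inside the box of half-width K + 1. Differentiating this constant at s =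
  0 under the integral gives the claim.\<close>

lemma integral_pdir_eq_0:
  fixes G :: "'a::euclidean_space \<Rightarrow> real"
  assumes C: "Cp (Suc 0) (\<lambda>_::real. G)" and supp: "\<And>x. norm x > K \<Longrightarrow> G x = 0" and v: "norm v \<le> 1"
  shows "integral (cbox (- ((K + 1) *\<^sub>R One)) ((K + 1) *\<^sub>R One)) (pdir G v) = 0"
proof -
  let ?B = "cbox (- ((K + 1) *\<^sub>R One)) ((K + 1) *\<^sub>R One) :: 'a set"
  have B: "x \<in> ?B" if "norm x \<le> K + 1" for x
    using Basis_le_norm[of _ x] that by (fastforce simp: mem_box abs_le_iff)
  have cG: "continuous_on X G" for X
    using Cp_continuous_compose[OF C continuous_on_const continuous_on_id] .
  obtain i where i: "(G has_integral i) ?B"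
    using integrable_continuous[OF cG] unfolding integrable_on_def by blast
  have shift: "integral ?B (\<lambda>x. G (x + s *\<^sub>R v)) = i" if s: "\<bar>s\<bar> \<le> 1" for s
  proof -
    have sv: "norm (s *\<^sub>R v) \<le> 1" using s v by (simp add: mult_le_one)
    have out: "G (x + s *\<^sub>R v) = 0" if "x \<notin> ?B" for x
    proof -
      have "norm x > K + 1" using B that by force
      moreover have "norm x \<le> norm (x + s *\<^sub>R v) + norm (s *\<^sub>R v)"
        using norm_triangle_ineq4[of "x + s *\<^sub>R v" "s *\<^sub>R v"] by simp
      ultimately show ?thesis using sv by (intro supp) linarith
    qed
    have out': "G (x + s *\<^sub>R v) = 0" if "x \<notin> (\<lambda>x. x - s *\<^sub>R v) ` ?B" for x
    proof -
      have "x + s *\<^sub>R v \<notin> ?B" using that by (metis add_diff_cancel imageI)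
      hence "norm (x + s *\<^sub>R v) > K" using B[of "x + s *\<^sub>R v"] by force
      thus ?thesis by (rule supp)
    qed
    have "((\<lambda>x. G (x + s *\<^sub>R v)) has_integral i) ((\<lambda>x. x - s *\<^sub>R v) ` ?B)"
      using has_integral_affinity[OF i zero_neq_one[symmetric], of "s *\<^sub>R v"]
      by (simp only: scaleR_one div_by_1 abs_one power_one diff_conv_add_uminus)
    hence "((\<lambda>x. G (x + s *\<^sub>R v)) has_integral i) UNIV"
      by (rule has_integral_on_superset[OF _ out']) auto
    moreover have "(\<lambda>x. G (x + s *\<^sub>R v)) = (\<lambda>x. if x \<in> ?B then G (x + s *\<^sub>R v) else 0)"
      using out by auto
    ultimately have "((\<lambda>x. if x \<in> ?B then G (x + s *\<^sub>R v) else 0) has_integral i) UNIV"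
      by (rule back_subst[where P="\<lambda>f. (f has_integral i) UNIV"])
    hence "((\<lambda>x. G (x + s *\<^sub>R v)) has_integral i) ?B"
      by (simp only: has_integral_restrict_UNIV)
    thus ?thesis by (rule integral_unique)
  qed
  have "((\<lambda>s. integral ?B (\<lambda>x. G (x + s *\<^sub>R v))) has_field_derivative
     integral ?B ((\<lambda>s x. pdir G v (x + s *\<^sub>R v)) 0)) (at 0 within UNIV)"
  proof (rule leibniz_rule_field_derivative)
    show "continuous_on (UNIV \<times> ?B) (\<lambda>(s, x). pdir G v (x + s *\<^sub>R v))"
      unfolding case_prod_beta'
      by (rule Cp_continuous_compose[OF Cp_pdir[OF C] continuous_on_const]) (intro continuous_intros)
    show "((\<lambda>s. G (x + s *\<^sub>R v)) has_real_derivative pdir G v (x + s *\<^sub>R v)) (at s within UNIV)" for s x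
      using Cp_line[OF C] by simp
    show "(\<lambda>x. G (x + s *\<^sub>R v)) integrable_on ?B" for s
      by (intro integrable_continuous Cp_continuous_compose[OF C continuous_on_const] continuous_intros)
  qed auto
  hence 1: "((\<lambda>s. integral ?B (\<lambda>x. G (x + s *\<^sub>R v))) has_real_derivative integral ?B (pdir G v)) (at 0)" by simp
  have 2: "((\<lambda>s. integral ?B (\<lambda>x. G (x + s *\<^sub>R v))) has_real_derivative 0) (at 0)"
    by (rule has_field_derivative_transform_within_open[where S="{-1<..<1}" and f="\<lambda>s. i"]) (use shift in auto)
  show ?thesis by (rule DERIV_unique[OF 1 2])
qed

lemma pdir_slice:
  fixes H :: "'a::euclidean_space \<times> real \<Rightarrow> real"
  assumes C: "Cp k (\<lambda>_::real. H)"
  shows "Cp k (\<lambda>_::real. \<lambda>x. H (x, r))"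
    and "k > 0 \<Longrightarrow> pdir (\<lambda>x. H (x, r)) b x = pdir H (b, 0) (x, r)"
proof -
  have lin: "linear (\<lambda>x::'a. (x, 0::real))" by (auto simp: linear_iff)
  show "Cp k (\<lambda>_::real. \<lambda>x. H (x, r))"
    using Cp_compose_affine[OF C lin continuous_on_const continuous_on_id continuous_on_const[of _ "(0, r)"]] by simp
  assume "k > 0"
  then obtain j where "k = Suc j" using gr0_conv_Suc by blast
  hence "H differentiable (at y)" for y using C Cp_const_differentiable by blast
  from pdir_compose_affine(1)[OF this lin, of "(0, r)" b x]
  show "pdir (\<lambda>x. H (x, r)) b x = pdir H (b, 0) (x, r)" by simp
qed

text \<open>The energy is weighted with the square of the positive part of \<open>R - r - \<rho>\<close>, where \<open>\<rho> x = sqrt (1 + |x|^2)\<close>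
  replaces \<open>|x|\<close> to keep the weight of class C^1. As \<open>|grad \<rho>| \<le> 1\<close>, the weighted energy decreases.\<close>

lemma wave_energy:
  fixes v :: "'a::euclidean_space \<times> real \<Rightarrow> real"
  assumes C: "Cp (Suc (Suc 0)) (\<lambda>_::real. v)"
    and eq: "\<And>z. dtt v z = Lap v z"
    and ic: "\<And>x. v (x, 0) = 0" "\<And>x. pdir v (0,1) (x, 0) = 0"
    and r: "0 \<le> r" and x: "sqrt (1 + x \<bullet> x) < R - r"
  shows "pdir v (0,1) (x, r) = 0"
proof -
  note C1 = Cp_pdir[OF C] and C2 = Cp_pdir[OF Cp_pdir[OF C]]
  let ?vr = "pdir v (0,1)" and ?vb = "\<lambda>b. pdir v (b,0)"
  define \<rho> :: "'a \<Rightarrow> real" where "\<rho> x = sqrt (1 + x \<bullet> x)" for x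
  define g :: "'a \<times> real \<Rightarrow> real" where "g z = R - snd z - \<rho> (fst z)" for z
  define \<kappa> where "\<kappa> z = (max 0 (g z))\<^sup>2" for z
  have \<rho>: "\<rho> y \<ge> norm y" "\<rho> y > 0" "(\<rho> y)\<^sup>2 = 1 + y \<bullet> y" for y
    by (auto simp: \<rho>_def norm_eq_sqrt_inner intro: add_pos_nonneg)
  have q: "Cp (Suc 0) (\<lambda>_::real. \<lambda>z::'a \<times> real. 1 + fst z \<bullet> fst z)"
  proof -
    have "Cp (Suc 0) (\<lambda>_::real. \<lambda>z::'a \<times> real. 1 + (\<Sum>b\<in>Basis. (fst z \<bullet> b) * (fst z \<bullet> b)))"
      by (intro Cp_add Cp_const Cp_sum Cp_mult Cp_linear bounded_linear_intros) (auto intro: continuous_intros)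
    thus ?thesis by (simp flip: euclidean_inner)
  qed
  have qd: "pdir (\<lambda>z::'a \<times> real. 1 + fst z \<bullet> fst z) d z = 2 * (fst z \<bullet> fst d)" for d z
    by (rule pdir_eq) (auto intro!: derivative_eq_intros simp: inner_commute)
  note \<rho>C = Cp1_compose[OF q, where S="{0<..}" and \<eta>=sqrt and \<eta>'="\<lambda>y. inverse (sqrt y) / 2"]
  have \<rho>1: "Cp (Suc 0) (\<lambda>_::real. \<lambda>z::'a \<times> real. \<rho> (fst z))"
    unfolding \<rho>_def by (rule \<rho>C) (auto intro!: continuous_intros derivative_eq_intros add_pos_nonneg simp: field_simps)
  have \<rho>d: "pdir (\<lambda>z::'a \<times> real. \<rho> (fst z)) d z = (fst z \<bullet> fst d) / \<rho> (fst z)" for d z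
    unfolding \<rho>_def by (subst \<rho>C) (auto intro!: continuous_intros derivative_eq_intros add_pos_nonneg simp: field_simps qd)
  have g1: "Cp (Suc 0) (\<lambda>_::real. g)"
    unfolding g_def[abs_def] by (intro Cp_diff Cp_const Cp_linear bounded_linear_snd \<rho>1) auto
  have gd: "pdir g d z = - snd d - (fst z \<bullet> fst d) / \<rho> (fst z)" for d z
  proof -
    have "((\<lambda>z. R - snd z - \<rho> (fst z)) has_derivative (\<lambda>d. 0 - snd d - pdir (\<lambda>z. \<rho> (fst z)) d z)) (at z)"
      by (intro has_derivative_diff has_derivative_const has_derivative_snd has_derivative_ident Cp_has_derivative[OF \<rho>1])
    from pdir_eq[OF this] show ?thesis by (simp add: g_def[abs_def] \<rho>d)
  qed
  have c\<eta>: "continuous_on UNIV (\<lambda>s::real. 2 * max 0 s)" by (intro continuous_intros)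
  note K = Cp1_compose[OF g1 UNIV_I DERIV_max_0_square c\<eta>]
  have \<kappa>1: "Cp (Suc 0) (\<lambda>_::real. \<kappa>)" unfolding \<kappa>_def[abs_def] by (rule K(1))
  have \<kappa>d: "pdir \<kappa> d z = 2 * max 0 (g z) * pdir g d z" for d z
    unfolding \<kappa>_def[abs_def] by (rule K(2))
  have \<kappa>0: "\<kappa> (y, s) = 0" if "0 \<le> s" "norm y > R" for y s
    using \<rho>(1)[of y] that by (simp add: \<kappa>_def g_def)
  let ?B = "cbox (- ((R + 1) *\<^sub>R One)) ((R + 1) *\<^sub>R One) :: 'a set"
  define e where "e z = ?vr z * ?vr z + (\<Sum>b\<in>Basis. ?vb b z * ?vb b z)" for z
  define F where "F z = \<kappa> z * e z" for z
  define H where "H b z = \<kappa> z * (?vr z * ?vb b z)" for b z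
  have e1: "Cp (Suc 0) (\<lambda>_::real. e)" unfolding e_def[abs_def] by (intro Cp_add Cp_sum Cp_mult C1) auto
  have F1: "Cp (Suc 0) (\<lambda>_::real. F)" unfolding F_def[abs_def] by (intro Cp_mult \<kappa>1 e1)
  have H1: "Cp (Suc 0) (\<lambda>_::real. H b)" for b unfolding H_def[abs_def] by (intro Cp_mult \<kappa>1 C1)
  note dif = Cp_const_differentiable[OF \<kappa>1] Cp_const_differentiable[OF C1] Cp_const_differentiable[OF e1]
  have ed: "pdir e d z = 2 * ?vr z * pdir ?vr d z + (\<Sum>b\<in>Basis. 2 * ?vb b z * pdir (?vb b) d z)" for d z
  proof -
    have "(e has_derivative (\<lambda>d. (?vr z * pdir ?vr d z + pdir ?vr d z * ?vr z)
        + (\<Sum>b\<in>Basis. ?vb b z * pdir (?vb b) d z + pdir (?vb b) d z * ?vb b z))) (at z)"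
      unfolding e_def[abs_def]
      by (intro has_derivative_add has_derivative_sum has_derivative_mult differentiable_pdir dif)
    from pdir_eq[OF this] show ?thesis by (simp add: algebra_simps sum.distrib)
  qed
  have Fd: "pdir F (0,1) z = - 2 * max 0 (g z) * e z
      + \<kappa> z * (2 * ?vr z * (\<Sum>b\<in>Basis. pdir (?vb b) (b,0) z) + (\<Sum>b\<in>Basis. 2 * ?vb b z * pdir (?vb b) (0,1) z))" for z
    unfolding F_def[abs_def] by (subst pdir_mult) (auto simp: dif ed \<kappa>d gd eq)
  have Hd: "pdir (H b) (b,0) z = 2 * max 0 (g z) * (- (fst z \<bullet> b) / \<rho> (fst z)) * (?vr z * ?vb b z)
      + \<kappa> z * (?vb b z * pdir (?vb b) (0,1) z + ?vr z * pdir (?vb b) (b,0) z)" for b z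
  proof -
    have "pdir (pdir v (0,1)) (b,0) z = pdir (?vb b) (0,1) z" by (rule Cp_Schwarz[OF C])
    thus ?thesis
      unfolding H_def[abs_def] by (simp add: pdir_mult dif \<kappa>d gd)
  qed
  have le: "pdir F (0,1) z \<le> (\<Sum>b\<in>Basis. 2 * pdir (H b) (b,0) z)" for z
  proof -
    define m where "m = max 0 (g z)"
    \<comment> \<open>The gradient of -\<rho>, which is also the space gradient of
      \<open>g\<close>.\<close>
    define \<gamma> where "\<gamma> b = - (fst z \<bullet> b) / \<rho> (fst z)" for b
    have "(\<Sum>b\<in>Basis. \<gamma> b * \<gamma> b) = (fst z \<bullet> fst z) / (\<rho> (fst z))\<^sup>2"
      by (simp add: \<gamma>_def euclidean_inner[of "fst z" "fst z"] sum_divide_distrib power2_eq_square)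
    hence \<gamma>: "(\<Sum>b\<in>Basis. \<gamma> b * \<gamma> b) \<le> 1" by (simp add: \<rho>(3) divide_le_eq add_pos_nonneg)
    \<comment> \<open>Completing squares: the energy density plus the flux term is a sum of squares
      plus the square of \<open>?vr z\<close> times 1 - |\<gamma>|^2, and |\<gamma>| \<le>
      1.\<close>
    have "0 \<le> ?vr z * ?vr z * (1 - (\<Sum>b\<in>Basis. \<gamma> b * \<gamma> b)) + (\<Sum>b\<in>Basis. (?vb b z + ?vr z * \<gamma> b) * (?vb b z + ?vr z * \<gamma> b))"
      using \<gamma> by (intro add_nonneg_nonneg sum_nonneg mult_nonneg_nonneg zero_le_square) auto
    also have "(\<Sum>b\<in>Basis. (?vb b z + ?vr z * \<gamma> b) * (?vb b z + ?vr z * \<gamma> b))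
       = (\<Sum>b\<in>Basis. ?vb b z * ?vb b z) + 2 * (\<Sum>b\<in>Basis. \<gamma> b * (?vr z * ?vb b z)) + ?vr z * ?vr z * (\<Sum>b\<in>Basis. \<gamma> b * \<gamma> b)"
      unfolding sum_distrib_left sum.distrib[symmetric] by (rule sum.cong) (auto simp: algebra_simps)
    finally have "0 \<le> e z + 2 * (\<Sum>b\<in>Basis. \<gamma> b * (?vr z * ?vb b z))" by (simp add: e_def algebra_simps)
    hence "0 \<le> 2 * m * (e z + 2 * (\<Sum>b\<in>Basis. \<gamma> b * (?vr z * ?vb b z)))" by (simp add: m_def)
    moreover have "(\<Sum>b\<in>Basis. 2 * pdir (H b) (b,0) z) = 4 * m * (\<Sum>b\<in>Basis. \<gamma> b * (?vr z * ?vb b z))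
        + \<kappa> z * (\<Sum>b\<in>Basis. 2 * ?vb b z * pdir (?vb b) (0,1) z) + \<kappa> z * (2 * ?vr z * (\<Sum>b\<in>Basis. pdir (?vb b) (b,0) z))"
      unfolding Hd m_def[symmetric] \<gamma>_def[symmetric] sum_distrib_left sum.distrib[symmetric]
      by (rule sum.cong) (auto simp: algebra_simps)
    ultimately show ?thesis unfolding Fd m_def[symmetric] by (simp add: algebra_simps)
  qed
  define E where "E s = integral ?B (\<lambda>y. F (y, s))" for s
  have cF: "continuous_on X (\<lambda>y. F (f y))" if "continuous_on X f" for X :: "'z::topological_space set" and f
    using Cp_continuous_compose[OF F1 continuous_on_const that] .
  have cFr: "continuous_on X (\<lambda>y. pdir F d (f y))" if "continuous_on X f" for X :: "'z::topological_space set" and f d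
    using Cp_continuous_compose[OF Cp_pdir[OF F1] continuous_on_const that] .
  have dE: "(E has_real_derivative integral ?B (\<lambda>y. pdir F (0,1) (y, s))) (at s)" for s
  proof -
    have "((\<lambda>s. integral ?B (\<lambda>y. F (y, s))) has_field_derivative
       integral ?B ((\<lambda>s y. pdir F (0,1) (y, s)) s)) (at s within UNIV)"
    proof (rule leibniz_rule_field_derivative)
      show "continuous_on (UNIV \<times> ?B) (\<lambda>(s, y). pdir F (0,1) (y, s))"
        unfolding case_prod_beta' by (intro cFr continuous_intros)
      show "((\<lambda>s. F (y, s)) has_real_derivative pdir F (0,1) (y, s)) (at s within UNIV)" for s y
        using Cp_line[OF F1, of "(y, 0)" "(0,1)" s] by simp
      show "(\<lambda>y. F (y, s)) integrable_on ?B" for s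
        by (intro integrable_continuous cF continuous_intros)
    qed auto
    thus ?thesis by (simp add: E_def[abs_def])
  qed
  have dE0: "integral ?B (\<lambda>y. pdir F (0,1) (y, s)) \<le> 0" if s: "0 \<le> s" for s
  proof -
    have Hs: "Cp (Suc 0) (\<lambda>_::real. \<lambda>y. H b (y, s))" for b by (rule pdir_slice(1)[OF H1])
    have cH: "(\<lambda>y. pdir (H b) (b,0) (y, s)) integrable_on ?B" for b
      by (intro integrable_continuous Cp_continuous_compose[OF Cp_pdir[OF H1] continuous_on_const] continuous_intros)
    have H0: "integral ?B (\<lambda>y. pdir (H b) (b,0) (y, s)) = 0" if "b \<in> Basis" for b
    proof -
      have sl: "pdir (\<lambda>y. H b (y, s)) b = (\<lambda>y. pdir (H b) (b,0) (y, s))"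
        using pdir_slice(2)[OF H1] by blast
      have "H b (y, s) = 0" if "norm y > R" for y using \<kappa>0[OF s that] by (simp add: H_def)
      from integral_pdir_eq_0[OF Hs this, where v=b] that show ?thesis by (simp add: sl)
    qed
    have "integral ?B (\<lambda>y. pdir F (0,1) (y, s)) \<le> integral ?B (\<lambda>y. \<Sum>b\<in>Basis. 2 * pdir (H b) (b,0) (y, s))"
    proof (rule integral_le)
      show "(\<lambda>y. pdir F (0,1) (y, s)) integrable_on ?B" by (intro integrable_continuous cFr continuous_intros)
      show "(\<lambda>y. \<Sum>b\<in>Basis. 2 * pdir (H b) (b,0) (y, s)) integrable_on ?B"
        by (intro integrable_sum integrable_on_cmult_left[of _ _ 2, simplified] cH) auto
    qed (rule le)
    also have "\<dots> = (\<Sum>b\<in>Basis. 2 * integral ?B (\<lambda>y. pdir (H b) (b,0) (y, s)))"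
      by (subst integral_sum) (auto intro: integrable_on_cmult_left cH)
    also have "\<dots> = 0" by (simp add: H0)
    finally show ?thesis .
  qed
  have "E r \<le> E 0"
    by (rule DERIV_nonpos_imp_nonincreasing[OF r]) (use dE dE0 in blast)
  also have "E 0 = 0"
  proof -
    have "?vb b (y, 0) = 0" for b y
      using pdir_slice(2)[OF C, of 0 b y] ic(1) by (simp add: pdirI)
    hence "F (y, 0) = 0" for y by (simp add: F_def e_def ic(2))
    thus ?thesis by (simp add: E_def)
  qed
  finally have "E r \<le> 0" .
  moreover have e0: "e z \<ge> 0" for z
    unfolding e_def by (intro add_nonneg_nonneg sum_nonneg zero_le_square)
  moreover have F0: "F z \<ge> 0" for z
    unfolding F_def \<kappa>_def by (intro mult_nonneg_nonneg e0 zero_le_power2)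
  moreover have Fint: "(\<lambda>y. F (y, r)) integrable_on ?B"
    by (intro integrable_continuous cF continuous_intros)
  ultimately have "E r = 0" using integral_nonneg[OF Fint] by (simp add: E_def)
  hence Fi: "((\<lambda>y. F (y, r)) has_integral 0) ?B"
    using integrable_integral[OF Fint] by (simp add: E_def)
  have Rr: "R > 0" using x r real_sqrt_ge_zero[of "1 + x \<bullet> x"] by (smt (verit) inner_ge_zero)
  have "x \<in> ?B"
  proof -
    have "norm x \<le> R + 1" using \<rho>(1)[of x] x r by (simp add: \<rho>_def)
    thus ?thesis using Basis_le_norm[of _ x] by (fastforce simp: mem_box abs_le_iff)
  qed
  moreover have "box (- ((R + 1) *\<^sub>R One)) ((R + 1) *\<^sub>R One) \<noteq> ({} :: 'a set)"
    using Rr by (auto simp: box_ne_empty)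
  moreover have "continuous_on ?B (\<lambda>y. F (y, r))" by (intro cF continuous_intros)
  \<comment> \<open>A nonnegative continuous function with integral 0 vanishes pointwise; the weight
    can then be cancelled, as it is positive inside the cone.\<close>
  ultimately have "F (x, r) = 0" using has_integral_0_cbox_imp_0[OF _ F0 Fi] by blast
  moreover have "\<kappa> (x, r) > 0" using x by (simp add: \<kappa>_def g_def \<rho>_def)
  ultimately have "e (x, r) = 0" by (simp add: F_def)
  hence "?vr (x, r) * ?vr (x, r) = 0"
    unfolding e_def by (subst (asm) add_nonneg_eq_0_iff) (auto intro: sum_nonneg)
  thus ?thesis by simp
qed

text \<open>The cones exhaust the half space as \<open>R\<close> grows, so by
  \<open>wave_energy\<close> the time derivative vanishes everywhere and \<open>v\<close> keeps its
  initial value 0.\<close>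

lemma wave_zero_forward:
  fixes v :: "'a::euclidean_space \<times> real \<Rightarrow> real"
  assumes C: "Cp (Suc (Suc 0)) (\<lambda>_::real. v)"
    and eq: "\<And>z. dtt v z = Lap v z"
    and ic: "\<And>x. v (x, 0) = 0" "\<And>x. pdir v (0,1) (x, 0) = 0"
    and r: "0 \<le> r"
  shows "v (x, r) = 0"
proof -
  have "pdir v (0,1) (x, s) = 0" if "0 \<le> s" for s
    by (rule wave_energy[OF C eq ic that, where R="s + sqrt (1 + x \<bullet> x) + 1"]) simp
  hence "((\<lambda>s. v (x, s)) has_real_derivative 0) (at s)" if "0 \<le> s" for s
    using Cp_line[OF C, of "(x, 0)" "(0,1)" s] that by simp
  hence "v (x, 0) \<le> v (x, r)" "v (x, 0) \<ge> v (x, r)"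
    by (auto intro!: DERIV_nonneg_imp_nondecreasing[OF r, of "\<lambda>s. v (x, s)"] DERIV_nonpos_imp_nonincreasing[OF r, of "\<lambda>s. v (x, s)"])
  thus ?thesis using ic by simp
qed

text \<open>\<open>is_wave_sol\<close> speaks of all real times. Negative ones are reached by
  reflecting time, which preserves the equation and the zero data.\<close>

lemma wave_zero:
  fixes v :: "'a::euclidean_space \<times> real \<Rightarrow> real"
  assumes C: "Cp (Suc (Suc 0)) (\<lambda>_::real. v)"
    and eq: "\<And>z. dtt v z = Lap v z"
    and ic: "\<And>x. v (x, 0) = 0" "\<And>x. pdir v (0,1) (x, 0) = 0"
  shows "v (x, r) = 0"
proof (cases "r \<ge> 0")
  case True
  then show ?thesis by (rule wave_zero_forward[OF assms])
next
  case False
  let ?A = "\<lambda>z::'a \<times> real. (fst z, - snd z)"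
  have lin: "linear ?A" by (auto simp: linear_iff)
  define u where "u z = v (?A z)" for z
  have Cu: "Cp k (\<lambda>_::real. \<lambda>z. w (?A z))" if "Cp k (\<lambda>_::real. w)" for w k
    using Cp_compose_affine[OF that lin continuous_on_const continuous_on_id continuous_on_const[of _ 0]] by (simp add: zero_prod_def)
  have d: "pdir (\<lambda>z. w (?A z)) d z = pdir w (?A d) (?A z)" if "Cp (Suc k) (\<lambda>_::real. w)" for w k d z
    using pdir_compose_affine(1)[OF Cp_const_differentiable[OF that] lin, of 0 d z] by (simp add: zero_prod_def)
  have d1: "pdir u d = (\<lambda>z. pdir v (?A d) (?A z))" for d unfolding u_def[abs_def] using d[OF C] by blast
  have d2: "pdir (pdir u d) d z = pdir (pdir v (?A d)) (?A d) (?A z)" for d z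
    unfolding d1 by (rule d[OF Cp_pdir[OF C]])
  have m: "pdir w (0,-1) z = - pdir w (0,1) z" if "Cp (Suc k) (\<lambda>_::real. w)" for w :: "'a \<times> real \<Rightarrow> real" and k z
  proof -
    interpret bounded_linear "\<lambda>d. pdir w d z"
      by (rule has_derivative_bounded_linear[OF differentiable_pdir[OF Cp_const_differentiable[OF that]]])
    show ?thesis using neg[of "(0,1)"] by simp
  qed
  have m2: "pdir (pdir v (0,-1)) (0,-1) z = dtt v z" for z
  proof -
    have "pdir v (0,-1) = (\<lambda>z. (-1) * pdir v (0,1) z)" using m[OF C] by auto
    thus ?thesis using pdir_cmult[OF Cp_const_differentiable[OF Cp_pdir[OF C]], of "-1"] m[OF Cp_pdir[OF C]] by simp
  qed
  have "u (x, -r) = 0"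
  proof (rule wave_zero_forward)
    show "Cp (Suc (Suc 0)) (\<lambda>_::real. u)" unfolding u_def[abs_def] by (rule Cu[OF C])
    show "dtt u z = Lap u z" for z
      unfolding d2 using eq by (simp add: m2)
  qed (use ic m[OF C] False in \<open>auto simp: d1\<close>, simp add: u_def ic)
  thus ?thesis by (simp add: u_def)
qed

section \<open>Existence and uniqueness for data of finite differentiability\<close>

text \<open>\<open>bs\<close> lists the derivatives already taken and \<open>j\<close> counts those
  still to come, at most \<open>k\<close> in total.\<close>

lemma Ck_on_imp_Cp:
  assumes g: "Ck_on k UNIV g" and bs: "set bs \<subseteq> Basis" "length bs + j \<le> k"
  shows "Cp j (\<lambda>_::'p::topological_space. pdirs g bs)"
  using bs
proof (induction j arbitrary: bs)
  have cont: "continuous_on UNIV (\<lambda>(p::'p, x). pdirs g bs x)" if "set bs \<subseteq> Basis" "length bs \<le> k" for bs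
  proof -
    have "continuous_on UNIV (pdirs g bs)" using g that by (simp add: Ck_on_def)
    thus ?thesis unfolding case_prod_beta' by (rule continuous_on_compose2[OF _ continuous_on_snd[OF continuous_on_id]]) simp
  qed
  {
    case 0 then show ?case using cont by simp
  next
    case (Suc j)
    show ?case
    proof (rule Cp_SucI[where F'="\<lambda>b _. pdirs g (b # bs)"])
      show "continuous_on UNIV (\<lambda>(p::'p, x). pdirs g bs x)" using Suc.prems by (intro cont) auto
      fix b x assume b: "b \<in> (Basis :: 'a set)"
      have "(\<lambda>s. pdirs g bs (x + s *\<^sub>R b)) differentiable (at 0)"
        using g Suc.prems b by (simp add: Ck_on_def)
      thus "has_pdir (pdirs g bs) b (pdirs g (b # bs) x) x"
        by (simp add: pdir_def DERIV_deriv_iff_real_differentiable)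
    next
      fix b assume b: "b \<in> (Basis :: 'a set)"
      show "Cp j (\<lambda>_::'p. pdirs g (b # bs))" by (rule Suc.IH) (use Suc.prems b in auto)
    qed
  }
qed

lemma Cp_pdirs:
  assumes "Cp (length bs + j) (\<lambda>_::real. g)"
  shows "Cp j (\<lambda>_::real. pdirs g bs)"
  using assms
proof (induction bs arbitrary: j)
  case (Cons b bs)
  have "Cp (Suc j) (\<lambda>_::real. pdirs g bs)" by (rule Cons.IH) (use Cons.prems in simp)
  from Cp_pdir[OF this, of b] show ?case by simp
qed simp

lemma Cp_imp_Ck_on:
  assumes "Cp k (\<lambda>_::real. g)"
  shows "Ck_on k UNIV g"
  unfolding Ck_on_def
proof (intro allI impI conjI ballI)
  fix bs :: "'a list" assume bs: "set bs \<subseteq> Basis \<and> length bs \<le> k"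
  have C: "Cp (k - length bs) (\<lambda>_::real. pdirs g bs)" by (rule Cp_pdirs) (use assms bs in simp)
  show "continuous_on UNIV (pdirs g bs)"
    using Cp_continuous_compose[OF C continuous_on_const continuous_on_id] by simp
  fix b x assume "length bs < k"
  then obtain j where "k - length bs = Suc j" by (metis Suc_diff_Suc)
  hence "Cp (Suc j) (\<lambda>_::real. pdirs g bs)" using C by simp
  from Cp_line[OF this, of x b 0] show "(\<lambda>s. pdirs g bs (x + s *\<^sub>R b)) differentiable (at 0)"
    by (auto simp: real_differentiable_def)
qed

text \<open>\<open>wave_op\<close> processes the directions in a fixed order. Any enumeration of the
  basis will do, since by uniqueness the solution does not depend on it.\<close>

definition axes :: "(real^'n::finite) list" where
  "axes = (SOME es. distinct es \<and> set es = Basis)"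

lemma axes: "distinct (axes :: (real^'n::finite) list)" "set (axes :: (real^'n) list) = Basis"
  "length (axes :: (real^'n) list) = CARD('n)"
proof -
  have "\<exists>es :: (real^'n) list. distinct es \<and> set es = Basis"
    using finite_distinct_list[OF finite_Basis] by metis
  from someI_ex[OF this] show 1: "distinct (axes :: (real^'n) list)" "set (axes :: (real^'n) list) = Basis"
    by (simp_all add: axes_def)
  show "length (axes :: (real^'n) list) = CARD('n)"
    using distinct_card[OF 1(1)] 1(2) by simp
qed

lemma Basis_vec_real: "(Basis :: (real^'n::finite) set) = range (\<lambda>i. axis i 1)"
  by (auto simp: Basis_vec_def)

lemma lapx_eq: "lapx v p = (\<Sum>b\<in>Basis. pdir (pdir v (b, 0)) (b, 0) p)"
  unfolding lapx_def Basis_vec_real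
  by (subst sum.reindex) (auto simp: inj_on_def axis_eq_axis)

lemma lap_eq: "lap v p = (\<Sum>b\<in>Basis. pdir (pdir v b) b p)"
  unfolding lap_def Basis_vec_real
  by (subst sum.reindex) (auto simp: inj_on_def axis_eq_axis)

lemma wave_sol_Cp: "is_wave_sol h v \<Longrightarrow> Cp (Suc (Suc 0)) (\<lambda>_::real. v)"
  using Ck_on_imp_Cp[of 2 v "[]" "Suc (Suc 0)"] by (auto simp: is_wave_sol_def simp del: Cp.simps)

lemma wave_sol_unique:
  assumes 1: "is_wave_sol h v1" and 2: "is_wave_sol h v2"
  shows "v1 = v2"
proof
  fix z
  note C1 = wave_sol_Cp[OF 1] and C2 = wave_sol_Cp[OF 2]
  let ?v = "\<lambda>z. v1 z - v2 z"
  have C: "Cp (Suc (Suc 0)) (\<lambda>_::real. ?v)" by (rule Cp_diff[OF C1 C2])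
  have d: "pdir (\<lambda>z. w1 z - w2 z) d = (\<lambda>z. pdir w1 d z - pdir w2 d z)"
    if "Cp (Suc k) (\<lambda>_::real. w1)" "Cp (Suc k) (\<lambda>_::real. w2)" for w1 w2 k and d :: "(real^'a) \<times> real"
    by (rule ext, rule pdir_eq, intro has_derivative_diff Cp_has_derivative[OF that(1)] Cp_has_derivative[OF that(2)])
  have dd: "pdir (pdir ?v d) d z = pdir (pdir v1 d) d z - pdir (pdir v2 d) d z" for d z
    unfolding d[OF C1 C2] d[OF Cp_pdir[OF C1] Cp_pdir[OF C2]] ..
  have "?v (fst z, snd z) = 0"
  proof (rule wave_zero[OF C])
    show "dtt ?v z = Lap ?v z" for z
      using 1 2 unfolding dd sum_subtractf by (simp add: is_wave_sol_def lapx_eq del: split_paired_All)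
  qed (use 1 2 in \<open>simp_all add: d[OF C1 C2] is_wave_sol_def\<close>)
  thus "v1 z = v2 z" by simp
qed

text \<open>Uniqueness is what lets an explicit solution evaluate the definite description in
  \<open>wave\<close>.\<close>

lemma wave_eqI: "is_wave_sol h v \<Longrightarrow> wave h x r = v (x, r)"
  unfolding wave_def using wave_sol_unique by (metis the_equality)

lemma wave_op_axes:
  fixes h :: "'p::topological_space \<Rightarrow> real^'n::finite \<Rightarrow> real"
  assumes "Cp (CARD('n) div 2 + Suc (Suc k)) h"
  shows "Cp (Suc (Suc k)) (\<lambda>p. wave_op axes (h p))"
    and "wave_op axes (h p) (x, 0) = h p x" and "pdir (wave_op axes (h p)) (0,1) (x, 0) = 0"
    and "dtt (wave_op axes (h p)) z = Lap (wave_op axes (h p)) z"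
proof -
  have h: "Cp (length (axes :: (real^'n) list) div 2 + Suc (Suc k)) h" using assms by (simp only: axes)
  from wave_op_properties[OF this]
  show "Cp (Suc (Suc k)) (\<lambda>p. wave_op axes (h p))" "wave_op axes (h p) (x, 0) = h p x" "pdir (wave_op axes (h p)) (0,1) (x, 0) = 0"
    "dtt (wave_op axes (h p)) z = Lap (wave_op axes (h p)) z"
    by (auto simp: sum_list_distinct_conv_sum_set axes simp del: Cp.simps split_paired_All)
qed

text \<open>The factor \<open>c\<close> is there because the solution with data f(\<cdot>, \<tau>)
  is obtained as \<tau>^(e - 2) times the one with the regularised data.\<close>

lemma wave_op_axes_sol:
  fixes h :: "'p::topological_space \<Rightarrow> real^'n::finite \<Rightarrow> real"
  assumes "Cp (CARD('n) div 2 + Suc (Suc k)) h"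
  shows "is_wave_sol (\<lambda>x. c * h p x) (\<lambda>z. c * wave_op axes (h p) z)"
proof -
  have h: "Cp (CARD('n) div 2 + Suc (Suc k)) (\<lambda>_::real. \<lambda>x. c * h p x)"
    using Cp_cmult[OF Cp_reparam[OF assms, of "\<lambda>_. p"], of c] by simp
  note A = wave_op_axes[OF assms]
  have C: "Cp (Suc (Suc k)) (\<lambda>_::real. wave_op axes (h p))" using Cp_reparam[OF A(1), of "\<lambda>_. p"] by simp
  have d: "pdir (\<lambda>z. c * w z) d = (\<lambda>z. c * pdir w d z)" if "Cp (Suc j) (\<lambda>_::real. w)" for w j and d :: "(real^'n) \<times> real"
    by (rule ext, rule pdir_cmult[OF Cp_const_differentiable[OF that]])
  have dd: "pdir (pdir (\<lambda>z. c * wave_op axes (h p) z) d) d = (\<lambda>z. c * pdir (pdir (wave_op axes (h p)) d) d z)" for d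
    unfolding d[OF C] by (rule d[OF Cp_pdir[OF C]])
  have "Cp 2 (\<lambda>_::real. \<lambda>z. c * wave_op axes (h p) z)" by (rule Cp_cmult, rule Cp_mono[OF C]) simp
  from Cp_imp_Ck_on[OF this] show ?thesis
    unfolding is_wave_sol_def lapx_eq dd unfolding d[OF C]
    using A(2-4) by (simp add: sum_distrib_left del: split_paired_All)
qed

text \<open>The weight \<tau>^(2 - e) against the bound \<tau>^(2 e - 2) leaves \<tau>^e, so every
  space derivative up to order \<open>K\<close>, so weighted, extends continuously by 0. In \<tau>,
  a parameter of \<open>Cp\<close>, continuity is all that is asked.\<close>

lemma Cp_powr_extension:
  fixes f :: "'a::euclidean_space \<times> real \<Rightarrow> real"
  assumes f: "Ck_on K (UNIV \<times> {0<..}) f" and e: "0 < e"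
    and bound: "\<And>\<alpha>. set \<alpha> \<subseteq> Basis \<Longrightarrow> length \<alpha> \<le> K \<Longrightarrow> \<exists>C. \<exists>\<delta>>0. \<forall>x t. 0 < t \<and> t < \<delta> \<longrightarrow>
       \<bar>pdirs f (map (\<lambda>b. (b, 0)) \<alpha>) (x, t)\<bar> \<le> C * t powr (2 * e - 2)"
  shows "Cp K (\<lambda>\<tau> x. if \<tau> > 0 then \<tau> powr (2 - e) * f (x, \<tau>) else 0)"
proof -
  define F where "F \<alpha> \<tau> x = (if \<tau> > 0 then \<tau> powr (2 - e) * pdirs f (map (\<lambda>b. (b, 0)) \<alpha>) (x, \<tau>) else 0)" for \<alpha> :: "'a list" and \<tau> x
  have setB: "set (map (\<lambda>b. (b, 0::real)) \<alpha>) \<subseteq> Basis" if "set \<alpha> \<subseteq> Basis" for \<alpha> :: "'a list"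
    using that by (auto simp: Basis_prod_def)
  have cont: "continuous_on UNIV (\<lambda>(\<tau>, x). F \<alpha> \<tau> x)" if \<alpha>: "set \<alpha> \<subseteq> Basis" "length \<alpha> \<le> K" for \<alpha>
  proof -
    let ?G = "\<lambda>(\<tau>, x). F \<alpha> \<tau> x"
    have c: "continuous_on (UNIV \<times> {0<..}) (pdirs f (map (\<lambda>b. (b, 0)) \<alpha>))"
      using f \<alpha> setB by (simp add: Ck_on_def)
    have "continuous_on ({0<..} \<times> UNIV) (\<lambda>(\<tau>, x). \<tau> powr (2 - e) * pdirs f (map (\<lambda>b. (b, 0)) \<alpha>) (x, \<tau>))"
      unfolding case_prod_beta' by (intro continuous_intros continuous_on_compose2[OF c]) auto
    hence pos: "continuous_on ({0<..} \<times> UNIV) ?G"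
      by (rule continuous_on_eq) (auto simp: F_def)
    have neg: "continuous_on ({..<0} \<times> UNIV) ?G"
      by (rule continuous_on_eq[OF continuous_on_const[of _ 0]]) (auto simp: F_def)
    have zero: "isCont ?G (0, x)" for x
    proof -
      obtain C \<delta> where C: "\<delta> > 0" "\<And>y t. 0 < t \<Longrightarrow> t < \<delta> \<Longrightarrow>
         \<bar>pdirs f (map (\<lambda>b. (b, 0)) \<alpha>) (y, t)\<bar> \<le> C * t powr (2 * e - 2)"
        using bound[OF \<alpha>] by blast
      have "((\<lambda>p. ?G p) \<longlongrightarrow> 0) (at (0, x))"
      proof (rule Lim_null_comparison)
        have "\<forall>\<^sub>F p :: real \<times> 'a in at (0, x). fst p < \<delta>"
          using C(1) order_tendstoD(2)[OF tendsto_fst[OF tendsto_ident_at], of "(0, x)" \<delta>] by simp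
        thus "\<forall>\<^sub>F p in at (0, x). norm (?G p) \<le> \<bar>C\<bar> * \<bar>fst p\<bar> powr e"
        proof eventually_elim
          case (elim p)
          obtain \<tau> y where p: "p = (\<tau>, y)" by (cases p)
          show ?case
          proof (cases "\<tau> > 0")
            case True
            have "norm (?G p) = \<tau> powr (2 - e) * \<bar>pdirs f (map (\<lambda>b. (b, 0)) \<alpha>) (y, \<tau>)\<bar>"
              using True by (simp add: p F_def abs_mult)
            also have "\<dots> \<le> \<tau> powr (2 - e) * (C * \<tau> powr (2 * e - 2))"
              using C(2)[OF True] elim p by (intro mult_left_mono) auto
            also have "\<dots> = C * \<tau> powr e" by (simp flip: powr_add)
            also have "\<dots> \<le> \<bar>C\<bar> * \<bar>fst p\<bar> powr e" using True by (auto simp: p intro: mult_right_mono)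
            finally show ?thesis .
          qed (simp add: p F_def)
        qed
        have "((\<lambda>p::real \<times> 'a. \<bar>C\<bar> * \<bar>fst p\<bar> powr e) \<longlongrightarrow> \<bar>C\<bar> * \<bar>fst (0::real, x)\<bar> powr e) (at (0, x))"
        proof (intro tendsto_mult tendsto_const tendsto_powr' disjI2 conjI)
          show "((\<lambda>p::real \<times> 'a. \<bar>fst p\<bar>) \<longlongrightarrow> \<bar>fst (0::real, x)\<bar>) (at (0, x))"
            by (intro tendsto_rabs tendsto_fst tendsto_ident_at)
        qed (use e in auto)
        thus "((\<lambda>p::real \<times> 'a. \<bar>C\<bar> * \<bar>fst p\<bar> powr e) \<longlongrightarrow> 0) (at (0, x))" by simp
      qed
      thus ?thesis by (simp add: isCont_def F_def)
    qed
    have "isCont ?G p" for p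
    proof -
      obtain \<tau> y where p: "p = (\<tau>, y)" by (cases p)
      have "open ({0<..} \<times> (UNIV::'a set) :: (real\<times>'a) set)" "open ({..<0} \<times> (UNIV::'a set) :: (real\<times>'a) set)"
        by (auto intro: open_Times)
      thus ?thesis using pos neg zero[of y] p
        by (cases "\<tau> = 0"; cases "\<tau> > 0") (auto simp: continuous_on_eq_continuous_at)
    qed
    thus ?thesis by (intro continuous_at_imp_continuous_on) auto
  qed
  have "Cp j (F \<alpha>)" if "set \<alpha> \<subseteq> Basis" "length \<alpha> + j \<le> K" for j \<alpha>
    using that
  proof (induction j arbitrary: \<alpha>)
    case 0 then show ?case using cont by simp
  next
    case (Suc j)
    show ?case
    proof (rule Cp_SucI[where F'="\<lambda>b. F (b # \<alpha>)"])
      show "continuous_on UNIV (\<lambda>(\<tau>, x). F \<alpha> \<tau> x)" using Suc.prems by (intro cont) auto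
      show "Cp j (F (b # \<alpha>))" if "b \<in> Basis" for b by (rule Suc.IH) (use Suc.prems that in auto)
      fix \<tau> x and b :: 'a assume b: "b \<in> Basis"
      show "((\<lambda>s. F \<alpha> \<tau> (x + s *\<^sub>R b)) has_real_derivative F (b # \<alpha>) \<tau> x) (at 0)"
      proof (cases "\<tau> > 0")
        case True
        have "(\<lambda>s. pdirs f (map (\<lambda>b. (b, 0)) \<alpha>) ((x, \<tau>) + s *\<^sub>R (b, 0))) differentiable (at 0)"
          using f[unfolded Ck_on_def, rule_format, of "map (\<lambda>b. (b, 0)) \<alpha>"] Suc.prems setB[of \<alpha>] b True
          by (auto simp: Basis_prod_def)
        hence "((\<lambda>s. pdirs f (map (\<lambda>b. (b, 0)) \<alpha>) ((x, \<tau>) + s *\<^sub>R (b, 0))) has_real_derivative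
            pdirs f (map (\<lambda>b. (b, 0)) (b # \<alpha>)) (x, \<tau>)) (at 0)"
          by (simp add: pdir_def DERIV_deriv_iff_real_differentiable)
        from DERIV_cmult[OF this, of "\<tau> powr (2 - e)"] show ?thesis using True by (simp add: F_def)
      qed (simp add: F_def)
    qed
  qed
  from this[of "[]" K] show ?thesis by (simp add: F_def[abs_def] cong: if_cong)
qed

section \<open>The kernel of the representation formula\<close>

text \<open>\<open>tprim w (x, r)\<close> is the integral of \<open>w (x, \<cdot>)\<close> from \<open>0\<close> to \<open>r\<close>, written so that it makes sense for negative \<open>r\<close>.\<close>

definition tprim :: "('a::euclidean_space \<times> real \<Rightarrow> real) \<Rightarrow> 'a \<times> real \<Rightarrow> real" where
  "tprim w z = snd z * integral {0..1} (\<lambda>s. w (fst z, s * snd z))"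

lemma linear_scale_snd: "linear (\<lambda>z::'a::euclidean_space \<times> real. (fst z, s * snd z))"
  by (auto simp: linear_iff algebra_simps)

lemma Cp_scale_snd:
  fixes w :: "'p::topological_space \<Rightarrow> 'a::euclidean_space \<times> real \<Rightarrow> real"
  assumes "Cp k w"
  shows "Cp k (\<lambda>q z. w (fst q) (fst z, snd q * snd z))"
proof -
  have "Cp k (\<lambda>q z. w (fst q) ((\<lambda>q z. (fst z, snd q * snd z)) q z + 0))"
    by (rule Cp_compose_affine[OF assms linear_scale_snd]) (intro continuous_intros)+
  thus ?thesis by (simp add: zero_prod_def)
qed

lemma pdir_scale_snd:
  fixes g :: "'a::euclidean_space \<times> real \<Rightarrow> real"
  assumes "\<And>y. g differentiable (at y)"
  shows "pdir (\<lambda>z. g (fst z, s * snd z)) d z = pdir g (fst d, s * snd d) (fst z, s * snd z)"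
  using pdir_compose_affine(1)[OF assms linear_scale_snd, of s 0 d z] by (simp add: zero_prod_def)

lemma Cp_tprim:
  assumes "Cp k w" shows "Cp k (\<lambda>p. tprim (w p))"
proof -
  have "Cp k (\<lambda>p z. snd z * integral {0..1} (\<lambda>s. w (fst (p, s)) (fst z, snd (p, s) * snd z)))"
    by (intro Cp_mult Cp_linear bounded_linear_snd Cp_integral Cp_scale_snd assms)
  thus ?thesis by (simp add: tprim_def[abs_def])
qed

lemma pdir_tprim:
  fixes w :: "'p::topological_space \<Rightarrow> 'a::euclidean_space \<times> real \<Rightarrow> real"
  assumes "Cp (Suc k) w"
  shows "pdir (tprim (w p)) d z = snd z * integral {0..1} (\<lambda>s. pdir (w p) (fst d, s * snd d) (fst z, s * snd z))
     + snd d * integral {0..1} (\<lambda>s. w p (fst z, s * snd z))"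
proof -
  note C = Cp_scale_snd[OF assms]
  have I: "pdir (\<lambda>z. integral {0..1} (\<lambda>s. w p (fst z, s * snd z))) d
      = (\<lambda>z. integral {0..1} (\<lambda>s. pdir (w p) (fst d, s * snd d) (fst z, s * snd z)))"
    using Cp_pdir_integral[OF C, of 0 1 p d] by (simp add: pdir_scale_snd[OF Cp_differentiable[OF assms]])
  have D: "(\<lambda>z. integral {0..1} (\<lambda>s. w p (fst z, s * snd z))) differentiable (at z)"
    using Cp_differentiable[OF Cp_integral[OF C], of 0 1 p z] by simp
  show ?thesis unfolding tprim_def[abs_def] by (simp add: pdir_mult[OF pdir_snd(2) D] pdir_snd(1) I)
qed

lemma pdir_tprim_space:
  assumes "Cp (Suc k) w"
  shows "pdir (tprim (w p)) (b, 0) = tprim (pdir (w p) (b, 0))"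
  by (rule ext) (simp add: pdir_tprim[OF assms] tprim_def)

text \<open>Differentiating under the integral produces w + s r w_r, which is the s-derivative of s
  w(x, s r); its integral over [0, 1] is w(x, r).\<close>

lemma pdir_tprim_time:
  fixes w :: "'p::topological_space \<Rightarrow> 'a::euclidean_space \<times> real \<Rightarrow> real"
  assumes "Cp (Suc k) w"
  shows "pdir (tprim (w p)) (0, 1) z = w p z"
proof -
  obtain x r where z: "z = (x, r)" by (cases z)
  note I = continuous_intros Cp_continuous_compose[OF assms continuous_on_const[of _ p]]
     Cp_continuous_compose[OF Cp_pdir[OF assms] continuous_on_const[of _ p]]
  have lin: "pdir (w p) (0, s) y = s * pdir (w p) (0, 1) y" for s y
  proof -
    interpret bounded_linear "\<lambda>d. pdir (w p) d y"
      by (rule has_derivative_bounded_linear[OF Cp_has_derivative[OF assms]])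
    show ?thesis using scaleR[of s "(0, 1)"] by simp
  qed
  have d: "((\<lambda>s. s * w p (x, s * r)) has_real_derivative w p (x, s * r) + r * (s * pdir (w p) (0, 1) (x, s * r))) (at s)" for s
  proof -
    have "((\<lambda>s. w p (x, s * r)) has_real_derivative pdir (w p) (0, r) (x, s * r)) (at s)"
      using Cp_line[OF assms, of p "(x, 0)" "(0, r)" s] by simp
    hence "((\<lambda>s. s * w p (x, s * r)) has_real_derivative 1 * w p (x, s * r) + pdir (w p) (0, r) (x, s * r) * s) (at s)"
      by (rule DERIV_mult[OF DERIV_ident])
    thus ?thesis by (simp add: lin[of r] mult.commute mult.left_commute)
  qed
  have "pdir (tprim (w p)) (0, 1) z = integral {0..1} (\<lambda>s. w p (x, s * r)) + integral {0..1} (\<lambda>s. r * (s * pdir (w p) (0, 1) (x, s * r)))"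
  proof -
    have "pdir (w p) (fst (0::'a, 1::real), s * snd (0::'a, 1::real)) (fst z, s * snd z) = s * pdir (w p) (0, 1) (x, s * r)" for s
      using lin[of s "(x, s * r)"] by (simp add: z)
    thus ?thesis unfolding pdir_tprim[OF assms] by (simp only: z fst_conv snd_conv integral_mult_right mult_1)
  qed
  also have "\<dots> = integral {0..1} (\<lambda>s. w p (x, s * r) + r * (s * pdir (w p) (0, 1) (x, s * r)))"
    by (rule integral_add[symmetric]) (intro integrable_continuous_real I)+
  also have "\<dots> = w p z" using integral_real_derivative[OF _ d, of 0 1] by (simp add: z)
  finally show ?thesis .
qed

lemma tprim_FTC:
  assumes "\<And>r. (g has_real_derivative w (x, r)) (at r)"
  shows "tprim w (x, R) = g R - g 0"
proof -
  have "((\<lambda>s. g (s * R)) has_real_derivative w (x, s * R) * R) (at s)" for s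
    by (rule DERIV_chain2[OF assms]) (auto intro!: derivative_eq_intros)
  from integral_real_derivative[OF _ this, of 0 1] show ?thesis by (simp add: tprim_def mult.commute[of R])
qed

lemma tprim_zero: "tprim w (x, 0) = 0"
  by (simp add: tprim_def)

lemma tprim_sum:
  fixes w :: "'i \<Rightarrow> 'p::topological_space \<Rightarrow> 'a::euclidean_space \<times> real \<Rightarrow> real"
  assumes "finite A" "\<And>i. i \<in> A \<Longrightarrow> Cp k (w i)"
  shows "tprim (\<lambda>z. \<Sum>i\<in>A. w i p z) z = (\<Sum>i\<in>A. tprim (w i p) z)"
proof -
  have "(\<lambda>s. w i p (fst z, s * snd z)) integrable_on {0..1}" if "i \<in> A" for i
    by (intro integrable_continuous_real Cp_continuous_compose[OF assms(2)[OF that] continuous_on_const] continuous_intros)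
  thus ?thesis unfolding tprim_def using assms(1) by (simp add: integral_sum sum_distrib_left)
qed

text \<open>With \<open>T = 3 t^(1/3)\<close> and \<open>\<sigma> = 3 \<tau>^(1/3)\<close> this is the integral of \<open>v (x, r) (T^2 + \<sigma>^2 - r^2)\<close> over
  \<open>0 \<le> r \<le> T - \<sigma>\<close>.\<close>

definition \<Phi> :: "('a::euclidean_space \<times> real \<Rightarrow> real) \<Rightarrow> real \<Rightarrow> 'a \<times> real \<Rightarrow> real" where
  "\<Phi> v \<sigma> z = ((snd z)\<^sup>2 + \<sigma>\<^sup>2) * tprim v (fst z, snd z - \<sigma>) - tprim (\<lambda>z. (snd z)\<^sup>2 * v z) (fst z, snd z - \<sigma>)"

lemma Cp_delay:
  fixes w :: "'p::topological_space \<Rightarrow> 'a::euclidean_space \<times> real \<Rightarrow> real"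
  assumes "Cp k w"
  shows "Cp k (\<lambda>q z. w (fst q) (fst z, snd z - snd q))"
proof -
  have "Cp k (\<lambda>q z. w (fst q) ((\<lambda>q z. z) q z + (0, - snd q)))"
    by (rule Cp_compose_affine[OF assms]) (auto simp: linear_iff intro!: continuous_intros)
  thus ?thesis by (simp add: plus_prod_def)
qed

lemma pdir_delay:
  fixes g :: "'a::euclidean_space \<times> real \<Rightarrow> real"
  assumes "\<And>y. g differentiable (at y)"
  shows "pdir (\<lambda>z. g (fst z, snd z - \<sigma>)) d z = pdir g d (fst z, snd z - \<sigma>)"
    and "(\<lambda>z. g (fst z, snd z - \<sigma>)) differentiable (at z)"
  using pdir_compose_affine(1)[where A="\<lambda>z. z" and c="(0, -\<sigma>)" and g=g and v=d and z=z]
    pdir_compose_affine(2)[where A="\<lambda>z. z" and c="(0, -\<sigma>)" and g=g and z=z] assms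
  by (simp_all add: linear_iff plus_prod_def)

lemma Cp_snd_square: "Cp k (\<lambda>_ z. (snd z)\<^sup>2)"
  unfolding power2_eq_square by (intro Cp_mult Cp_linear bounded_linear_snd)

lemma pdir_snd_square: "pdir (\<lambda>z::'a::euclidean_space\<times>real. (snd z)\<^sup>2) d z = 2 * snd z * snd d"
  "(\<lambda>z::'a::euclidean_space\<times>real. (snd z)\<^sup>2) differentiable (at z)"
  using pdir_mult[OF pdir_snd(2) pdir_snd(2), of d z]
  by (auto simp: power2_eq_square pdir_snd)

lemma Cp_\<Phi>:
  assumes "Cp k v"
  shows "Cp k (\<lambda>q. \<Phi> (v (fst q)) (snd q))"
  unfolding \<Phi>_def[abs_def]
  by (intro Cp_diff Cp_mult Cp_add Cp_snd_square Cp_const Cp_delay[OF Cp_tprim] assms continuous_intros)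

lemma pdir_\<Phi>:
  fixes v :: "'p::topological_space \<Rightarrow> 'a::euclidean_space \<times> real \<Rightarrow> real"
  assumes v: "Cp (Suc k) v"
  shows "pdir (\<Phi> (v p) \<sigma>) d z = ((snd z)\<^sup>2 + \<sigma>\<^sup>2) * pdir (tprim (v p)) d (fst z, snd z - \<sigma>)
    + 2 * snd z * snd d * tprim (v p) (fst z, snd z - \<sigma>)
    - pdir (tprim (\<lambda>z. (snd z)\<^sup>2 * v p z)) d (fst z, snd z - \<sigma>)"
proof -
  have v2: "Cp (Suc k) (\<lambda>p z. (snd z)\<^sup>2 * v p z)" by (intro Cp_mult Cp_snd_square v)
  note dJ = Cp_differentiable[OF Cp_tprim[OF v]] Cp_differentiable[OF Cp_tprim[OF v2]]
  note dD = pdir_delay(2)[OF dJ(1), where \<sigma>=\<sigma>] pdir_delay(2)[OF dJ(2), where \<sigma>=\<sigma>]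
  have s: "pdir (\<lambda>z::'a \<times> real. (snd z)\<^sup>2 + \<sigma>\<^sup>2) d z = 2 * snd z * snd d" "(\<lambda>z::'a \<times> real. (snd z)\<^sup>2 + \<sigma>\<^sup>2) differentiable (at z)" for d z
    using pdir_add[OF pdir_snd_square(2), of "\<lambda>_. \<sigma>\<^sup>2" z d] pdirI[of "\<lambda>_. \<sigma>\<^sup>2" z d 0]
    by (auto simp: pdir_snd_square)
  have "pdir (\<Phi> (v p) \<sigma>) d z = pdir (\<lambda>z. ((snd z)\<^sup>2 + \<sigma>\<^sup>2) * tprim (v p) (fst z, snd z - \<sigma>)) d z
     - pdir (\<lambda>z. tprim (\<lambda>z. (snd z)\<^sup>2 * v p z) (fst z, snd z - \<sigma>)) d z"
    unfolding \<Phi>_def[abs_def] by (intro pdir_diff differentiable_mult s dD)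
  thus ?thesis
    by (simp add: pdir_mult[OF s(2) dD(1)] s pdir_delay(1)[OF dJ(1)] pdir_delay(1)[OF dJ(2)])
qed

lemma pdir_\<Phi>_space:
  assumes v: "Cp (Suc k) v"
  shows "pdir (\<Phi> (v p) \<sigma>) (b, 0) = \<Phi> (pdir (v p) (b, 0)) \<sigma>"
proof
  fix z
  have v2: "Cp (Suc k) (\<lambda>p z. (snd z)\<^sup>2 * v p z)" by (intro Cp_mult Cp_snd_square v)
  have "pdir (\<lambda>z. (snd z)\<^sup>2 * v p z) (b,0) = (\<lambda>z. (snd z)\<^sup>2 * pdir (v p) (b,0) z)"
    by (rule ext) (simp add: pdir_mult[OF pdir_snd_square(2) Cp_differentiable[OF v]] pdir_snd_square)
  thus "pdir (\<Phi> (v p) \<sigma>) (b, 0) z = \<Phi> (pdir (v p) (b, 0)) \<sigma> z"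
    by (simp add: pdir_\<Phi>[OF v] pdir_tprim_space[OF v] pdir_tprim_space[OF v2] \<Phi>_def)
qed

text \<open>At the moving end r = T - \<sigma> the kernel equals T^2 + \<sigma>^2 - (T - \<sigma>)^2
  = 2 T \<sigma>, which gives the boundary term; the T-derivative of the kernel itself is 2
  T.\<close>

lemma pdir_\<Phi>_time:
  assumes v: "Cp (Suc k) v"
  shows "pdir (\<Phi> (v p) \<sigma>) (0, 1) = (\<lambda>z. 2 * snd z * (tprim (v p) (fst z, snd z - \<sigma>) + \<sigma> * v p (fst z, snd z - \<sigma>)))"
proof
  fix z
  have v2: "Cp (Suc k) (\<lambda>p z. (snd z)\<^sup>2 * v p z)" by (intro Cp_mult Cp_snd_square v)
  show "pdir (\<Phi> (v p) \<sigma>) (0, 1) z = 2 * snd z * (tprim (v p) (fst z, snd z - \<sigma>) + \<sigma> * v p (fst z, snd z - \<sigma>))"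
    by (simp add: pdir_\<Phi>[OF v] pdir_tprim_time[OF v] pdir_tprim_time[OF v2], simp add: algebra_simps power2_eq_square)
qed

text \<open>Together with \<open>pdir_\<Phi>_time\<close> at T = \<sigma> this provides the data for
  Duhamel's principle: value 0 and T-derivative 2 \<sigma>^2 v(x, 0).\<close>

lemma \<Phi>_diagonal: "\<Phi> v \<sigma> (x, \<sigma>) = 0"
  by (simp add: \<Phi>_def tprim_zero)

text \<open>Under the kernel the Laplacian of \<open>v\<close> is replaced by v_rr and integrated by
  parts twice in r. At r = 0 nothing is left, since v_r and the r-derivative of the kernel both
  vanish there; at r = T - \<sigma> the boundary terms match those of the T-derivatives.\<close>

lemma \<Phi>_EPD:
  fixes v :: "'p::topological_space \<Rightarrow> 'a::euclidean_space \<times> real \<Rightarrow> real"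
  assumes v: "Cp (Suc (Suc k)) v"
    and eq: "\<And>z. dtt (v p) z = Lap (v p) z"
    and ic: "\<And>x. pdir (v p) (0,1) (x, 0) = 0"
    and T: "snd z \<noteq> 0"
  shows "dtt (\<Phi> (v p) \<sigma>) z = 2 / snd z * pdir (\<Phi> (v p) \<sigma>) (0,1) z
     + Lap (\<Phi> (v p) \<sigma>) z"
proof -
  obtain x T where z: "z = (x, T)" by (cases z)
  define R where "R = T - \<sigma>"
  note v1 = Cp_pdir[OF v] and v2 = Cp_pdir[OF Cp_pdir[OF v]]
  note dv = Cp_differentiable[OF v] and dJ = Cp_differentiable[OF Cp_tprim[OF v]]
  let ?r = "pdir (v p) (0,1)"
  have g: "(\<lambda>z. tprim (v p) (fst z, snd z - \<sigma>) + \<sigma> * v p (fst z, snd z - \<sigma>)) differentiable (at z)"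
    "pdir (\<lambda>z. tprim (v p) (fst z, snd z - \<sigma>) + \<sigma> * v p (fst z, snd z - \<sigma>)) (0,1) z = v p (x, R) + \<sigma> * ?r (x, R)"
  proof -
    have 1: "(\<lambda>z. \<sigma> * v p (fst z, snd z - \<sigma>)) differentiable (at z)"
      by (intro differentiable_mult differentiable_const pdir_delay(2)[OF dv])
    show "(\<lambda>z. tprim (v p) (fst z, snd z - \<sigma>) + \<sigma> * v p (fst z, snd z - \<sigma>)) differentiable (at z)"
      by (intro differentiable_add 1 pdir_delay(2)[OF dJ])
    show "pdir (\<lambda>z. tprim (v p) (fst z, snd z - \<sigma>) + \<sigma> * v p (fst z, snd z - \<sigma>)) (0,1) z = v p (x, R) + \<sigma> * ?r (x, R)"
      by (simp add: pdir_add[OF pdir_delay(2)[OF dJ] 1] pdir_cmult[OF pdir_delay(2)[OF dv]] pdir_delay(1)[OF dJ] pdir_delay(1)[OF dv] pdir_tprim_time[OF v], simp add: z R_def)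
  qed
  have two: "pdir (\<lambda>z::'a \<times> real. 2 * snd z) (0,1) z = 2" "(\<lambda>z::'a \<times> real. 2 * snd z) differentiable (at z)"
    using pdir_cmult[OF pdir_snd(2), of 2 "(0,1)" z] by (auto simp: pdir_snd intro!: differentiable_mult)
  have L: "dtt (\<Phi> (v p) \<sigma>) z = 2 * T * (v p (x, R) + \<sigma> * ?r (x, R)) + 2 * (tprim (v p) (x, R) + \<sigma> * v p (x, R))"
    unfolding pdir_\<Phi>_time[OF v] by (simp add: pdir_mult[OF two(2) g(1)] g(2) two, simp add: z R_def)
  have dr: "((\<lambda>r. v p (x, r)) has_real_derivative ?r (x, r)) (at r)" for r
    using Cp_line[OF v, of p "(x, 0)" "(0,1)" r] by simp
  have drr: "((\<lambda>r. ?r (x, r)) has_real_derivative pdir ?r (0,1) (x, r)) (at r)" for r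
    using Cp_line[OF v1, of p "(0,1)" "(x, 0)" "(0,1)" r] by simp
  have dJr: "((\<lambda>r. tprim (v p) (x, r)) has_real_derivative v p (x, r)) (at r)" for r
    using Cp_line[OF Cp_tprim[OF v], of p "(x, 0)" "(0,1)" r] by (simp add: pdir_tprim_time[OF v])
  \<comment> \<open>The integrations by parts, as explicit antiderivatives in r: \<open>J1\<close>
    for the part of the kernel that is constant in r, \<open>J2\<close> for r^2.\<close>
  have J1: "tprim (pdir ?r (0,1)) (x, R) = ?r (x, R)"
    using tprim_FTC[of "\<lambda>r. ?r (x, r)", OF drr] by (simp add: ic)
  have J2: "tprim (\<lambda>z. (snd z)\<^sup>2 * pdir ?r (0,1) z) (x, R) = R\<^sup>2 * ?r (x, R) - 2 * (R * v p (x, R)) + 2 * tprim (v p) (x, R)"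
  proof -
    have "((\<lambda>r. r\<^sup>2 * ?r (x, r) - 2 * (r * v p (x, r)) + 2 * tprim (v p) (x, r)) has_real_derivative
      (\<lambda>z. (snd z)\<^sup>2 * pdir ?r (0,1) z) (x, r)) (at r)" for r
      by (auto intro!: derivative_eq_intros dr drr dJr simp: algebra_simps)
    from tprim_FTC[OF this] show ?thesis by (simp add: tprim_zero)
  qed
  have "Lap (\<Phi> (v p) \<sigma>) z = (\<Sum>b\<in>Basis. \<Phi> (pdir (pdir (v p) (b,0)) (b,0)) \<sigma> z)"
    unfolding pdir_\<Phi>_space[OF v] pdir_\<Phi>_space[OF v1] ..
  also have "\<dots> = \<Phi> (\<lambda>z. \<Sum>b\<in>Basis. pdir (pdir (v p) (b,0)) (b,0) z) \<sigma> z"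
  proof -
    have s2: "Cp k (\<lambda>p z. (snd z)\<^sup>2 * pdir (pdir (v p) (b,0)) (b,0) z)" for b
      by (intro Cp_mult Cp_snd_square v2)
    show ?thesis
      unfolding \<Phi>_def sum_distrib_left[of "(snd _)\<^sup>2"]
      by (simp add: tprim_sum[OF finite_Basis v2] tprim_sum[OF finite_Basis s2] sum_subtractf sum_distrib_left)
  qed
  also have "(\<lambda>z. \<Sum>b\<in>Basis. pdir (pdir (v p) (b,0)) (b,0) z) = pdir ?r (0,1)" using eq by auto
  also have "\<Phi> (pdir ?r (0,1)) \<sigma> z = (T\<^sup>2 + \<sigma>\<^sup>2) * ?r (x, R) - (R\<^sup>2 * ?r (x, R) - 2 * (R * v p (x, R)) + 2 * tprim (v p) (x, R))"
    unfolding \<Phi>_def z by (simp add: J1 J2 flip: R_def)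
  finally have S: "Lap (\<Phi> (v p) \<sigma>) z = \<dots>" .
  have M: "2 / snd z * pdir (\<Phi> (v p) \<sigma>) (0,1) z = 4 * (tprim (v p) (x, R) + \<sigma> * v p (x, R))"
    using T unfolding pdir_\<Phi>_time[OF v] by (simp add: z R_def)
  show ?thesis unfolding L S M by (simp add: R_def algebra_simps power2_eq_square)
qed

text \<open>A primitive in the parameter y, taken from 0 and rescaled to [0, 1]: with fixed limits
  \<open>Y\<close> is an ordinary parameter ranging over the whole line, and
  \<open>Cp_integral\<close> applies.\<close>

definition pprim :: "(real \<Rightarrow> 'a::euclidean_space \<Rightarrow> real) \<Rightarrow> real \<Rightarrow> 'a \<Rightarrow> real" where
  "pprim \<Theta> Y z = Y * integral {0..1} (\<lambda>\<zeta>. \<Theta> (Y * \<zeta>) z)"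

lemma Cp_pprim_integrand:
  fixes \<Theta> :: "real \<Rightarrow> 'a::euclidean_space \<Rightarrow> real"
  shows "Cp k \<Theta> \<Longrightarrow> Cp k (\<lambda>q. \<Theta> (fst q * snd q))"
  by (erule Cp_reparam) (intro continuous_intros)

lemma Cp_pprim:
  assumes "Cp k \<Theta>" shows "Cp k (pprim \<Theta>)"
proof -
  have "Cp k (\<lambda>Y z. Y * integral {0..1} (\<lambda>\<zeta>. \<Theta> (fst (Y, \<zeta>) * snd (Y, \<zeta>)) z))"
    by (intro Cp_mult Cp_const continuous_on_id Cp_integral Cp_pprim_integrand assms)
  thus ?thesis by (simp add: pprim_def[abs_def])
qed

lemma pdir_pprim:
  assumes "Cp (Suc k) \<Theta>"
  shows "pdir (pprim \<Theta> Y) d = pprim (\<lambda>y. pdir (\<Theta> y) d) Y"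
proof
  fix z
  note C = Cp_pprim_integrand[OF assms]
  have "(\<lambda>z. integral {0..1} (\<lambda>\<zeta>. \<Theta> (Y * \<zeta>) z)) differentiable (at z)"
    using Cp_differentiable[OF Cp_integral[OF C], of 0 1 Y z] by simp
  from pdir_cmult[OF this, of Y d] show "pdir (pprim \<Theta> Y) d z = pprim (\<lambda>y. pdir (\<Theta> y) d) Y z"
    using Cp_pdir_integral[OF C, of 0 1 Y d] by (simp add: pprim_def[abs_def])
qed

lemma pprim_integral:
  fixes \<Theta> :: "real \<Rightarrow> 'a::euclidean_space \<Rightarrow> real"
  assumes \<Theta>: "Cp k \<Theta>" and Y: "0 \<le> Y"
  shows "pprim \<Theta> Y z = integral {0..Y} (\<lambda>y. \<Theta> y z)"
proof -
  have "((\<lambda>\<zeta>. Y *\<^sub>R \<Theta> (Y * \<zeta>) z) has_integral (integral {Y * 0..Y * 1} (\<lambda>y. \<Theta> y z))) {0..1}"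
  proof (rule has_integral_substitution)
    show "continuous_on {0..Y} (\<lambda>y. \<Theta> y z)"
      by (intro Cp_continuous_compose[OF \<Theta>] continuous_intros)
  qed (use Y in \<open>auto intro!: derivative_eq_intros mult_left_le\<close>)
  from integral_unique[OF this] show ?thesis by (simp add: pprim_def)
qed

lemma pprim_deriv:
  fixes \<Theta> :: "real \<Rightarrow> 'a::euclidean_space \<Rightarrow> real"
  assumes \<Theta>: "Cp k \<Theta>" and Y: "0 < Y"
  shows "((\<lambda>Y. pprim \<Theta> Y z) has_real_derivative \<Theta> Y z) (at Y)"
proof -
  have c: "continuous_on {0..Y+1} (\<lambda>y. \<Theta> y z)"
    by (intro Cp_continuous_compose[OF \<Theta>] continuous_intros)
  have "((\<lambda>Y. integral {0..Y} (\<lambda>y. \<Theta> y z)) has_real_derivative \<Theta> Y z) (at Y within {0..Y+1})"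
    by (rule integral_has_real_derivative[OF c]) (use Y in auto)
  hence "((\<lambda>Y. integral {0..Y} (\<lambda>y. \<Theta> y z)) has_real_derivative \<Theta> Y z) (at Y)"
    using Y by (subst (asm) at_within_interior) (auto simp: interior_atLeastAtMost_real)
  thus ?thesis
    by (rule has_field_derivative_transform_within_open[where S="{0<..}"]) (use Y pprim_integral[OF \<Theta>] in auto)
qed

text \<open>Leibniz' rule with a moving upper limit. Limit and point move together, so the
  derivative in the limit is combined with the continuous derivative along \<open>d\<close>.\<close>

lemma pprim_chain:
  fixes \<Theta> :: "real \<Rightarrow> 'a::euclidean_space \<times> real \<Rightarrow> real"
  assumes \<Theta>: "Cp (Suc k) \<Theta>" and Y: "0 < Y (snd z)" and dY: "(Y has_real_derivative Y') (at (snd z))"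
  shows "((\<lambda>s. pprim \<Theta> (Y (snd (z + s *\<^sub>R d))) (z + s *\<^sub>R d)) has_real_derivative
     snd d * Y' * \<Theta> (Y (snd z)) z + pprim (\<lambda>y. pdir (\<Theta> y) d) (Y (snd z)) z) (at 0)"
proof -
  let ?f = "\<lambda>y s. pprim \<Theta> y (z + s *\<^sub>R d)"
  let ?y = "Y (snd z)"
  have C: "Cp (Suc k) (pprim \<Theta>)" by (rule Cp_pprim[OF \<Theta>])
  have D: "((\<lambda>(y, s). ?f y s) has_derivative (\<lambda>(ty, ts). (\<Theta> ?y z) * ty + blinfun_apply ((\<lambda>y s. blinfun_scaleR_left (pdir (pprim \<Theta> y) d (z + s *\<^sub>R d))) ?y 0) ts))
     (at (?y, 0) within UNIV \<times> UNIV)"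
  proof (rule has_derivative_partialsI)
    show "((\<lambda>y. ?f y 0) has_derivative (*) (\<Theta> ?y z)) (at ?y within UNIV)"
      using pprim_deriv[OF \<Theta> Y, of z] by (simp add: has_field_derivative_def)
    show "((\<lambda>s. ?f y s) has_derivative blinfun_apply (blinfun_scaleR_left (pdir (pprim \<Theta> y) d (z + s *\<^sub>R d)))) (at s within UNIV)" for y s
      using Cp_line[OF C, of y z d s] by (simp add: has_field_derivative_def mult_commute_abs)
    have "continuous_on UNIV (\<lambda>p. blinfun_scaleR_left (pdir (pprim \<Theta> (fst p)) d (z + snd p *\<^sub>R d)))"
      by (intro continuous_intros Cp_continuous_compose[OF Cp_pdir[OF C]])
    thus "continuous (at (?y, 0) within UNIV \<times> UNIV) (\<lambda>(y, s). blinfun_scaleR_left (pdir (pprim \<Theta> y) d (z + s *\<^sub>R d)))"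
      by (simp add: case_prod_beta' continuous_on_eq_continuous_at)
  qed auto
  have Yd: "((\<lambda>s. Y (snd (z + s *\<^sub>R d))) has_real_derivative Y' * snd d) (at 0)"
    by (rule DERIV_chain2[of Y]) (use dY in \<open>auto intro!: derivative_eq_intros\<close>)
  have "((\<lambda>s. (Y (snd (z + s *\<^sub>R d)), s)) has_derivative (\<lambda>s. (Y' * snd d * s, s))) (at 0)"
    by (intro has_derivative_Pair has_derivative_ident Yd[unfolded has_field_derivative_def])
  moreover have "((\<lambda>(y, s). ?f y s) has_derivative (\<lambda>t. \<Theta> ?y z * fst t + snd t * pdir (pprim \<Theta> ?y) d z)) (at (Y (snd (z + 0 *\<^sub>R d)), 0))"
    using D by (simp add: case_prod_beta')
  ultimately have "((\<lambda>s. (\<lambda>(y, s). ?f y s) (Y (snd (z + s *\<^sub>R d)), s)) has_derivative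
     (\<lambda>s. \<Theta> ?y z * fst (Y' * snd d * s, s) + snd (Y' * snd d * s, s) * pdir (pprim \<Theta> ?y) d z)) (at 0)"
    by (rule has_derivative_compose)
  hence "((\<lambda>s. ?f (Y (snd (z + s *\<^sub>R d))) s) has_derivative (\<lambda>s. \<Theta> ?y z * (Y' * snd d * s) + s * pdir (pprim \<Theta> ?y) d z)) (at 0)"
    by simp
  hence "((\<lambda>s. ?f (Y (snd (z + s *\<^sub>R d))) s) has_real_derivative snd d * Y' * \<Theta> ?y z + pdir (pprim \<Theta> ?y) d z) (at 0)"
    unfolding has_field_derivative_def by (rule has_derivative_eq_rhs) (auto simp: algebra_simps)
  thus ?thesis by (simp add: pdir_pprim[OF \<Theta>])
qed

section \<open>Second order calculus on the half space\<close>

definition upper_half :: "('a::euclidean_space \<times> real) set" where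
  "upper_half = UNIV \<times> {0<..}"

lemma open_upper_half: "open upper_half"
  unfolding upper_half_def by (intro open_Times) auto

lemma in_upper_half_iff: "z \<in> upper_half \<longleftrightarrow> 0 < snd z"
  by (cases z) (simp add: upper_half_def)

text \<open>\<open>U1\<close> and \<open>U2\<close> list the partial derivatives of \<open>U\<close>; only their values at basis vectors matter.\<close>

definition C2_half :: "('a::euclidean_space \<times> real \<Rightarrow> real) \<Rightarrow> ('a \<times> real \<Rightarrow> 'a \<times> real \<Rightarrow> real)
    \<Rightarrow> ('a \<times> real \<Rightarrow> 'a \<times> real \<Rightarrow> 'a \<times> real \<Rightarrow> real) \<Rightarrow> bool" where
  "C2_half U U1 U2 \<longleftrightarrow> continuous_on upper_half U \<and>
     (\<forall>d\<in>Basis. continuous_on upper_half (U1 d) \<and>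
        (\<forall>z\<in>upper_half. has_pdir U d (U1 d z) z) \<and>
        (\<forall>d'\<in>Basis. continuous_on upper_half (U2 d d') \<and>
          (\<forall>z\<in>upper_half. has_pdir (U1 d) d' (U2 d d' z) z)))"

lemma C2_halfI:
  assumes "continuous_on upper_half U"
    and "\<And>d. d \<in> Basis \<Longrightarrow> continuous_on upper_half (U1 d)"
    and "\<And>d d'. d \<in> Basis \<Longrightarrow> d' \<in> Basis \<Longrightarrow> continuous_on upper_half (U2 d d')"
    and "\<And>d z. d \<in> Basis \<Longrightarrow> z \<in> upper_half \<Longrightarrow> has_pdir U d (U1 d z) z"
    and "\<And>d d' z. d \<in> Basis \<Longrightarrow> d' \<in> Basis \<Longrightarrow> z \<in> upper_half \<Longrightarrow>
      has_pdir (U1 d) d' (U2 d d' z) z"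
  shows "C2_half U U1 U2"
  using assms unfolding C2_half_def by blast

lemma C2_halfD:
  assumes "C2_half U U1 U2"
  shows "continuous_on upper_half U"
    and "d \<in> Basis \<Longrightarrow> continuous_on upper_half (U1 d)"
    and "d \<in> Basis \<Longrightarrow> d' \<in> Basis \<Longrightarrow> continuous_on upper_half (U2 d d')"
    and "d \<in> Basis \<Longrightarrow> z \<in> upper_half \<Longrightarrow> has_pdir U d (U1 d z) z"
    and "d \<in> Basis \<Longrightarrow> d' \<in> Basis \<Longrightarrow> z \<in> upper_half \<Longrightarrow>
      has_pdir (U1 d) d' (U2 d d' z) z"
  using assms unfolding C2_half_def by blast+

lemma half_space_line:
  fixes z d :: "'a::euclidean_space \<times> real"
  assumes "z \<in> upper_half" "has_pdir g d D z"
    and "\<And>y. y \<in> upper_half \<Longrightarrow> f y = g y"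
  shows "has_pdir f d D z"
proof (rule has_field_derivative_transform_within_open[OF assms(2)])
  show "open ((\<lambda>s. z + s *\<^sub>R d) -` upper_half)"
    by (intro open_vimage open_upper_half continuous_intros)
qed (use assms in auto)

lemma C2_half_cong:
  assumes "C2_half U U1 U2" "\<And>z. z \<in> upper_half \<Longrightarrow> V z = U z"
  shows "C2_half V U1 U2"
proof (rule C2_halfI)
  show "continuous_on upper_half V" using C2_halfD(1)[OF assms(1)] assms(2) by (simp cong: continuous_on_cong)
  show "has_pdir V d (U1 d z) z" if "d \<in> Basis" "z \<in> upper_half" for d z
    by (rule half_space_line[OF that(2) C2_halfD(4)[OF assms(1) that] assms(2)])
qed (use C2_halfD[OF assms(1)] in auto)

lemma C2_half_pdir:
  assumes U: "C2_half U U1 U2" and d: "d \<in> Basis" "d' \<in> Basis" and z: "z \<in> upper_half"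
  shows "pdir U d z = U1 d z" "pdir (pdir U d) d' z = U2 d d' z"
    "has_pdir (pdir U d) d' (U2 d d' z) z"
proof -
  have 1: "pdir U d z = U1 d z" if "z \<in> upper_half" for z
    by (intro pdirI C2_halfD(4)[OF U d(1) that])
  show "pdir U d z = U1 d z" by (rule 1[OF z])
  show 2: "has_pdir (pdir U d) d' (U2 d d' z) z"
    by (rule half_space_line[OF z C2_halfD(5)[OF U d z] 1])
  show "pdir (pdir U d) d' z = U2 d d' z" by (rule pdirI[OF 2])
qed

lemma C2_half_Ck_on:
  assumes U: "C2_half U U1 U2"
  shows "Ck_on 2 upper_half U"
  unfolding Ck_on_def
proof (intro allI impI)
  fix bs :: "('a \<times> real) list" assume bs: "set bs \<subseteq> Basis \<and> length bs \<le> 2"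
  note P = C2_half_pdir[OF U]
  have dif: "f differentiable (at 0)" if "(f has_real_derivative D) (at 0)" for f D
    using that by (auto simp: real_differentiable_def)
  consider "bs = []" | d where "bs = [d]" "d \<in> Basis" | d d' where "bs = [d', d]" "d \<in> Basis" "d' \<in> Basis"
    using bs by (cases bs; cases "tl bs") (auto simp: le_Suc_eq numeral_2_eq_2)
  thus "continuous_on upper_half (pdirs U bs) \<and> (length bs < 2 \<longrightarrow>
      (\<forall>b\<in>Basis. \<forall>x\<in>upper_half. (\<lambda>s. pdirs U bs (x + s *\<^sub>R b)) differentiable at 0))"
  proof cases
    case 1
    then show ?thesis using C2_halfD(1)[OF U] dif[OF C2_halfD(4)[OF U]] by simp
  next
    case 2
    have "continuous_on upper_half (pdir U d)"
      using C2_halfD(2)[OF U 2(2)] P(1)[OF 2(2,2)] by (simp cong: continuous_on_cong)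
    then show ?thesis using 2 dif[OF P(3)[OF 2(2)]] by simp
  next
    case 3
    have "continuous_on upper_half (pdir (pdir U d) d')"
      using C2_halfD(3)[OF U 3(2,3)] P(2)[OF 3(2,3)] by (simp cong: continuous_on_cong)
    then show ?thesis using 3 by simp
  qed
qed

lemma C2_half_add_cmult:
  assumes "C2_half U U1 U2" "C2_half V V1 V2"
  shows "C2_half (\<lambda>z. U z + c * V z) (\<lambda>d z. U1 d z + c * V1 d z) (\<lambda>d d' z. U2 d d' z + c * V2 d d' z)"
  by (intro C2_halfI continuous_on_add continuous_on_mult_left DERIV_add DERIV_cmult C2_halfD[OF assms(1)] C2_halfD[OF assms(2)])

lemma Cp_C2_half:
  assumes "Cp (Suc (Suc 0)) (\<lambda>_::real. U)"
  shows "C2_half U (pdir U) (\<lambda>d. pdir (pdir U d))"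
  by (rule C2_halfI)
    (use Cp_line[OF assms, where c=0] Cp_line[OF Cp_pdir[OF assms], where c=0]
    Cp_continuous_compose[OF assms continuous_on_const continuous_on_id]
    Cp_continuous_compose[OF Cp_pdir[OF assms] continuous_on_const continuous_on_id]
    Cp_continuous_compose[OF Cp_pdir[OF Cp_pdir[OF assms]] continuous_on_const continuous_on_id] in simp_all)

text \<open>The upper limit depends on T, but \<open>\<Psi>\<close> vanishes there, so first
  derivatives have no boundary term. Second derivatives have one, with a first derivative of
  \<open>\<Psi>\<close> in z; nothing is ever differentiated in the parameter y.\<close>

lemma C2_half_pprim:
  fixes \<Psi> :: "real \<Rightarrow> 'a::euclidean_space \<times> real \<Rightarrow> real"
  assumes \<Psi>: "Cp (Suc (Suc 0)) \<Psi>"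
    and Y: "\<And>T. 0 < T \<Longrightarrow> 0 < Y T" "\<And>T. 0 < T \<Longrightarrow> (Y has_real_derivative Y' T) (at T)"
    and Y': "continuous_on {0<..} Y'"
    and zero: "\<And>x T. 0 < T \<Longrightarrow> \<Psi> (Y T) (x, T) = 0"
  shows "C2_half (\<lambda>z. pprim \<Psi> (Y (snd z)) z) (\<lambda>d z. pprim (\<lambda>y. pdir (\<Psi> y) d) (Y (snd z)) z)
     (\<lambda>d d' z. snd d' * Y' (snd z) * pdir (\<Psi> (Y (snd z))) d z + pprim (\<lambda>y. pdir (pdir (\<Psi> y) d) d') (Y (snd z)) z)"
proof -
  have cY: "continuous_on upper_half (\<lambda>z::'a \<times> real. Y (snd z))"
  proof (rule continuous_on_compose2[where g=Y and t="{0<..}"])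
    show "continuous_on {0<..} Y" using Y(2) by (meson DERIV_isCont continuous_at_imp_continuous_on greaterThan_iff)
  qed (auto simp: in_upper_half_iff intro: continuous_intros)
  have cY': "continuous_on upper_half (\<lambda>z::'a \<times> real. Y' (snd z))"
    by (rule continuous_on_compose2[OF Y']) (auto simp: in_upper_half_iff intro: continuous_intros)
  have cK: "continuous_on upper_half (\<lambda>z. pprim \<Theta> (Y (snd z)) z)" if "Cp k \<Theta>" for k and \<Theta> :: "real \<Rightarrow> 'a \<times> real \<Rightarrow> real"
    by (rule Cp_continuous_compose[OF Cp_pprim[OF that] cY continuous_on_id])
  note \<Psi>1 = Cp_pdir[OF \<Psi>] and \<Psi>2 = Cp_pdir[OF Cp_pdir[OF \<Psi>]]
  have c\<Psi>: "continuous_on upper_half (\<lambda>z. pdir (\<Psi> (Y (snd z))) d z)" for d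
    by (rule Cp_continuous_compose[OF \<Psi>1 cY continuous_on_id])
  show ?thesis
  proof (rule C2_halfI)
    fix d d' z :: "'a \<times> real" assume z: "z \<in> upper_half"
    hence T: "0 < snd z" by (simp add: in_upper_half_iff)
    show "((\<lambda>s. pprim \<Psi> (Y (snd (z + s *\<^sub>R d))) (z + s *\<^sub>R d)) has_real_derivative pprim (\<lambda>y. pdir (\<Psi> y) d) (Y (snd z)) z) (at 0)"
      using pprim_chain[OF \<Psi> Y(1)[OF T] Y(2)[OF T], of d] zero[OF T, of "fst z"] by simp
    show "((\<lambda>s. pprim (\<lambda>y. pdir (\<Psi> y) d) (Y (snd (z + s *\<^sub>R d'))) (z + s *\<^sub>R d')) has_real_derivative
       snd d' * Y' (snd z) * pdir (\<Psi> (Y (snd z))) d z + pprim (\<lambda>y. pdir (pdir (\<Psi> y) d) d') (Y (snd z)) z) (at 0)"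
      by (rule pprim_chain[OF \<Psi>1 Y(1)[OF T] Y(2)[OF T]])
  qed (intro continuous_intros cK[OF \<Psi>] cK[OF \<Psi>1] cK[OF \<Psi>2] c\<Psi> cY')+
qed

section \<open>The time change T = 3 t^(1/3)\<close>

lemma DERIV_time_change:
  assumes "0 < t"
  shows "((\<lambda>t. 3 * t powr (1/3)) has_real_derivative t powr (-2/3)) (at t)"
  by (rule DERIV_cong, rule DERIV_cmult[OF has_real_derivative_powr[OF assms]]) simp

text \<open>The partial derivatives of \<open>\<psi> (x, t) = U (x, 3 t^(1/3)) / t\<close> in terms of those of \<open>U\<close>.\<close>

definition time_change1 :: "('a::euclidean_space \<times> real \<Rightarrow> real) \<Rightarrow> ('a \<times> real \<Rightarrow> 'a \<times> real \<Rightarrow> real) \<Rightarrow> 'a \<times> real \<Rightarrow> 'a \<times> real \<Rightarrow> real" where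
  "time_change1 U U1 d p = (let z = (fst p, 3 * snd p powr (1/3)); t = snd p in
     if d = (0, 1) then U1 (0, 1) z * t powr (-5/3) - U z / t\<^sup>2 else U1 d z / t)"

definition time_change2 :: "('a::euclidean_space \<times> real \<Rightarrow> real) \<Rightarrow> ('a \<times> real \<Rightarrow> 'a \<times> real \<Rightarrow> real)
    \<Rightarrow> ('a \<times> real \<Rightarrow> 'a \<times> real \<Rightarrow> 'a \<times> real \<Rightarrow> real) \<Rightarrow> 'a \<times> real \<Rightarrow> 'a \<times> real \<Rightarrow> 'a \<times> real \<Rightarrow> real" where
  "time_change2 U U1 U2 d d' p = (let z = (fst p, 3 * snd p powr (1/3)); t = snd p in
     if d = (0, 1) then
       if d' = (0, 1) then U2 (0, 1) (0, 1) z * t powr (-7/3) - 8/3 * U1 (0, 1) z * t powr (-8/3) + 2 * U z / t ^ 3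
       else U2 (0, 1) d' z * t powr (-5/3) - U1 d' z / t\<^sup>2
     else if d' = (0, 1) then U2 d (0, 1) z * t powr (-5/3) - U1 d z / t\<^sup>2
     else U2 d d' z / t)"

text \<open>The chain rule with dT/dt = t^(-2/3). The coefficient -8/3 is -5/3, from the power in
  the first derivative, minus 1, from differentiating \<open>U\<close> in -U / t^2.\<close>

lemma C2_half_time_change:
  assumes U: "C2_half U U1 U2"
  shows "C2_half (\<lambda>p. U (fst p, 3 * snd p powr (1/3)) / snd p) (time_change1 U U1) (time_change2 U U1 U2)"
proof -
  let ?H = "upper_half :: ('a \<times> real) set"
  let ?z = "\<lambda>p::'a \<times> real. (fst p, 3 * snd p powr (1/3))"
  have cz: "continuous_on ?H ?z" by (intro continuous_intros) (auto simp: in_upper_half_iff)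
  have cc: "continuous_on ?H (\<lambda>p. g (?z p))" if "continuous_on ?H g" for g :: "'a \<times> real \<Rightarrow> real"
    by (rule continuous_on_compose2[OF that cz]) (auto simp: in_upper_half_iff)
  note cU = C2_halfD(1)[OF U] and cU1 = C2_halfD(2)[OF U] and cU2 = C2_halfD(3)[OF U] and UU = C2_halfD(4)[OF U] and UU1 = C2_halfD(5)[OF U]
  have B1: "(0, 1) \<in> (Basis :: ('a \<times> real) set)" by (auto simp: Basis_prod_def)
  have tl: "((\<lambda>s. g (?z (p + s *\<^sub>R (0, 1)))) has_real_derivative g' (?z p) * snd p powr (-2/3)) (at 0)"
    if g: "\<And>z. z \<in> ?H \<Longrightarrow> ((\<lambda>s. g (z + s *\<^sub>R (0, 1))) has_real_derivative g' z) (at 0)" and p: "p \<in> ?H" for g g' p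
  proof -
    obtain x t where pt: "p = (x, t)" and t: "0 < t" using p by (cases p) (auto simp: in_upper_half_iff)
    have "((\<lambda>T. g ((x, 0) + T *\<^sub>R (0, 1))) has_real_derivative g' (x, 3 * t powr (1/3))) (at (3 * t powr (1/3)))"
      by (rule has_real_derivative_line_shift) (use g[of "(x, 3 * t powr (1/3))"] t in \<open>simp add: in_upper_half_iff\<close>)
    hence 1: "((\<lambda>T. g (x, T)) has_real_derivative g' (x, 3 * t powr (1/3))) (at (3 * t powr (1/3)))" by simp
    have "((\<lambda>s. t + s) has_real_derivative 1) (at 0)" by (auto intro!: derivative_eq_intros)
    from DERIV_chain2[OF _ this, of "\<lambda>t. 3 * t powr (1/3)"] DERIV_time_change[OF t]
    have "((\<lambda>s. 3 * (t + s) powr (1/3)) has_real_derivative t powr (-2/3)) (at 0)" by simp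
    from DERIV_chain2[OF _ this, of "\<lambda>T. g (x, T)"] 1 show ?thesis by (simp add: pt)
  qed
  have sl: "((\<lambda>s. g (?z (p + s *\<^sub>R (b, 0)))) has_real_derivative g' (?z p)) (at 0)"
    if g: "\<And>z. z \<in> ?H \<Longrightarrow> ((\<lambda>s. g (z + s *\<^sub>R (b, 0))) has_real_derivative g' z) (at 0)" and p: "p \<in> ?H" for g g' p b
    using g[of "?z p"] p by (auto simp: in_upper_half_iff)
  have tp: "((\<lambda>s. snd (p + s *\<^sub>R (0::'a, 1)) powr a) has_real_derivative a * snd p powr (a - 1)) (at 0)" if p: "p \<in> ?H" for p a
  proof -
    have "((\<lambda>s. (snd p + s)) has_real_derivative 1) (at 0)" by (auto intro!: derivative_eq_intros)
    from DERIV_chain2[OF _ this, of "\<lambda>t. t powr a"] has_real_derivative_powr[of "snd p" a] p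
    show ?thesis by (auto simp: in_upper_half_iff)
  qed
  \<comment> \<open>Quotients are rewritten as real powers, which is possible for positive time, so
    that one power rule differentiates all of them.\<close>
  have e1: "U (?z p) / snd p = U (?z p) * snd p powr (-1)" "U (?z p) / (snd p)\<^sup>2 = U (?z p) * snd p powr (-2)"
    "g / snd p = g * snd p powr (-1)" "g / (snd p)\<^sup>2 = g * snd p powr (-2)" "g / (snd p)^3 = g * snd p powr (-3)" if "p \<in> ?H" for p g
    using that by (simp_all add: in_upper_half_iff powr_neg_one powr_neg_numeral)
  have pw0: "x powr a * x powr b = x powr c" if "a + b = c" for x a b c :: real
    unfolding that[symmetric] powr_add ..
  have pw: "snd p powr (-2/3) * snd p powr (-1) = snd p powr (-5/3)" "snd p powr (-2/3) * snd p powr (-5/3) = snd p powr (-7/3)"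
    "snd p powr (-2/3) * snd p powr (-2) = snd p powr (-8/3)" for p :: "'a \<times> real"
    by (rule pw0, simp)+
  have ex: "(-1::real) - 1 = -2" "(-5/3::real) - 1 = -8/3" "(-2::real) - 1 = -3" by simp_all
  have p0: "p + 0 *\<^sub>R d = p" for p d :: "'a \<times> real" by simp
  show ?thesis
  proof (rule C2_halfI)
    show "continuous_on ?H (\<lambda>p. U (?z p) / snd p)"
      by (intro continuous_intros cc[OF cU]) (auto simp: in_upper_half_iff)
    fix d :: "'a \<times> real" assume d: "d \<in> Basis"
    show "continuous_on ?H (time_change1 U U1 d)"
      unfolding time_change1_def[abs_def] Let_def
      by (cases "d = (0,1)"; simp; intro continuous_intros cc[OF cU] cc[OF cU1[OF d]] cc[OF cU1[OF B1]]) (auto simp: in_upper_half_iff)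
    fix d' :: "'a \<times> real" assume d': "d' \<in> Basis"
    show "continuous_on ?H (time_change2 U U1 U2 d d')"
      unfolding time_change2_def[abs_def] Let_def
      by (cases "d = (0,1)"; cases "d' = (0,1)"; simp;
          intro continuous_intros cc[OF cU] cc[OF cU1[OF d]] cc[OF cU1[OF d']] cc[OF cU1[OF B1]]
           cc[OF cU2[OF d d']] cc[OF cU2[OF B1 d']] cc[OF cU2[OF d B1]] cc[OF cU2[OF B1 B1]]) (auto simp: in_upper_half_iff)
  next
    fix d p :: "'a \<times> real" assume d: "d \<in> Basis" and p: "p \<in> ?H"
    show "((\<lambda>s. U (?z (p + s *\<^sub>R d)) / snd (p + s *\<^sub>R d)) has_real_derivative time_change1 U U1 d p) (at 0)"
    proof (rule half_space_line[OF p _ e1(1)])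
      show "((\<lambda>s. U (?z (p + s *\<^sub>R d)) * snd (p + s *\<^sub>R d) powr (-1)) has_real_derivative time_change1 U U1 d p) (at 0)"
      proof (cases "d = (0,1)")
        case True
        show ?thesis unfolding True
          by (rule DERIV_cong, rule DERIV_mult[OF tl[of U "U1 (0,1)", OF UU[OF B1] p] tp[OF p]], assumption)
            (simp only: p0 time_change1_def time_change2_def Let_def simp_thms if_True if_False e1[OF p] ex mult.assoc pw, simp add: algebra_simps)
      next
        case False
        then obtain b where b: "d = (b, 0)" using d by (auto simp: Basis_prod_def)
        have "((\<lambda>s. U (?z (p + s *\<^sub>R (b,0)))) has_real_derivative U1 (b,0) (?z p)) (at 0)"
          by (rule sl[of U b "U1 (b,0)", OF UU p]) (use d b in auto)
        from DERIV_cmult_right[OF this, of "snd p powr (-1)"] show ?thesis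
          using b False by (simp add: time_change1_def Let_def e1[OF p])
      qed
    qed
    fix d' :: "'a \<times> real" assume d': "d' \<in> Basis"
    show "has_pdir (time_change1 U U1 d) d' (time_change2 U U1 U2 d d' p) p"
    proof (cases "d = (0,1)")
      case True
      have t1: "time_change1 U U1 d y = U1 (0,1) (?z y) * snd y powr (-5/3) - U (?z y) * snd y powr (-2)" if "y \<in> ?H" for y
        using that by (simp add: time_change1_def Let_def True e1)
      show ?thesis
      proof (rule half_space_line[OF p _ t1])
        show "((\<lambda>s. U1 (0,1) (?z (p + s *\<^sub>R d')) * snd (p + s *\<^sub>R d') powr (-5/3) - U (?z (p + s *\<^sub>R d')) * snd (p + s *\<^sub>R d') powr (-2))
           has_real_derivative time_change2 U U1 U2 d d' p) (at 0)"
        proof (cases "d' = (0,1)")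
          case d'1: True
          show ?thesis unfolding d'1
            by (rule DERIV_cong, rule DERIV_diff[OF DERIV_mult[OF tl[of "U1 (0,1)" "U2 (0,1) (0,1)", OF UU1[OF B1 B1] p] tp[OF p]]
                DERIV_mult[OF tl[of U "U1 (0,1)", OF UU[OF B1] p] tp[OF p]]], assumption, assumption)
            (simp only: True p0 time_change1_def time_change2_def Let_def simp_thms if_True if_False e1[OF p] ex mult.assoc pw, simp add: algebra_simps)
        next
          case False
          then obtain b where b: "d' = (b, 0)" using d' by (auto simp: Basis_prod_def)
          have 1: "((\<lambda>s. U (?z (p + s *\<^sub>R (b,0)))) has_real_derivative U1 (b,0) (?z p)) (at 0)"
            by (rule sl[of U b "U1 (b,0)", OF UU p]) (use d' b in auto)
          have 2: "((\<lambda>s. U1 (0,1) (?z (p + s *\<^sub>R (b,0)))) has_real_derivative U2 (0,1) (b,0) (?z p)) (at 0)"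
            by (rule sl[of "U1 (0,1)" b "U2 (0,1) (b,0)", OF UU1 p]) (use d' b B1 in auto)
          show ?thesis
            using DERIV_diff[OF DERIV_cmult_right[OF 2, of "snd p powr (-5/3)"] DERIV_cmult_right[OF 1, of "snd p powr (-2)"]] b False True
            by (simp add: time_change2_def Let_def e1[OF p])
        qed
      qed
    next
      case d1: False
      have t1: "time_change1 U U1 d y = U1 d (?z y) * snd y powr (-1)" if "y \<in> ?H" for y
        using that d1 by (simp add: time_change1_def Let_def e1)
      show ?thesis
      proof (rule half_space_line[OF p _ t1])
        show "((\<lambda>s. U1 d (?z (p + s *\<^sub>R d')) * snd (p + s *\<^sub>R d') powr (-1)) has_real_derivative time_change2 U U1 U2 d d' p) (at 0)"
        proof (cases "d' = (0,1)")
          case True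
          show ?thesis unfolding True
            by (rule DERIV_cong, rule DERIV_mult[OF tl[of "U1 d" "U2 d (0,1)", OF UU1[OF d B1] p] tp[OF p]], assumption)
            (simp only: d1 p0 time_change1_def time_change2_def Let_def simp_thms if_True if_False e1[OF p] ex mult.assoc pw, simp add: algebra_simps)
        next
          case False
          then obtain b where b: "d' = (b, 0)" using d' by (auto simp: Basis_prod_def)
          have 2: "((\<lambda>s. U1 d (?z (p + s *\<^sub>R (b,0)))) has_real_derivative U2 d (b,0) (?z p)) (at 0)"
            by (rule sl[of "U1 d" b "U2 d (b,0)", OF UU1 p]) (use d' b d in auto)
          show ?thesis using DERIV_cmult_right[OF 2, of "snd p powr (-1)"] b False d1
            by (simp add: time_change2_def Let_def e1[OF p])
        qed
      qed
    qed
  qed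
qed

section \<open>The representation formula in the time variable T\<close>

definition epd_sol :: "('a::euclidean_space \<times> real \<Rightarrow> real) \<Rightarrow> 'a \<times> real \<Rightarrow> real" where
  "epd_sol v z = v z - snd z * pdir v (0,1) z"

lemma Cp_epd_sol:
  assumes "Cp (Suc k) (\<lambda>_::real. v)" shows "Cp k (\<lambda>_::real. epd_sol v)"
  unfolding epd_sol_def[abs_def]
  by (intro Cp_diff Cp_mult Cp_linear bounded_linear_snd Cp_pdir[OF assms] Cp_mono_Suc[OF assms])

lemma pdir_epd_sol:
  assumes v: "Cp (Suc (Suc k)) (\<lambda>_::real. v)"
  shows "pdir (epd_sol v) d z = pdir v d z - snd d * pdir v (0,1) z - snd z * pdir (pdir v (0,1)) d z"
proof -
  note dv = Cp_const_differentiable[OF v] and dv1 = Cp_const_differentiable[OF Cp_pdir[OF v]]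
  have 1: "(\<lambda>z. snd z * pdir v (0,1) z) differentiable (at z)" by (intro differentiable_mult pdir_snd(2) dv1)
  show ?thesis unfolding epd_sol_def[abs_def]
    by (simp add: pdir_diff[OF dv 1] pdir_mult[OF pdir_snd(2) dv1] pdir_snd(1))
qed

lemma epd_sol_time:
  assumes v: "Cp (Suc (Suc k)) (\<lambda>_::real. v)"
  shows "pdir (epd_sol v) (0,1) = (\<lambda>z. - (snd z * dtt v z))"
  using pdir_epd_sol[OF v] by auto

text \<open>The T-derivative of v - T v_r is -T v_rr and the second one -v_rr - T v_rrr, while the
  Laplacian is v_rr - T v_rrr. The difference -2 v_rr is 2/T times the first derivative.\<close>

lemma epd_sol_EPD:
  fixes v :: "'a::euclidean_space \<times> real \<Rightarrow> real"
  assumes v: "Cp (Suc (Suc (Suc k))) (\<lambda>_::real. v)"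
    and eq: "\<And>z. dtt v z = Lap v z"
    and T: "snd z \<noteq> 0"
  shows "dtt (epd_sol v) z = 2 / snd z * pdir (epd_sol v) (0,1) z + Lap (epd_sol v) z"
proof -
  note v1 = Cp_pdir[OF v] and v2 = Cp_pdir[OF Cp_pdir[OF v]]
  note dv1 = Cp_const_differentiable[OF v1] and dv2 = Cp_const_differentiable[OF v2]
  let ?rr = "dtt v"
  have L: "dtt (epd_sol v) z = - ?rr z - snd z * pdir ?rr (0,1) z"
  proof -
    have "pdir (\<lambda>z. (-1) * (snd z * ?rr z)) (0,1) z = (-1) * pdir (\<lambda>z. snd z * ?rr z) (0,1) z"
      by (intro pdir_cmult differentiable_mult pdir_snd(2) dv2)
    thus ?thesis unfolding epd_sol_time[OF v] by (simp add: pdir_mult[OF pdir_snd(2) dv2] pdir_snd(1))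
  qed
  have S: "pdir (pdir (epd_sol v) (b,0)) (b,0) z = pdir (pdir v (b,0)) (b,0) z - snd z * pdir (pdir (pdir v (b,0)) (b,0)) (0,1) z" for b
  proof -
    have e: "pdir (epd_sol v) (b,0) = (\<lambda>z. pdir v (b,0) z - snd z * pdir (pdir v (0,1)) (b,0) z)"
      by (rule ext) (simp add: pdir_epd_sol[OF v])
    have 1: "(\<lambda>z. snd z * pdir (pdir v (0,1)) (b,0) z) differentiable (at z)" by (intro differentiable_mult pdir_snd(2) dv2)
    have "pdir (pdir v (0,1)) (b,0) = pdir (pdir v (b,0)) (0,1)" using Cp_Schwarz[OF v] by blast
    hence "pdir (pdir (pdir v (0,1)) (b,0)) (b,0) z = pdir (pdir (pdir v (b,0)) (b,0)) (0,1) z"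
      using Cp_Schwarz[OF v1, of "(b,0)" "(0,1)" "(b,0)" z] by simp
    thus ?thesis unfolding e by (simp add: pdir_diff[OF dv1 1] pdir_mult[OF pdir_snd(2) dv2] pdir_snd(1))
  qed
  have R: "(\<Sum>b\<in>Basis. pdir (pdir (pdir v (b,0)) (b,0)) (0,1) z) = pdir ?rr (0,1) z"
  proof -
    have "?rr = (\<lambda>z. \<Sum>b\<in>Basis. pdir (pdir v (b,0)) (b,0) z)" using eq by auto
    thus ?thesis
      using pdir_eq[OF has_derivative_sum[of Basis, OF differentiable_pdir[OF dv2]], of "\<lambda>b. (b,0)" "\<lambda>b. (b,0)"] by simp
  qed
  show ?thesis unfolding L S sum_subtractf sum_distrib_left[symmetric] R
    using T by (simp add: epd_sol_time[OF v] eq[symmetric])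
qed

text \<open>v_rrr is the Laplacian of v_r, and v_r vanishes on the whole initial plane. So v_rr(x,
  T) - v_rr(x, 0) is o(T), which the second initial condition needs.\<close>

lemma pdir_vrr_zero:
  fixes v :: "'a::euclidean_space \<times> real \<Rightarrow> real"
  assumes v: "Cp (Suc (Suc (Suc k))) (\<lambda>_::real. v)"
    and eq: "\<And>z. dtt v z = Lap v z"
    and ic: "\<And>x. pdir v (0,1) (x, 0) = 0"
  shows "dtt (pdir v (0,1)) (x, 0) = 0"
proof -
  note v1 = Cp_pdir[OF v] and v2 = Cp_pdir[OF Cp_pdir[OF v]]
  note dv2 = Cp_const_differentiable[OF v2]
  have z: "pdir (pdir (pdir v (b,0)) (b,0)) (0,1) (x, 0) = 0" for b
  proof -
    have "pdir (pdir v (0,1)) (b,0) = pdir (pdir v (b,0)) (0,1)" using Cp_Schwarz[OF v] by blast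
    hence "pdir (pdir (pdir v (b,0)) (b,0)) (0,1) (x, 0) = pdir (pdir (pdir v (0,1)) (b,0)) (b,0) (x, 0)"
      using Cp_Schwarz[OF v1, of "(b,0)" "(b,0)" "(0,1)" "(x, 0)"] by simp
    also have "\<dots> = pdir (\<lambda>y. pdir (\<lambda>y. pdir v (0,1) (y, 0)) b y) b x"
      using pdir_slice(2)[OF v1, of "(0,1)" 0 b] pdir_slice(2)[OF v2, of "(0,1)" "(b,0)" 0 b x] by simp
    also have "\<dots> = 0"
    proof -
      have "pdir (\<lambda>y::'a. 0) b = (\<lambda>_. 0)" by (rule ext, rule pdirI) simp
      thus ?thesis by (simp add: ic)
    qed
    finally show ?thesis .
  qed
  have "dtt v = (\<lambda>z. \<Sum>b\<in>Basis. pdir (pdir v (b,0)) (b,0) z)" using eq by auto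
  hence "dtt (pdir v (0,1)) (x, 0) = (\<Sum>b\<in>Basis. pdir (pdir (pdir v (b,0)) (b,0)) (0,1) (x, 0))"
    using pdir_eq[OF has_derivative_sum[of Basis, OF differentiable_pdir[OF dv2]], of "\<lambda>b. (b,0)" "\<lambda>b. (b,0)"] by simp
  thus ?thesis by (simp add: z)
qed

lemma Cp_tendsto:
  fixes F :: "real \<Rightarrow> 'a::euclidean_space \<Rightarrow> real"
  assumes "Cp k F" "(P \<longlongrightarrow> p) fl" "(X \<longlongrightarrow> x) fl"
  shows "((\<lambda>t. F (P t) (X t)) \<longlongrightarrow> F p x) fl"
proof -
  have "isCont (\<lambda>(p, x). F p x) (p, x)"
    using Cp_continuous[OF assms(1)] by (simp add: continuous_on_eq_continuous_at)
  from isCont_tendsto_compose[OF this tendsto_Pair[OF assms(2,3)]] show ?thesis by simp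
qed

lemma powr_tendsto_0_right:
  assumes "0 < a"
  shows "((\<lambda>t::real. t powr a) \<longlongrightarrow> 0) (at_right 0)"
proof -
  have "((\<lambda>t::real. t powr a) \<longlongrightarrow> 0 powr a) (at_right 0)"
    by (intro tendsto_powr' tendsto_ident_at tendsto_const) (use assms in \<open>auto simp: eventually_at_right_less eventually_at_filter\<close>)
  thus ?thesis by simp
qed

lemma continuous_on_abs_powr: "0 < a \<Longrightarrow> continuous_on S (\<lambda>y::real. \<bar>y\<bar> powr a)"
  by (intro continuous_on_powr' continuous_intros) auto

text \<open>The substitution r = T s, \<sigma> = T \<beta>: one factor T comes from dr and two from
  the kernel, and the upper limit 1 - \<beta> becomes T - \<sigma>.\<close>

lemma rescaled_inner_integral:
  fixes g :: "'a::euclidean_space \<times> real \<Rightarrow> real"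
  assumes b: "0 \<le> \<beta>" "\<beta> \<le> 1" and g: "\<And>S. continuous_on S (\<lambda>r. g (x, r))"
  shows "T ^ 3 * integral {0..1 - \<beta>} (\<lambda>s. g (x, T * s) * (1 + \<beta>\<^sup>2 - s\<^sup>2)) = \<Phi> g (T * \<beta>) (x, T)"
proof -
  let ?h = "\<lambda>s. g (x, T * s) * (1 + \<beta>\<^sup>2 - s\<^sup>2)"
  have gc: "continuous_on S (\<lambda>s. g (x, c * s))" for S c
    by (rule continuous_on_compose2[OF g[of UNIV]]) (auto intro: continuous_intros)
  have "((\<lambda>s. (1 - \<beta>) *\<^sub>R ?h ((1 - \<beta>) * s)) has_integral (integral {(1 - \<beta>) * 0..(1 - \<beta>) * 1} ?h)) {0..1}"
  proof (rule has_integral_substitution)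
    show "continuous_on {0..1 - \<beta>} ?h" by (intro continuous_intros gc)
  qed (use b in \<open>auto intro!: derivative_eq_intros mult_left_le\<close>)
  from integral_unique[OF this]
  have 1: "integral {0..1 - \<beta>} ?h = (1 - \<beta>) * integral {0..1} (\<lambda>s. ?h ((1 - \<beta>) * s))" by simp
  let ?g = "\<lambda>s. g (x, s * (T - T * \<beta>))"
  have gc': "continuous_on S ?g" for S
    using gc[of S "T - T * \<beta>"] by (simp add: mult.commute)
  have "T ^ 3 * integral {0..1 - \<beta>} ?h = (T - T * \<beta>) * integral {0..1} (\<lambda>s. T\<^sup>2 * ?h ((1 - \<beta>) * s))"
  proof -
    have "T ^ 3 * ((1 - \<beta>) * I) = (T - T * \<beta>) * (T\<^sup>2 * I)" for I
      by (simp add: power3_eq_cube power2_eq_square algebra_simps)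
    thus ?thesis unfolding 1 integral_mult_right .
  qed
  also have "(\<lambda>s. T\<^sup>2 * ?h ((1 - \<beta>) * s)) = (\<lambda>s. (T\<^sup>2 + (T * \<beta>)\<^sup>2) * ?g s - (s * (T - T * \<beta>))\<^sup>2 * ?g s)"
  proof
    fix s
    have "T * ((1 - \<beta>) * s) = s * (T - T * \<beta>)" by (simp add: algebra_simps)
    thus "T\<^sup>2 * ?h ((1 - \<beta>) * s) = (T\<^sup>2 + (T * \<beta>)\<^sup>2) * ?g s - (s * (T - T * \<beta>))\<^sup>2 * ?g s"
      by (simp add: power2_eq_square algebra_simps)
  qed
  also have "integral {0..1} (\<lambda>s. (T\<^sup>2 + (T * \<beta>)\<^sup>2) * ?g s - (s * (T - T * \<beta>))\<^sup>2 * ?g s)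
     = (T\<^sup>2 + (T * \<beta>)\<^sup>2) * integral {0..1} ?g - integral {0..1} (\<lambda>s. (s * (T - T * \<beta>))\<^sup>2 * ?g s)"
    by (subst integral_diff) (auto intro!: integrable_continuous_real continuous_intros gc')
  finally show ?thesis by (simp add: \<Phi>_def tprim_def algebra_simps)
qed

text \<open>\<open>G \<tau>\<close> solves the wave equation with data \<open>\<tau>^(2 - e) f(\<cdot>, \<tau>)\<close>, which extend continuously by \<open>0\<close> to \<open>\<tau> = 0\<close>.
  The substitution \<open>y = \<tau>^e\<close> turns the singular weight \<open>\<tau>^(e - 1) d\<tau>\<close> into a multiple of \<open>dy\<close>.\<close>

locale wave_data =
  fixes v0 v1 :: "'a::euclidean_space \<times> real \<Rightarrow> real" and G :: "real \<Rightarrow> 'a \<times> real \<Rightarrow> real"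
    and f :: "'a \<times> real \<Rightarrow> real" and e :: real
  assumes v0: "Cp (Suc (Suc (Suc 0))) (\<lambda>_::real. v0)"
    and v0_eq: "\<And>z. dtt v0 z = Lap v0 z"
    and v0_ic: "\<And>x. pdir v0 (0,1) (x, 0) = 0"
    and v1: "Cp (Suc (Suc 0)) (\<lambda>_::real. v1)"
    and v1_eq: "\<And>z. dtt v1 z = Lap v1 z"
    and v1_ic: "\<And>x. pdir v1 (0,1) (x, 0) = 0"
    and G: "Cp (Suc (Suc 0)) G"
    and G_eq: "\<And>\<tau> z. dtt (G \<tau>) z = Lap (G \<tau>) z"
    and G_ic: "\<And>\<tau> x. pdir (G \<tau>) (0,1) (x, 0) = 0"
    and G_f: "\<And>t x. 0 < t \<Longrightarrow> G t (x, 0) = t powr (2 - e) * f (x, t)"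
    and e: "0 < e"
begin

text \<open>\<open>s1\<close> and \<open>s2\<close> express \<tau> and \<sigma> = 3 \<tau>^(1/3)
  through y = \<tau>^e. The absolute value keeps them continuous on the whole line, over which y
  ranges as a parameter of \<open>Cp\<close>.\<close>

definition s1 :: "real \<Rightarrow> real" where "s1 y = \<bar>y\<bar> powr (1 / e)"
definition s2 :: "real \<Rightarrow> real" where "s2 y = 3 * \<bar>y\<bar> powr (1 / (3 * e))"
definition \<Psi> :: "real \<Rightarrow> 'a \<times> real \<Rightarrow> real" where "\<Psi> y = \<Phi> (G (s1 y)) (s2 y)"
text \<open>The value of y at \<tau> = t, since t = T^3 / 27.\<close>

definition Y :: "real \<Rightarrow> real" where "Y T = (T ^ 3 / 27) powr e"
definition Y' :: "real \<Rightarrow> real" where "Y' T = e * (T ^ 3 / 27) powr (e - 1) * (T\<^sup>2 / 9)"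
text \<open>The factor 1/18 is 3/2 t divided by T^3 = 27 t, where T^3 is the factor in
  \<open>rescaled_inner_integral\<close>.\<close>

definition uR :: "'a \<times> real \<Rightarrow> real" where "uR z = epd_sol v0 z + 1/18 * \<Phi> v1 0 z"
text \<open>Duhamel's weight \<tau> d\<tau> / 18, multiplied by the factor \<tau>^(e - 2) that
  undoes the regularisation of the data, is \<tau>^(e - 1) d\<tau> / 18 = dy / (18 e).\<close>

definition U :: "'a \<times> real \<Rightarrow> real" where "U z = uR z + 1 / (18 * e) * pprim \<Psi> (Y (snd z)) z"
definition U1 :: "'a \<times> real \<Rightarrow> 'a \<times> real \<Rightarrow> real" where
  "U1 d z = pdir uR d z + 1 / (18 * e) * pprim (\<lambda>y. pdir (\<Psi> y) d) (Y (snd z)) z"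
definition U2 :: "'a \<times> real \<Rightarrow> 'a \<times> real \<Rightarrow> 'a \<times> real \<Rightarrow> real" where
  "U2 d d' z = pdir (pdir uR d) d' z + 1 / (18 * e) *
     (snd d' * Y' (snd z) * pdir (\<Psi> (Y (snd z))) d z + pprim (\<lambda>y. pdir (pdir (\<Psi> y) d) d') (Y (snd z)) z)"

lemma continuous_s1 [continuous_intros]: "continuous_on S s1"
  and continuous_s2 [continuous_intros]: "continuous_on S s2"
  unfolding s1_def[abs_def] s2_def[abs_def] using e by (auto intro!: continuous_intros continuous_on_abs_powr)

lemma C\<Psi>: "Cp (Suc (Suc 0)) \<Psi>"
proof -
  have "Cp (Suc (Suc 0)) (\<lambda>y. (\<lambda>q. \<Phi> (G (fst q)) (snd q)) ((\<lambda>y. (s1 y, s2 y)) y))"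
    by (rule Cp_reparam[OF Cp_\<Phi>[OF G]]) (intro continuous_intros)
  thus ?thesis by (simp only: \<Psi>_def[abs_def] fst_conv snd_conv)
qed

lemma C\<Phi>1: "Cp (Suc (Suc 0)) (\<lambda>_::real. \<Phi> v1 0)"
proof -
  have "Cp (Suc (Suc 0)) (\<lambda>y::real. (\<lambda>q. \<Phi> v1 (snd q)) ((\<lambda>y. (y, 0)) y))"
    by (rule Cp_reparam[OF Cp_\<Phi>[OF v1]]) (intro continuous_intros)
  thus ?thesis by simp
qed

lemma CuR: "Cp (Suc (Suc 0)) (\<lambda>_::real. uR)"
  unfolding uR_def[abs_def] by (intro Cp_add Cp_cmult Cp_epd_sol[OF v0] C\<Phi>1)

lemma s1_Y: "0 < T \<Longrightarrow> s1 (Y T) = T ^ 3 / 27"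
  using e by (simp add: s1_def Y_def powr_powr)

lemma s2_Y: assumes "0 < T" shows "s2 (Y T) = T"
proof -
  have cube: "T ^ 3 / 27 = (T / 3) powr 3" using assms by (simp add: powr_numeral power_divide)
  have "(T ^ 3 / 27) powr (1 / 3) = T / 3" unfolding cube using assms by (subst powr_powr) simp
  thus ?thesis using e by (simp add: s2_def Y_def powr_powr)
qed

lemma Y_pos: "0 < T \<Longrightarrow> 0 < Y T"
  by (simp add: Y_def)

lemma DERIV_Y: "0 < T \<Longrightarrow> (Y has_real_derivative Y' T) (at T)"
  unfolding Y_def[abs_def] Y'_def
  by (auto intro!: derivative_eq_intros simp: power2_eq_square)

lemma C2_U: "C2_half U U1 U2"
proof -
  have "continuous_on {0<..} Y'"
    unfolding Y'_def[abs_def] by (intro continuous_intros) auto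
  moreover have "\<Psi> (Y T) (x, T) = 0" if "0 < T" for x T
    using that by (simp add: \<Psi>_def s2_Y \<Phi>_diagonal)
  ultimately have "C2_half (\<lambda>z. pprim \<Psi> (Y (snd z)) z) (\<lambda>d z. pprim (\<lambda>y. pdir (\<Psi> y) d) (Y (snd z)) z)
     (\<lambda>d d' z. snd d' * Y' (snd z) * pdir (\<Psi> (Y (snd z))) d z + pprim (\<lambda>y. pdir (pdir (\<Psi> y) d) d') (Y (snd z)) z)"
    by (intro C2_half_pprim C\<Psi> Y_pos DERIV_Y)
  from C2_half_add_cmult[OF Cp_C2_half[OF CuR] this, of "1 / (18 * e)"]
  show ?thesis by (simp only: U_def[abs_def] U1_def[abs_def] U2_def[abs_def])
qed

lemma pdir_uR: "pdir uR d z = pdir (epd_sol v0) d z + 1/18 * pdir (\<Phi> v1 0) d z"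
  "pdir (pdir uR d) d' z = pdir (pdir (epd_sol v0) d) d' z + 1/18 * pdir (pdir (\<Phi> v1 0) d) d' z"
proof -
  note C0 = Cp_epd_sol[OF v0] and C1 = C\<Phi>1
  have 1: "pdir (\<lambda>z. g z + 1/18 * h z) d = (\<lambda>z. pdir g d z + 1/18 * pdir h d z)"
    if "Cp (Suc k) (\<lambda>_::real. g)" "Cp (Suc k) (\<lambda>_::real. h)" for g h k and d :: "'a \<times> real"
    by (rule ext, rule pdir_eq, intro has_derivative_add has_derivative_mult_right Cp_has_derivative[OF that(1)] Cp_has_derivative[OF that(2)])
  have d1: "pdir uR d = (\<lambda>z. pdir (epd_sol v0) d z + 1/18 * pdir (\<Phi> v1 0) d z)" for d
    unfolding uR_def[abs_def] by (rule 1[OF C0 C1])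
  show "pdir uR d z = pdir (epd_sol v0) d z + 1/18 * pdir (\<Phi> v1 0) d z" by (simp add: d1)
  show "pdir (pdir uR d) d' z = pdir (pdir (epd_sol v0) d) d' z + 1/18 * pdir (pdir (\<Phi> v1 0) d) d' z"
    unfolding d1 1[OF Cp_pdir[OF C0] Cp_pdir[OF C1]] ..
qed

lemma \<Psi>_time: "pdir (\<Psi> y) (0,1) = (\<lambda>z. 2 * snd z * (tprim (G (s1 y)) (fst z, snd z - s2 y) + s2 y * G (s1 y) (fst z, snd z - s2 y)))"
  unfolding \<Psi>_def by (rule pdir_\<Phi>_time[OF G])

text \<open>Each \<open>\<Psi> y\<close> solves the homogeneous equation, so the integral over y
  contributes only the boundary term at \<sigma> = T. The factor in front of f is t^(4/3) times
  t.\<close>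

lemma U_EPD:
  assumes T: "0 < T"
  shows "U2 (0,1) (0,1) (x, T) = 2 / T * U1 (0,1) (x, T) + (\<Sum>b\<in>Basis. U2 (b,0) (b,0) (x, T))
     + T ^ 4 / 81 * (T ^ 3 / 27) * f (x, T ^ 3 / 27)"
proof -
  let ?z = "(x, T)"
  let ?t = "T ^ 3 / 27"
  have u: "dtt uR ?z = 2 / T * pdir uR (0,1) ?z + Lap uR ?z"
    using epd_sol_EPD[OF v0 v0_eq, of ?z] \<Phi>_EPD[where v="\<lambda>_::real. v1", OF v1 v1_eq v1_ic, of ?z 0] T
    by (simp add: pdir_uR sum.distrib sum_distrib_left[symmetric] distrib_left sum_divide_distrib[symmetric])
  have \<Psi>: "dtt (\<Psi> y) ?z = 2 / T * pdir (\<Psi> y) (0,1) ?z + Lap (\<Psi> y) ?z" for y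
    unfolding \<Psi>_def using \<Phi>_EPD[OF G G_eq G_ic, of ?z] T by simp
  have c1: "(\<lambda>\<zeta>. pdir (\<Psi> (y * \<zeta>)) d ?z) integrable_on {0..1}" for y d
    by (intro integrable_continuous_real Cp_continuous_compose[OF Cp_pdir[OF C\<Psi>]] continuous_intros)
  have c2: "(\<lambda>\<zeta>. pdir (pdir (\<Psi> (y * \<zeta>)) d) d' ?z) integrable_on {0..1}" for y d d'
    by (intro integrable_continuous_real Cp_continuous_compose[OF Cp_pdir[OF Cp_pdir[OF C\<Psi>]]] continuous_intros)
  have Kl: "pprim (\<lambda>y. dtt (\<Psi> y)) y ?z = 2 / T * pprim (\<lambda>y. pdir (\<Psi> y) (0,1)) y ?z
      + (\<Sum>b\<in>Basis. pprim (\<lambda>y. pdir (pdir (\<Psi> y) (b,0)) (b,0)) y ?z)" for y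
  proof -
    have "integral {0..1} (\<lambda>\<zeta>. dtt (\<Psi> (y * \<zeta>)) ?z)
       = integral {0..1} (\<lambda>\<zeta>. 2 / T * pdir (\<Psi> (y * \<zeta>)) (0,1) ?z) + integral {0..1} (\<lambda>\<zeta>. \<Sum>b\<in>Basis. pdir (pdir (\<Psi> (y * \<zeta>)) (b,0)) (b,0) ?z)"
      unfolding \<Psi> by (intro integral_add integrable_sum c2 integrable_on_mult_right c1) auto
    also have "\<dots> = 2 / T * integral {0..1} (\<lambda>\<zeta>. pdir (\<Psi> (y * \<zeta>)) (0,1) ?z) + (\<Sum>b\<in>Basis. integral {0..1} (\<lambda>\<zeta>. pdir (pdir (\<Psi> (y * \<zeta>)) (b,0)) (b,0) ?z))"
      by (subst integral_sum) (auto intro: c2)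
    finally show ?thesis by (simp add: pprim_def distrib_left sum_distrib_left)
  qed
  \<comment> \<open>At \<sigma> = T the derivative of \<open>\<Psi>\<close> is 2 T^2 t^(2 - e) f,
    and \<open>Y'\<close> is e t^(e - 1) T^2 / 9; the two powers of t multiply to t.\<close>
  have src: "1 / (18 * e) * (Y' T * pdir (\<Psi> (Y T)) (0,1) ?z) = T ^ 4 / 81 * ?t * f (x, ?t)"
  proof -
    have t: "0 < ?t" using T by simp
    have "?t powr (e - 1) * ?t powr (2 - e) = ?t" using t by (simp flip: powr_add)
    hence "1 / (18 * e) * (Y' T * (2 * T * (T * (?t powr (2 - e) * f (x, ?t))))) = T ^ 4 / 81 * ?t * f (x, ?t)"
      using e by (simp add: Y'_def field_simps power2_eq_square power4_eq_xxxx)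
    thus ?thesis by (simp add: \<Psi>_time s2_Y[OF T] s1_Y[OF T] tprim_zero G_f[OF t])
  qed
  show ?thesis
    unfolding U1_def U2_def u
    by (simp only: snd_conv Kl sum.distrib sum_distrib_left[symmetric] mult_1 mult_zero_left add_0 distrib_left src[symmetric])
       (simp add: algebra_simps)
qed

lemma tendsto_U: "((\<lambda>t. U (x, 3 * t powr (1/3))) \<longlongrightarrow> v0 (x, 0)) (at_right 0)"
proof -
  have T: "((\<lambda>t::real. 3 * t powr (1/3)) \<longlongrightarrow> 0) (at_right 0)"
    using tendsto_mult_right_zero[OF powr_tendsto_0_right[of "1/3"], of 3] by simp
  have z: "((\<lambda>t::real. (x, 3 * t powr (1/3))) \<longlongrightarrow> (x, 0)) (at_right 0)"
    by (intro tendsto_Pair tendsto_const T)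
  have "((\<lambda>t. ((3 * t powr (1/3)) ^ 3 / 27) powr e) \<longlongrightarrow> 0 powr e) (at_right 0)"
  proof (intro tendsto_powr' tendsto_const disjI2 conjI)
    show "((\<lambda>t::real. (3 * t powr (1/3)) ^ 3 / 27) \<longlongrightarrow> 0) (at_right 0)"
      using tendsto_divide[OF tendsto_power[OF T, of 3] tendsto_const[of 27]] by simp
  qed (use e in auto)
  hence Y: "((\<lambda>t. Y (3 * t powr (1/3))) \<longlongrightarrow> 0) (at_right 0)" by (simp add: Y_def)
  have "((\<lambda>t. uR (x, 3 * t powr (1/3)) + 1 / (18 * e) * pprim \<Psi> (Y (3 * t powr (1/3))) (x, 3 * t powr (1/3)))
     \<longlongrightarrow> uR (x, 0) + 1 / (18 * e) * pprim \<Psi> 0 (x, 0)) (at_right 0)"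
    by (intro tendsto_add tendsto_mult tendsto_const Cp_tendsto[OF CuR tendsto_const z] Cp_tendsto[OF Cp_pprim[OF C\<Psi>] Y z])
  thus ?thesis by (simp add: U_def uR_def epd_sol_def \<Phi>_diagonal pprim_def)
qed

lemma quotient_right_limit:
  assumes "(g has_real_derivative D) (at 0)"
  shows "((\<lambda>T. (g T - g 0) / T) \<longlongrightarrow> D) (at_right 0)"
  using Lim_at_imp_Lim_at_within[OF assms[unfolded DERIV_def], of "{0<..}"] by simp

text \<open>In \<open>\<Psi>_time\<close> the primitive is at most (T - \<sigma>) M and the boundary
  term at most \<sigma> M, together T M. As \<open>Y T\<close> tends to 0, the source contributes
  o(T^2) to the T-derivative of \<open>U\<close>, which is what division by T^2 requires. T \<le> 1
  keeps \<tau> and r in the unit interval, where M bounds \<open>G\<close>.\<close>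

lemma pprim_\<Psi>_bound:
  obtains M where "\<And>T. 0 < T \<Longrightarrow> T \<le> 1 \<Longrightarrow> \<bar>pprim (\<lambda>y. pdir (\<Psi> y) (0,1)) (Y T) (x, T)\<bar> \<le> Y T * (2 * T\<^sup>2 * M)"
proof -
  have "continuous_on ({0..1} \<times> {0..1}) (\<lambda>q. G (fst q) (x, snd q))"
    by (intro Cp_continuous_compose[OF G] continuous_intros)
  hence "compact ((\<lambda>q. G (fst q) (x, snd q)) ` ({0..1} \<times> {0..1}))"
    by (rule compact_continuous_image) (intro compact_Times compact_Icc)
  from compact_imp_bounded[OF this]
  obtain M where M: "\<And>\<tau> r. \<tau> \<in> {0..1} \<Longrightarrow> r \<in> {0..1} \<Longrightarrow> \<bar>G \<tau> (x, r)\<bar> \<le> M"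
    unfolding bounded_iff by (auto simp del: atLeastAtMost_iff)
  show thesis
  proof (rule that[of M])
    fix T :: real assume T: "0 < T" "T \<le> 1"
    have Y1: "Y T \<le> 1" unfolding Y_def using T e power_le_one[of T 3] by (intro powr_le1) auto
    have b: "\<bar>pdir (\<Psi> (Y T * \<zeta>)) (0,1) (x, T)\<bar> \<le> 2 * T\<^sup>2 * M" if \<zeta>: "\<zeta> \<in> {0..1}" for \<zeta>
    proof -
      define y where "y = Y T * \<zeta>"
      have y: "0 \<le> y" "y \<le> Y T" using \<zeta> Y_pos[OF T(1)] by (auto simp: y_def mult_left_le)
      have \<tau>: "s1 y \<in> {0..1}" using y Y1 e by (auto simp: s1_def intro: powr_le1)
      have \<sigma>: "0 \<le> s2 y" "s2 y \<le> T"
      proof -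
        show "0 \<le> s2 y" by (simp add: s2_def)
        have "s2 y \<le> s2 (Y T)" using y e by (auto simp: s2_def intro: powr_mono2)
        thus "s2 y \<le> T" by (simp add: s2_Y[OF T(1)])
      qed
      define R where "R = T - s2 y"
      have R: "0 \<le> R" "R \<le> 1" using \<sigma> T by (auto simp: R_def)
      have "\<bar>integral {0..1} (\<lambda>s. G (s1 y) (x, s * R))\<bar> \<le> M * (1 - 0)"
        unfolding real_norm_def[symmetric]
      proof (rule integral_bound)
        show "continuous_on {0..1} (\<lambda>s. G (s1 y) (x, s * R))"
          by (intro Cp_continuous_compose[OF G] continuous_intros)
        show "norm (G (s1 y) (x, s * R)) \<le> M" if "s \<in> {0..1}" for s
          using M[OF \<tau>, of "s * R"] that R by (auto simp: mult_le_one)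
      qed simp
      hence JM: "\<bar>tprim (G (s1 y)) (x, R)\<bar> \<le> R * M" using R by (simp add: tprim_def abs_mult mult_left_mono)
      have GM: "\<bar>s2 y * G (s1 y) (x, R)\<bar> \<le> s2 y * M" using M[OF \<tau>, of R] R \<sigma> by (simp add: abs_mult mult_left_mono)
      have "\<bar>tprim (G (s1 y)) (x, R) + s2 y * G (s1 y) (x, R)\<bar> \<le> R * M + s2 y * M" using JM GM by linarith
      also have "\<dots> = T * M" by (simp add: R_def algebra_simps)
      finally have "2 * T * \<bar>tprim (G (s1 y)) (x, R) + s2 y * G (s1 y) (x, R)\<bar> \<le> 2 * T * (T * M)"
        using T by (intro mult_left_mono) auto
      thus ?thesis using T by (simp add: \<Psi>_time abs_mult power2_eq_square y_def[symmetric] R_def[symmetric] mult.assoc)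
    qed
    have "\<bar>integral {0..1} (\<lambda>\<zeta>. pdir (\<Psi> (Y T * \<zeta>)) (0,1) (x, T))\<bar> \<le> 2 * T\<^sup>2 * M * (1 - 0)"
      unfolding real_norm_def[symmetric]
      by (rule integral_bound) (use b in \<open>auto intro!: Cp_continuous_compose[OF Cp_pdir[OF C\<Psi>]] continuous_intros\<close>)
    thus "\<bar>pprim (\<lambda>y. pdir (\<Psi> y) (0,1)) (Y T) (x, T)\<bar> \<le> Y T * (2 * T\<^sup>2 * M)"
      using Y_pos[OF T(1)] by (simp add: pprim_def abs_mult mult_left_mono)
  qed
qed

text \<open>The second initial condition read in T: t \<psi>_t + \<psi> is the t-derivative of
  \<open>U\<close>, that is t^(-2/3) = 9 / T^2 times its T-derivative, and 3 t^(-1/3) = 9 / T. The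
  limits \<open>a\<close>, \<open>b\<close>, \<open>c\<close> treat the contributions of
  \<open>v0\<close>, \<open>v1\<close> and the source.\<close>

lemma tendsto_U1:
  "((\<lambda>T. 9 * U1 (0,1) (x, T) / T\<^sup>2 + 9 * dtt v0 (x, 0) / T) \<longlongrightarrow> v1 (x, 0)) (at_right 0)"
proof -
  let ?w = "dtt v0" and ?k = "\<lambda>T. pprim (\<lambda>y. pdir (\<Psi> y) (0,1)) (Y T) (x, T)"
  have a: "((\<lambda>T. (?w (x, T) - ?w (x, 0)) / T) \<longlongrightarrow> 0) (at_right 0)"
  proof (rule quotient_right_limit)
    show "((\<lambda>T. ?w (x, T)) has_real_derivative 0) (at 0)"
      using Cp_line[OF Cp_pdir[OF Cp_pdir[OF v0]], of "(0,1)" "(0,1)" "(x, 0)" "(0,1)" 0] pdir_vrr_zero[OF v0 v0_eq v0_ic, of x] by simp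
  qed
  have b: "((\<lambda>T. tprim v1 (x, T) / T) \<longlongrightarrow> v1 (x, 0)) (at_right 0)"
  proof -
    have "((\<lambda>T. tprim v1 (x, T)) has_real_derivative v1 (x, 0)) (at 0)"
      using Cp_line[OF Cp_tprim[OF v1], of "(x, 0)" "(0,1)" 0] pdir_tprim_time[OF v1, of "(x, 0)"] by simp
    from quotient_right_limit[OF this] show ?thesis by (simp add: tprim_zero)
  qed
  obtain M where M: "\<And>T. 0 < T \<Longrightarrow> T \<le> 1 \<Longrightarrow> \<bar>?k T\<bar> \<le> Y T * (2 * T\<^sup>2 * M)" using pprim_\<Psi>_bound by blast
  have c: "((\<lambda>T. ?k T / T\<^sup>2) \<longlongrightarrow> 0) (at_right 0)"
  proof (rule Lim_null_comparison)
    have "\<forall>\<^sub>F T::real in at_right 0. T < 1" using eventually_at_right_real[of 0 1] by (auto elim: eventually_mono)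
    thus "\<forall>\<^sub>F T in at_right 0. norm (?k T / T\<^sup>2) \<le> Y T * (2 * M)"
      using eventually_at_right_less[of 0]
    proof eventually_elim
      case (elim T)
      from M[of T] elim have "\<bar>?k T\<bar> / T\<^sup>2 \<le> Y T * (2 * T\<^sup>2 * M) / T\<^sup>2" by (intro divide_right_mono) auto
      thus ?case using elim by (simp add: abs_divide)
    qed
    have "((\<lambda>T. (T ^ 3 / 27) powr e) \<longlongrightarrow> 0 powr e) (at_right 0)"
    proof (intro tendsto_powr' tendsto_const disjI2 conjI)
      show "((\<lambda>T::real. T ^ 3 / 27) \<longlongrightarrow> 0) (at_right 0)"
        using tendsto_divide[OF tendsto_power[OF tendsto_ident_at, of 3 "0::real" "{0<..}"] tendsto_const[of 27]] by simp
    qed (use e in \<open>auto simp: eventually_at_filter\<close>)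
    hence "((\<lambda>T. Y T) \<longlongrightarrow> 0) (at_right 0)" by (simp add: Y_def)
    from tendsto_mult_left_zero[OF this, of "2 * M"] show "((\<lambda>T. Y T * (2 * M)) \<longlongrightarrow> 0) (at_right 0)" .
  qed
  have "((\<lambda>T. - 9 * ((?w (x, T) - ?w (x, 0)) / T) + tprim v1 (x, T) / T + 9 / (18 * e) * (?k T / T\<^sup>2)) \<longlongrightarrow> - 9 * 0 + v1 (x, 0) + 9 / (18 * e) * 0) (at_right 0)"
    by (intro tendsto_add tendsto_mult tendsto_const a b c)
  moreover have "\<forall>\<^sub>F T in at_right 0. - 9 * ((?w (x, T) - ?w (x, 0)) / T) + tprim v1 (x, T) / T + 9 / (18 * e) * (?k T / T\<^sup>2)
      = 9 * U1 (0,1) (x, T) / T\<^sup>2 + 9 * ?w (x, 0) / T"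
    using eventually_at_right_less[of 0]
  proof eventually_elim
    case (elim T)
    have u: "U1 (0,1) (x, T) = - (T * ?w (x, T)) + 1/18 * (2 * T * tprim v1 (x, T)) + 1 / (18 * e) * ?k T"
      using fun_cong[OF pdir_\<Phi>_time[where v="\<lambda>_::real. v1", OF v1, of 0], of "(x, T)"] fun_cong[OF epd_sol_time[OF v0], of "(x, T)"]
      by (simp add: U1_def pdir_uR)
    show ?case unfolding u using elim e by (simp add: field_simps power2_eq_square)
  qed
  ultimately show ?thesis by (simp add: filterlim_cong[OF refl refl])
qed

end

section \<open>Return to the time variable t\<close>

lemma powr_thirds:
  assumes "0 < t"
  shows "t powr (- real k / 3) = 1 / (t powr (1/3)) ^ k" and "(t powr (1/3)) ^ 3 = t"
proof -
  have c: "(t powr (1/3)) ^ k = t powr (real k / 3)" for k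
    using assms by (simp add: powr_powr flip: powr_realpow)
  have "t powr (- (real k / 3)) = inverse (t powr (real k / 3))" by (rule powr_minus)
  thus "t powr (- real k / 3) = 1 / (t powr (1/3)) ^ k" by (simp add: c inverse_eq_divide)
  show "(t powr (1/3)) ^ 3 = t" using c[of 3] assms by simp
qed

text \<open>With c = t^(1/3), \<open>A\<close>, \<open>B\<close> and \<open>S\<close> stand for U_T,
  U and the Laplacian of U at T = 3 c. U_TT has been replaced by means of the equation in T, whose
  source t^(7/3) f is \<open>c ^ 7 * F\<close>.\<close>

lemma change_of_time_identity:
  fixes c :: real
  assumes "0 < c"
  shows "(2 / (3 * c) * A + S + c ^ 7 * F) * (1 / c ^ 7) - 8/3 * A * (1 / c ^ 8) + 2 * B / (c ^ 3) ^ 3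
     - 1 / c ^ 4 * (S / c ^ 3) + 2 / c ^ 3 * (A * (1 / c ^ 5) - B / (c ^ 3)\<^sup>2) = F"
proof -
  define a where "a = 1 / c"
  have r: "y / c ^ k = y * a ^ k" "2 / (3 * c) = 2/3 * a" for k y
    by (simp_all add: a_def power_divide)
  \<comment> \<open>Writing the high powers of \<open>a\<close> through its cube keeps the degree of
    the polynomial identity low.\<close>
  define x where "x = a ^ 3"
  have x: "a ^ 4 = a * x" "a ^ 5 = a\<^sup>2 * x" "a ^ 6 = x\<^sup>2" "a ^ 7 = a * x\<^sup>2" "a ^ 8 = a\<^sup>2 * x\<^sup>2" "a ^ 9 = x ^ 3" "a ^ 3 = x"
    by (simp_all add: x_def eval_nat_numeral)
  have "c ^ 7 * a ^ 7 = 1" using assms by (simp add: a_def power_one_over)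
  hence u: "c ^ 7 * (a * x\<^sup>2) = 1" by (simp only: x)
  have "(2/3 * a * A + S + c ^ 7 * F) * (a * x\<^sup>2) - 8/3 * A * (a\<^sup>2 * x\<^sup>2) + 2 * B * x ^ 3 - a * x * (S * x)
     + 2 * x * (A * (a\<^sup>2 * x) - B * x\<^sup>2) = F * (c ^ 7 * (a * x\<^sup>2))"
    by (simp add: algebra_simps power2_eq_square power3_eq_cube)
  hence "(2/3 * a * A + S + c ^ 7 * F) * a ^ 7 - 8/3 * A * a ^ 8 + 2 * B * a ^ 9 - a ^ 4 * (S * a ^ 3)
     + 2 * a ^ 3 * (A * a ^ 5 - B * a ^ 6) = F"
    unfolding u x by simp
  moreover have "(c ^ 3) ^ 3 = c ^ 9" "(c ^ 3)\<^sup>2 = c ^ 6" by (simp_all flip: power_mult)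
  ultimately show ?thesis by (simp only: r mult_1)
qed

context wave_data
begin

lemma Y_time_change:
  assumes "0 < t" shows "Y (3 * t powr (1/3)) = t powr e"
  using powr_thirds(2)[OF assms] by (simp add: Y_def power_mult_distrib)

text \<open>Inside, \<open>rescaled_inner_integral\<close> turns the integral over s into
  \<open>\<Psi>\<close>; outside, y = (t b)^e absorbs the weight. The constant is 3/2 t^2 / (27 e
  t^3) = 1 / (18 e t). \<open>w \<tau>\<close> stands for the wave solution at x with data
  f(\<cdot>, \<tau>).\<close>

lemma source_integral:
  assumes t: "0 < t"
    and w: "\<And>\<tau> r. 0 < \<tau> \<Longrightarrow> w \<tau> r = \<tau> powr (e - 2) * G \<tau> (x, r)"
  shows "3/2 * t\<^sup>2 * integral {0..1} (\<lambda>b. integral {0..1 - root 3 b}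
        (\<lambda>s. b * w (t * b) (3 * t powr (1/3) * s) * (1 + b powr (2/3) - s\<^sup>2)))
    = 1 / (18 * e) * pprim \<Psi> (Y (3 * t powr (1/3))) (x, 3 * t powr (1/3)) / t"
proof -
  define c where "c = t powr (1/3)"
  have c: "0 < c" "c ^ 3 = t" using t powr_thirds(2)[OF t] by (auto simp: c_def)
  let ?T = "3 * c"
  let ?g = "\<lambda>b. (t * b) powr e" and ?g' = "\<lambda>b. e * t * (t * b) powr (e - 1)"
  have inner: "integral {0..1 - root 3 b} (\<lambda>s. b * w (t * b) (?T * s) * (1 + b powr (2/3) - s\<^sup>2))
      = 1 / (27 * e * t ^ 3) * (?g' b * \<Psi> (?g b) (x, ?T))" if b: "b \<in> {0..1}" for b
  \<comment> \<open>At b = 0 both sides are 0: the left one through the factor \<open>b\<close>, the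
    right one because \<open>powr\<close> gives 0 at base 0.\<close>
  proof (cases "b = 0")
    case False
    hence b0: "0 < b" "b \<le> 1" using b by auto
    let ?\<beta> = "root 3 b"
    have \<beta>: "?\<beta> = b powr (1/3)" using b0 by (simp add: root_powr_inverse)
    have \<beta>2: "b powr (2/3) = ?\<beta>\<^sup>2" using b0 by (simp add: \<beta> powr_powr flip: powr_realpow)
    have \<beta>01: "0 \<le> ?\<beta>" "?\<beta> \<le> 1" using b0 by auto
    have tb: "0 < t * b" using t b0 by simp
    have s1g: "s1 (?g b) = t * b" using tb e by (simp add: s1_def powr_powr)
    have s2g: "s2 (?g b) = ?T * ?\<beta>"
      using tb e b0 t by (simp add: s2_def powr_powr \<beta> c_def powr_mult)
    have "integral {0..1 - ?\<beta>} (\<lambda>s. b * w (t * b) (?T * s) * (1 + b powr (2/3) - s\<^sup>2))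
       = integral {0..1 - ?\<beta>} (\<lambda>s. (b * (t * b) powr (e - 2)) * (G (t * b) (x, ?T * s) * (1 + ?\<beta>\<^sup>2 - s\<^sup>2)))"
      by (simp add: w[OF tb] \<beta>2 mult.assoc)
    also have "\<dots> = b * (t * b) powr (e - 2) * integral {0..1 - ?\<beta>} (\<lambda>s. G (t * b) (x, ?T * s) * (1 + ?\<beta>\<^sup>2 - s\<^sup>2))"
      by (rule integral_mult_right)
    also have "integral {0..1 - ?\<beta>} (\<lambda>s. G (t * b) (x, ?T * s) * (1 + ?\<beta>\<^sup>2 - s\<^sup>2)) = \<Psi> (?g b) (x, ?T) / ?T ^ 3"
    proof -
      have ne: "?T ^ 3 \<noteq> 0" using c t by simp
      have "?T ^ 3 * integral {0..1 - ?\<beta>} (\<lambda>s. G (t * b) (x, ?T * s) * (1 + ?\<beta>\<^sup>2 - s\<^sup>2)) = \<Phi> (G (t * b)) (?T * ?\<beta>) (x, ?T)"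
        by (rule rescaled_inner_integral[OF \<beta>01]) (intro Cp_continuous_compose[OF G] continuous_intros)
      thus ?thesis unfolding \<Psi>_def s1g s2g by (intro eq_divide_imp[OF ne]) (subst mult.commute)
    qed
    also have "?T ^ 3 = 27 * t" using c by (simp add: power_mult_distrib)
    also have "b * (t * b) powr (e - 2) * (\<Psi> (?g b) (x, ?T) / (27 * t)) = 1 / (27 * e * t ^ 3) * (?g' b * \<Psi> (?g b) (x, ?T))"
    proof -
      have "(t * b) powr (e - 1) = (t * b) powr (e - 2) * (t * b)"
        using tb powr_add[of "t * b" "e - 2" 1] by simp
      thus ?thesis using e t by (simp add: field_simps power3_eq_cube)
    qed
    finally show ?thesis .
  qed simp
  have "((\<lambda>b. ?g' b *\<^sub>R \<Psi> (?g b) (x, ?T)) has_integral (integral {?g 0..?g 1} (\<lambda>y. \<Psi> y (x, ?T)))) {0..1}"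
  \<comment> \<open>For e < 1 the substitution is not differentiable at b = 0, hence the exceptional
    point.\<close>
  proof (rule has_integral_substitution_strong[where s="{0}" and c=0 and d="t powr e"])
    show "continuous_on {0..t powr e} (\<lambda>y. \<Psi> y (x, ?T))"
      by (intro Cp_continuous_compose[OF C\<Psi>] continuous_intros)
    show "continuous_on {0..1} ?g" using e t by (intro continuous_on_powr' continuous_intros) auto
    show "(?g has_field_derivative ?g' b) (at b within {0..1})" if "b \<in> {0..1} - {0}" for b
      using that t by (auto intro!: derivative_eq_intros)
    show "?g ` {0..1} \<subseteq> {0..t powr e}" using t e by (auto intro!: powr_mono2 mult_left_le)
  qed (use t e in auto)
  hence I: "integral {0..1} (\<lambda>b. ?g' b * \<Psi> (?g b) (x, ?T)) = pprim \<Psi> (t powr e) (x, ?T)"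
    using pprim_integral[OF C\<Psi>, of "t powr e"] by (simp add: integral_unique)
  have "integral {0..1} (\<lambda>b. integral {0..1 - root 3 b} (\<lambda>s. b * w (t * b) (?T * s) * (1 + b powr (2/3) - s\<^sup>2)))
     = integral {0..1} (\<lambda>b. 1 / (27 * e * t ^ 3) * (?g' b * \<Psi> (?g b) (x, ?T)))"
    by (rule integral_cong) (rule inner)
  also have "\<dots> = 1 / (27 * e * t ^ 3) * pprim \<Psi> (t powr e) (x, ?T)"
    unfolding I[symmetric] by (rule integral_mult_right)
  finally show ?thesis
    using t e unfolding Y_time_change[OF t] by (simp add: c_def[symmetric] field_simps power2_eq_square power3_eq_cube)
qed

lemma U_over_t:
  assumes t: "0 < t" and w: "\<And>\<tau> r. 0 < \<tau> \<Longrightarrow> w \<tau> r = \<tau> powr (e - 2) * G \<tau> (x, r)"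
  shows "3/2 * t\<^sup>2 * integral {0..1} (\<lambda>b. integral {0..1 - root 3 b}
        (\<lambda>s. b * w (t * b) (3 * t powr (1/3) * s) * (1 + b powr (2/3) - s\<^sup>2)))
      + (1 / t) * v0 (x, 3 * t powr (1/3)) - 3 * t powr (-2/3) * pdir v0 (0,1) (x, 3 * t powr (1/3))
      + 3/2 * integral {0..1} (\<lambda>s. v1 (x, 3 * t powr (1/3) * s) * (1 - s\<^sup>2))
    = U (x, 3 * t powr (1/3)) / t"
proof -
  define c where "c = t powr (1/3)"
  have c: "0 < c" "c ^ 3 = t" using t powr_thirds(2)[OF t] by (auto simp: c_def)
  have p: "t powr (-2/3) = 1 / c\<^sup>2" using powr_thirds(1)[OF t, of 2] by (simp add: c_def)
  \<comment> \<open>With \<beta> = 0 the integral runs over the whole unit interval and the kernel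
    is 1 - s^2.\<close>
  have "(3 * c) ^ 3 * integral {0..1 - 0} (\<lambda>s. v1 (x, 3 * c * s) * (1 + 0\<^sup>2 - s\<^sup>2)) = \<Phi> v1 (3 * c * 0) (x, 3 * c)"
    by (rule rescaled_inner_integral) (auto intro!: Cp_continuous_compose[OF v1 continuous_on_const] continuous_intros simp del: Cp.simps)
  hence 1: "3/2 * integral {0..1} (\<lambda>s. v1 (x, 3 * c * s) * (1 - s\<^sup>2)) = 1/18 * \<Phi> v1 0 (x, 3 * c) / t"
    using c t by (simp add: power_mult_distrib field_simps)
  have 0: "(1 / t) * v0 (x, 3 * c) - 3 * (1 / c\<^sup>2) * pdir v0 (0,1) (x, 3 * c) = epd_sol v0 (x, 3 * c) / t"
    using c unfolding c(2)[symmetric] by (simp add: epd_sol_def field_simps power2_eq_square power3_eq_cube)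
  show ?thesis
    unfolding p c_def[symmetric] using source_integral[OF assms, folded c_def] 0 1
    by (simp add: U_def uR_def add_divide_distrib)
qed

text \<open>All claims are local to t > 0, so \<open>\<psi>\<close> is tied to U / t there and may
  be arbitrary elsewhere.\<close>

lemma change_of_time:
  assumes \<psi>: "\<And>x t. 0 < t \<Longrightarrow> \<psi> (x, t) = U (x, 3 * t powr (1/3)) / t"
  shows "Ck_on 2 (UNIV \<times> {0<..}) \<psi>"
    and "0 < t \<Longrightarrow> dtt \<psi> (x, t) - t powr (-4/3) * Lap \<psi> (x, t)
       + 2 / t * pdir \<psi> (0,1) (x, t) = f (x, t)"
    and "((\<lambda>t. t * \<psi> (x, t)) \<longlongrightarrow> v0 (x, 0)) (at_right 0)"
    and "((\<lambda>t. t * pdir \<psi> (0,1) (x, t) + \<psi> (x, t) + 3 * t powr (-1/3) * dtt v0 (x, 0)) \<longlongrightarrow> v1 (x, 0)) (at_right 0)"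
proof -
  have C: "C2_half \<psi> (time_change1 U U1) (time_change2 U U1 U2)"
  proof (rule C2_half_cong[OF C2_half_time_change[OF C2_U]])
    show "\<psi> z = U (fst z, 3 * snd z powr (1/3)) / snd z" if "z \<in> upper_half" for z
      using \<psi>[of "snd z" "fst z"] that by (simp add: in_upper_half_iff)
  qed
  from C2_half_Ck_on[OF this] show "Ck_on 2 (UNIV \<times> {0<..}) \<psi>" by (simp add: upper_half_def)
  have B1: "(0, 1) \<in> (Basis :: ('a \<times> real) set)" and Bb: "b \<in> Basis \<Longrightarrow> (b, 0) \<in> (Basis :: ('a \<times> real) set)" for b
    by (auto simp: Basis_prod_def)
  note P = C2_half_pdir[OF C]
  have tt: "pdir \<psi> (0,1) (x, t) = U1 (0,1) (x, 3 * t powr (1/3)) * t powr (-5/3) - U (x, 3 * t powr (1/3)) / t\<^sup>2" if "0 < t" for t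
    using P(1)[OF B1 B1, of "(x, t)"] that by (simp add: time_change1_def Let_def in_upper_half_iff)
  show "dtt \<psi> (x, t) - t powr (-4/3) * Lap \<psi> (x, t)
       + 2 / t * pdir \<psi> (0,1) (x, t) = f (x, t)" if t: "0 < t"
  proof -
    define c where "c = t powr (1/3)"
    have c: "0 < c" "t = c ^ 3" using t powr_thirds(2)[OF t] by (auto simp: c_def)
    let ?z = "(x, 3 * c)"
    have p: "t powr (-4/3) = 1 / c ^ 4" "t powr (-5/3) = 1 / c ^ 5" "t powr (-7/3) = 1 / c ^ 7" "t powr (-8/3) = 1 / c ^ 8"
      using powr_thirds(1)[OF t, of 4] powr_thirds(1)[OF t, of 5] powr_thirds(1)[OF t, of 7] powr_thirds(1)[OF t, of 8] by (simp_all add: c_def)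
    have 1: "pdir \<psi> (0,1) (x, t) = U1 (0,1) ?z * (1 / c ^ 5) - U ?z / t\<^sup>2"
      using tt[OF t] unfolding p c_def[symmetric] .
    have 2: "dtt \<psi> (x, t) = U2 (0,1) (0,1) ?z * (1 / c ^ 7) - 8/3 * U1 (0,1) ?z * (1 / c ^ 8) + 2 * U ?z / t ^ 3"
      using P(2)[OF B1 B1, of "(x, t)"] t by (simp add: time_change2_def Let_def in_upper_half_iff p[simplified] c_def[symmetric])
    have "pdir (pdir \<psi> (b,0)) (b,0) (x, t) = U2 (b,0) (b,0) ?z / t" if "b \<in> Basis" for b
      using P(2)[OF Bb[OF that] Bb[OF that], of "(x, t)"] t by (simp add: time_change2_def Let_def in_upper_half_iff c_def[symmetric])
    hence 3: "Lap \<psi> (x, t) = (\<Sum>b\<in>Basis. U2 (b,0) (b,0) ?z) / t"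
      by (simp add: sum_divide_distrib)
    define S where "S = (\<Sum>b\<in>Basis. U2 (b,0) (b,0) ?z)"
    \<comment> \<open>\<open>U_EPD\<close> at T = 3 c, where T^3 / 27 = t = c^3 and T^4 / 81 =
      c^4.\<close>
    have E: "U2 (0,1) (0,1) ?z = 2 / (3 * c) * U1 (0,1) ?z + S + c ^ 7 * f (x, t)"
      using U_EPD[of "3 * c" x] c by (simp add: S_def power_mult_distrib flip: power_add)
    show ?thesis unfolding 1 2 3 p S_def[symmetric] E
      using change_of_time_identity[OF c(1), of "U1 (0,1) ?z" S "f (x, t)" "U ?z"] unfolding c(2) by simp
  qed
  have ev: "\<forall>\<^sub>F t::real in at_right 0. 0 < t" by (rule eventually_at_right_less)
  show "((\<lambda>t. t * \<psi> (x, t)) \<longlongrightarrow> v0 (x, 0)) (at_right 0)"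
    by (rule Lim_transform_eventually[OF tendsto_U]) (use ev in eventually_elim, simp add: \<psi>)
  have T: "filterlim (\<lambda>t::real. 3 * t powr (1/3)) (at_right 0) (at_right 0)"
    unfolding filterlim_at
    using tendsto_mult_right_zero[OF powr_tendsto_0_right[of "1/3"], of 3] ev by (auto elim!: eventually_mono)
  show "((\<lambda>t. t * pdir \<psi> (0,1) (x, t) + \<psi> (x, t) + 3 * t powr (-1/3) * dtt v0 (x, 0)) \<longlongrightarrow> v1 (x, 0)) (at_right 0)"
  proof (rule Lim_transform_eventually[OF filterlim_compose[OF tendsto_U1 T]], use ev in eventually_elim)
    fix t :: real assume t: "0 < t"
    define c where "c = t powr (1/3)"
    have c: "0 < c" "t = c ^ 3" using t powr_thirds(2)[OF t] by (auto simp: c_def)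
    have p: "t powr (-1/3) = 1 / c" "t powr (-5/3) = 1 / c ^ 5"
      using powr_thirds(1)[OF t, of 1] powr_thirds(1)[OF t, of 5] by (simp_all add: c_def)
    show "9 * U1 (0,1) (x, 3 * t powr (1/3)) / (3 * t powr (1/3))\<^sup>2 + 9 * dtt v0 (x, 0) / (3 * t powr (1/3))
       = t * pdir \<psi> (0,1) (x, t) + \<psi> (x, t) + 3 * t powr (-1/3) * dtt v0 (x, 0)"
      unfolding tt[OF t] \<psi>[OF t] p c_def[symmetric] using c(1) unfolding c(2)
      by (simp add: field_simps power2_eq_square eval_nat_numeral)
  qed
qed

end

section \<open>The representation formula for the original data\<close>

theorem theorem1p1:
  fixes \<phi>0 \<phi>1 :: "real^'n::finite \<Rightarrow> real" and f :: "(real^'n) \<times> real \<Rightarrow> real"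
  assumes phi0: "Ck_on (CARD('n) div 2 + 3) UNIV \<phi>0"
    and phi1: "Ck_on (CARD('n) div 2 + 2) UNIV \<phi>1"
    and freg: "Ck_on (CARD('n) div 2 + 2) (UNIV \<times> {0<..}) f"
    and fbound: "\<exists>\<epsilon>>0. \<forall>\<alpha> \<beta>.
        set \<alpha> \<subseteq> (\<lambda>i. (axis i 1, 0)) ` UNIV \<and> length \<alpha> \<le> CARD('n) div 2 + 2 \<and>
        set \<beta> \<subseteq> (\<lambda>i. (axis i 1, 0)) ` UNIV \<and> length \<beta> \<le> CARD('n) div 2 + 1 \<longrightarrow>
        (\<exists>C. \<exists>\<delta>>0. \<forall>x t. 0 < t \<and> t < \<delta> \<longrightarrow>
           \<bar>pdirs f \<alpha> (x, t)\<bar> + \<bar>t * pdir (pdirs f \<beta>) (0, 1) (x, t)\<bar> \<le> C * t powr (\<epsilon> - 2))"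
  shows "Ck_on 2 (UNIV \<times> {0<..}) (\<lambda>(x, t). psi f \<phi>0 \<phi>1 x t)
    \<and> (\<forall>x t. 0 < t \<longrightarrow>
         pdir (pdir (\<lambda>(y, s). psi f \<phi>0 \<phi>1 y s) (0, 1)) (0, 1) (x, t)
         - t powr (-4/3) * lapx (\<lambda>(y, s). psi f \<phi>0 \<phi>1 y s) (x, t)
         + 2 / t * pdir (\<lambda>(y, s). psi f \<phi>0 \<phi>1 y s) (0, 1) (x, t) = f (x, t))
    \<and> (\<forall>x. ((\<lambda>t. t * psi f \<phi>0 \<phi>1 x t) \<longlongrightarrow> \<phi>0 x) (at_right 0))
    \<and> (\<forall>x. ((\<lambda>t. t * pdir (\<lambda>(y, s). psi f \<phi>0 \<phi>1 y s) (0, 1) (x, t) + psi f \<phi>0 \<phi>1 x t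
               + 3 * t powr (-1/3) * lap \<phi>0 x) \<longlongrightarrow> \<phi>1 x) (at_right 0))"
proof -
  let ?m = "CARD('n) div 2"
  have h0: "Cp (?m + Suc (Suc (Suc 0))) (\<lambda>_::real. \<phi>0)"
    using Ck_on_imp_Cp[OF phi0, of "[]" "?m + Suc (Suc (Suc 0))"] by (simp del: Cp.simps)
  have h1: "Cp (?m + Suc (Suc 0)) (\<lambda>_::real. \<phi>1)"
    using Ck_on_imp_Cp[OF phi1, of "[]" "?m + Suc (Suc 0)"] by (simp del: Cp.simps)
  obtain \<epsilon> where \<epsilon>: "\<epsilon> > 0" and fb: "\<And>\<alpha> \<beta>.
        set \<alpha> \<subseteq> (\<lambda>i. (axis i 1, 0)) ` UNIV \<and> length \<alpha> \<le> ?m + 2 \<and>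
        set \<beta> \<subseteq> (\<lambda>i. (axis i 1, 0)) ` UNIV \<and> length \<beta> \<le> ?m + 1 \<Longrightarrow>
        \<exists>C. \<exists>\<delta>>0. \<forall>x t. 0 < t \<and> t < \<delta> \<longrightarrow>
           \<bar>pdirs f \<alpha> (x, t)\<bar> + \<bar>t * pdir (pdirs f \<beta>) (0, 1) (x, t)\<bar> \<le> C * t powr (\<epsilon> - 2)"
    using fbound by blast
  define e where "e = \<epsilon> / 2"
  have e: "e > 0" using \<epsilon> by (simp add: e_def)
  define F where "F \<tau> x = (if \<tau> > 0 then \<tau> powr (2 - e) * f (x, \<tau>) else 0)" for \<tau> x
  have "Cp (?m + 2) F"
    unfolding F_def[abs_def]
  proof (rule Cp_powr_extension[OF freg e])
    fix \<alpha> :: "(real^'n) list" assume \<alpha>: "set \<alpha> \<subseteq> Basis" "length \<alpha> \<le> ?m + 2"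
    have "set (map (\<lambda>b. (b, 0::real)) \<alpha>) \<subseteq> (\<lambda>i. (axis i 1, 0)) ` UNIV"
      using \<alpha>(1) by (auto simp: Basis_vec_real)
    then obtain C \<delta> where "\<delta> > 0" and C: "\<And>x t. 0 < t \<and> t < \<delta> \<Longrightarrow>
        \<bar>pdirs f (map (\<lambda>b. (b, 0)) \<alpha>) (x, t)\<bar> + \<bar>t * pdir (pdirs f []) (0, 1) (x, t)\<bar> \<le> C * t powr (\<epsilon> - 2)"
      using fb[of "map (\<lambda>b. (b, 0)) \<alpha>" "[]"] \<alpha>(2) by auto
    have "\<bar>pdirs f (map (\<lambda>b. (b, 0)) \<alpha>) (x, t)\<bar> \<le> C * t powr (2 * e - 2)" if "0 < t \<and> t < \<delta>" for x t
      using C[OF that, of x] by (simp add: e_def)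
    thus "\<exists>C. \<exists>\<delta>>0. \<forall>x t. 0 < t \<and> t < \<delta> \<longrightarrow> \<bar>pdirs f (map (\<lambda>b. (b, 0)) \<alpha>) (x, t)\<bar> \<le> C * t powr (2 * e - 2)"
      using \<open>\<delta> > 0\<close> by blast
  qed
  hence hF: "Cp (?m + Suc (Suc 0)) F" by (simp add: numeral_2_eq_2 del: Cp.simps)
  note A0 = wave_op_axes[OF h0] and A1 = wave_op_axes[OF h1] and AF = wave_op_axes[OF hF]
  interpret wave_data "wave_op axes \<phi>0" "wave_op axes \<phi>1" "\<lambda>\<tau>. wave_op axes (F \<tau>)" f e
    by (unfold_locales; (rule A0 A1 AF e)?) (simp add: AF(2) F_def)
  have w0: "wave \<phi>0 x r = wave_op axes \<phi>0 (x, r)" for x r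
    using wave_eqI[OF wave_op_axes_sol[OF h0, of 1], of x r] by simp
  have w1: "wave \<phi>1 x r = wave_op axes \<phi>1 (x, r)" for x r
    using wave_eqI[OF wave_op_axes_sol[OF h1, of 1], of x r] by simp
  \<comment> \<open>Undoing the weight: for \<tau> > 0 the data f(\<cdot>, \<tau>) are \<tau>^(e -
    2) times \<open>F \<tau>\<close>, and the solution is linear in the data.\<close>
  have wf: "wave (\<lambda>y. f (y, \<tau>)) x r = \<tau> powr (e - 2) * wave_op axes (F \<tau>) (x, r)" if "0 < \<tau>" for \<tau> x r
  proof -
    have "(\<lambda>y. f (y, \<tau>)) = (\<lambda>y. \<tau> powr (e - 2) * F \<tau> y)"
      using that by (auto simp: F_def simp flip: mult.assoc powr_add)
    thus ?thesis using wave_eqI[OF wave_op_axes_sol[OF hF, of "\<tau> powr (e - 2)" \<tau>], of x r] by simp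
  qed
  have wdr: "wave_dr \<phi>0 x r = pdir (wave_op axes \<phi>0) (0,1) (x, r)" for x r
    using DERIV_imp_deriv[OF Cp_line[OF A0(1), of "(x, 0)" "(0,1)" r]] by (simp add: wave_dr_def w0)
  let ?\<psi> = "\<lambda>(x, t). psi f \<phi>0 \<phi>1 x t"
  have \<psi>: "?\<psi> (x, t) = U (x, 3 * t powr (1/3)) / t" if "0 < t" for x t
    using U_over_t[OF that wf, of x] unfolding psi_def w0 w1 wdr prod.case by simp
  note L = change_of_time[of ?\<psi>, OF \<psi>]
  \<comment> \<open>At r = 0 the wave equation turns the second time derivative into the Laplacian
    of the initial value.\<close>
  have lap0: "dtt (wave_op axes \<phi>0) (x, 0) = lap \<phi>0 x" for x
  proof -
    have "pdir (wave_op axes \<phi>0) (b,0) (y, 0) = pdir \<phi>0 b y" for b y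
      using pdir_slice(2)[OF A0(1), of 0 b y] by (simp add: A0(2))
    hence "pdir (pdir (wave_op axes \<phi>0) (b,0)) (b,0) (x, 0) = pdir (pdir \<phi>0 b) b x" for b
      using pdir_slice(2)[OF Cp_pdir[OF A0(1)], of "(b,0)" 0 b x] by simp
    thus ?thesis by (simp add: A0(4) lap_eq)
  qed
  show ?thesis
  proof (intro conjI allI impI)
    show "Ck_on 2 (UNIV \<times> {0<..}) ?\<psi>" by (rule L(1))
  next
    fix x t assume "0 < (t::real)"
    from L(2)[OF _ this, of x]
    show "dtt ?\<psi> (x, t) - t powr (-4/3) * lapx ?\<psi> (x, t) + 2 / t * pdir ?\<psi> (0,1) (x, t) = f (x, t)"
      by (simp add: lapx_eq)
  next
    fix x
    show "((\<lambda>t. t * psi f \<phi>0 \<phi>1 x t) \<longlongrightarrow> \<phi>0 x) (at_right 0)"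
      using L(3)[of x] by (simp add: A0(2))
    show "((\<lambda>t. t * pdir ?\<psi> (0, 1) (x, t) + psi f \<phi>0 \<phi>1 x t + 3 * t powr (-1/3) * lap \<phi>0 x) \<longlongrightarrow> \<phi>1 x) (at_right 0)"
      using L(4)[of x] by (simp add: A1(2) lap0)
  qed
qed

end
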